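(* Let $S\subset\mathbb P^4$ be a smooth nondegenerate surface of degree $3$, viewed as the blow-up of $\mathbb P^2$ at a point $P$ (embedded by the linear system $|2h-e|$). Let $C_1,C_2$ be distinct reduced, irreducible curves on $S$ of degrees $d_1,d_2\ge 2$. Then $|C_1\cap C_2|\le B(d_1,d_2)$. Moreover the bound is sharp and (up to exchanging the roles of the two curves) it is achieved by suitable reduced irreducible curves $C_1,C_2$ as follows: - if $d_1\le d_2$ are both even, or if $d_1$ is even and $d_2$ is odd, by curves whose classes are $\frac{d_1}{2}h$ and $(d_2-1)h-(d_2-2)e$; - if $d_1$ and $d_2$ are both odd, by curves whose classes are $\frac{d_1+1}{2}h-e$ and $(d_2-1)h-(d_2-2)e$.
   Context: We work over $\mathbb C$. $h$ is the divisor class on $S$ coming from a line in $\mathbb P^2$ and $e$ is the class of the exceptional divisor; the hyperplane class of $S\subset\mathbb P^4$ is $2h-e$. $|C_1\cap C_2|$ counts intersection points without multiplicity. For positive integers $d_1,d_2$ define $$B(d_1,d_2)=\begin{cases}\frac{d_1(d_2-1)}{2} & \text{if both are even and } d_1\le d_2,\text{ or } d_1 \text{ even and } d_2\text{ odd},\\ \frac{(d_1-1)d_2}{2} & \text{if both are even and } d_1\ge d_2,\text{ or } d_1\text{ odd and } d_2\text{ even},\\ \frac{(d_1-1)(d_2-1)}{2}+1 & \text{if both are odd}.\end{cases}$$ *)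

theory Defs
  imports "HOL-Analysis.Analysis" "HOL-Library.Poly_Mapping"
begin

section \<open>Complex projective space\<close>

text \<open>A point of the projective space with homogeneous coordinates indexed by \<open>'n\<close> is a line
  through the origin of \<open>complex ^ 'n\<close>; thus \<open>3 proj\<close> is the projective plane and \<open>5 proj\<close> is
  projective 4-space.\<close>

typedef ('n::finite) proj = "{L :: (complex ^ 'n) set. vec.subspace L \<and> vec.dim L = 1}"
  morphisms lin Abs_proj
proof -
  have "vec.dim (vec.span {1 :: complex ^ 'n}) = 1"
    by (simp add: vec.dim_span)
  then show ?thesis
    using vec.subspace_span by blast
qed

text \<open>The algebra of functions generated by \<open>A\<close>. Since the complex field is infinite, polynomials
  and polynomial functions are the same thing.\<close>

inductive_set poly_alg :: "('v \<Rightarrow> complex) set \<Rightarrow> ('v \<Rightarrow> complex) set"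
  for A :: "('v \<Rightarrow> complex) set" where
  gen: "f \<in> A \<Longrightarrow> f \<in> poly_alg A"
| const: "(\<lambda>_. c) \<in> poly_alg A"
| add: "f \<in> poly_alg A \<Longrightarrow> g \<in> poly_alg A \<Longrightarrow> (\<lambda>x. f x + g x) \<in> poly_alg A"
| mult: "f \<in> poly_alg A \<Longrightarrow> g \<in> poly_alg A \<Longrightarrow> (\<lambda>x. f x * g x) \<in> poly_alg A"

definition polys :: "(complex ^ 'n \<Rightarrow> complex) set" where
  "polys = poly_alg (range (\<lambda>i x. x $ i))"

definition hom_poly :: "nat \<Rightarrow> (complex ^ 'n \<Rightarrow> complex) \<Rightarrow> bool" where
  "hom_poly d F \<longleftrightarrow> F \<in> polys \<and> (\<forall>c x. F (c *s x) = c ^ d * F x)"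

definition vanishes :: "(complex ^ 'n \<Rightarrow> complex) \<Rightarrow> ('n::finite) proj \<Rightarrow> bool" where
  "vanishes F p \<longleftrightarrow> (\<forall>v \<in> lin p. F v = 0)"

definition proj_closed :: "('n::finite) proj set \<Rightarrow> bool" where
  "proj_closed X \<longleftrightarrow> (\<exists>T. (\<forall>F \<in> T. \<exists>d. hom_poly d F) \<and> X = {p. \<forall>F \<in> T. vanishes F p})"

definition variety :: "('n::finite) proj set \<Rightarrow> bool" where
  "variety X \<longleftrightarrow> proj_closed X \<and> X \<noteq> {} \<and>
     (\<forall>Y Z. proj_closed Y \<longrightarrow> proj_closed Z \<longrightarrow> X = Y \<union> Z \<longrightarrow> X = Y \<or> X = Z)"

definition variety_chain :: "('n::finite) proj set \<Rightarrow> nat \<Rightarrow> bool" where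
  "variety_chain X k \<longleftrightarrow> (\<exists>Z :: nat \<Rightarrow> 'n proj set.
     (\<forall>i \<le> k. variety (Z i) \<and> Z i \<subseteq> X) \<and> (\<forall>i < k. Z i \<subset> Z (Suc i)))"

text \<open>Krull dimension.\<close>

definition has_dim :: "('n::finite) proj set \<Rightarrow> nat \<Rightarrow> bool" where
  "has_dim X k \<longleftrightarrow> variety_chain X k \<and> \<not> variety_chain X (Suc k)"

definition hyperplane :: "complex ^ 'n \<Rightarrow> ('n::finite) proj set" where
  "hyperplane a = {p. vanishes (\<lambda>v. \<Sum>i\<in>UNIV. a $ i * v $ i) p}"

definition nondegenerate :: "('n::finite) proj set \<Rightarrow> bool" where
  "nondegenerate X \<longleftrightarrow> (\<forall>a. a \<noteq> 0 \<longrightarrow> \<not> X \<subseteq> hyperplane a)"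

text \<open>The degree of a \<open>k\<close>-dimensional variety is the number of points in which it meets \<open>k\<close> general
  hyperplanes. General means: off the zero set of some nonzero polynomial \<open>G\<close> in the coefficients
  of the \<open>k\<close> linear forms \<open>l 0, \<dots>, l (k - 1)\<close>.\<close>

definition has_degree :: "('n::finite) proj set \<Rightarrow> nat \<Rightarrow> bool" where
  "has_degree X d \<longleftrightarrow> (\<exists>k. has_dim X k \<and>
     (\<exists>G \<in> poly_alg {(\<lambda>l :: nat \<Rightarrow> complex ^ 'n. l j $ i) | j i. j < k}.
        (\<exists>l. G l \<noteq> 0) \<and>
        (\<forall>l. G l \<noteq> 0 \<longrightarrow> finite (X \<inter> (\<Inter>j<k. hyperplane (l j))) \<and>
                          card (X \<inter> (\<Inter>j<k. hyperplane (l j))) = d)))"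

definition ideal_of :: "('n::finite) proj set \<Rightarrow> (complex ^ 'n \<Rightarrow> complex) set" where
  "ideal_of X = {F \<in> polys. \<forall>p \<in> X. vanishes F p}"

definition dir_deriv :: "(complex ^ 'n \<Rightarrow> complex) \<Rightarrow> complex ^ 'n \<Rightarrow> complex ^ 'n \<Rightarrow> complex" where
  "dir_deriv F v w = deriv (\<lambda>t. F (v + t *s w)) 0"

text \<open>Jacobian criterion, on the affine cone: its Zariski tangent space at a nonzero vector has
  dimension one more than the variety.\<close>

definition smooth_variety :: "('n::finite) proj set \<Rightarrow> bool" where
  "smooth_variety X \<longleftrightarrow> variety X \<and> (\<exists>k. has_dim X k \<and>
     (\<forall>p \<in> X. \<forall>v \<in> lin p. v \<noteq> 0 \<longrightarrow>
        vec.dim {w. \<forall>F \<in> ideal_of X. dir_deriv F v w = 0} = k + 1))"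

definition smooth_nondegenerate_surface :: "('n::finite) proj set \<Rightarrow> bool" where
  "smooth_nondegenerate_surface S \<longleftrightarrow> smooth_variety S \<and> has_dim S 2 \<and> nondegenerate S"

definition curve_on :: "('n::finite) proj set \<Rightarrow> 'n proj set \<Rightarrow> bool" where
  "curve_on S C \<longleftrightarrow> variety C \<and> has_dim C 1 \<and> C \<subseteq> S"


section \<open>Linear equivalence of divisors on a smooth surface\<close>

primrec ideal_pow :: "('v \<Rightarrow> complex) set \<Rightarrow> ('v \<Rightarrow> complex) set \<Rightarrow> nat \<Rightarrow> ('v \<Rightarrow> complex) set" where
  "ideal_pow R I 0 = R"
| "ideal_pow R I (Suc n) =
     {(\<lambda>x. \<Sum>i<k. f i x * g i x) | (k::nat) f g. (\<forall>i<k. f i \<in> I \<and> g i \<in> ideal_pow R I n)}"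

text \<open>Order of vanishing along the curve \<open>C\<close> of (the restriction to \<open>S\<close> of) a form \<open>F\<close>: the largest
  \<open>n\<close> such that \<open>F\<close> lies in the \<open>n\<close>-th power of the maximal ideal of the local ring of \<open>S\<close> along
  \<open>C\<close>. Membership in the localization is expressed by a denominator \<open>G\<close> not vanishing on \<open>C\<close>.\<close>

definition vanishing_order ::
  "('n::finite) proj set \<Rightarrow> 'n proj set \<Rightarrow> (complex ^ 'n \<Rightarrow> complex) \<Rightarrow> nat" where
  "vanishing_order S C F = (GREATEST n. \<exists>G \<in> polys - ideal_of C.
     \<exists>A \<in> ideal_pow polys (ideal_of C) n. \<exists>B \<in> ideal_of S. \<forall>x. G x * F x = A x + B x)"

text \<open>Divisors are elements of the free abelian group on the curves on \<open>S\<close>. A nonzero rational function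
  on \<open>S\<close> is a quotient \<open>F / G\<close> of two forms of the same degree which do not vanish identically
  on \<open>S\<close>.\<close>

definition divisor_on :: "('n::finite) proj set \<Rightarrow> ('n proj set \<Rightarrow>\<^sub>0 int) \<Rightarrow> bool" where
  "divisor_on S D \<longleftrightarrow> Poly_Mapping.keys D \<subseteq> {C. curve_on S C}"

definition principal_on :: "('n::finite) proj set \<Rightarrow> ('n proj set \<Rightarrow>\<^sub>0 int) \<Rightarrow> bool" where
  "principal_on S D \<longleftrightarrow> divisor_on S D \<and>
     (\<exists>m F G. hom_poly m F \<and> hom_poly m G \<and> F \<notin> ideal_of S \<and> G \<notin> ideal_of S \<and>
        (\<forall>C. curve_on S C \<longrightarrow> Poly_Mapping.lookup D C =
           int (vanishing_order S C F) - int (vanishing_order S C G)))"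

definition lin_equiv ::
  "('n::finite) proj set \<Rightarrow> ('n proj set \<Rightarrow>\<^sub>0 int) \<Rightarrow> ('n proj set \<Rightarrow>\<^sub>0 int) \<Rightarrow> bool" where
  "lin_equiv S D D' \<longleftrightarrow> divisor_on S D \<and> divisor_on S D' \<and> principal_on S (D - D')"


section \<open>The blow-up of the plane at a point, embedded by conics through the point\<close>

definition proj_line :: "3 proj set \<Rightarrow> bool" where
  "proj_line L \<longleftrightarrow> (\<exists>a. a \<noteq> 0 \<and> L = hyperplane a)"

definition blow_up :: "3 proj \<Rightarrow> (3 proj \<times> 3 proj set) set" where
  "blow_up P = {(x, L). proj_line L \<and> P \<in> L \<and> x \<in> L}"

text \<open>The sections of \<open>2h - e\<close> are the conics through \<open>P\<close>; the components of \<open>q\<close> form a basis of the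
  space of these.\<close>

definition conic_basis :: "3 proj \<Rightarrow> (complex ^ 3 \<Rightarrow> complex ^ 5) \<Rightarrow> bool" where
  "conic_basis P q \<longleftrightarrow>
     (\<forall>i. hom_poly 2 (\<lambda>v. q v $ i) \<and> vanishes (\<lambda>v. q v $ i) P) \<and>
     (\<forall>Q. hom_poly 2 Q \<and> vanishes Q P \<longrightarrow>
        (\<exists>!a :: complex ^ 5. \<forall>v. Q v = (\<Sum>i\<in>UNIV. a $ i * q v $ i)))"

text \<open>The map from the blow-up to projective 4-space given by these sections. Off the exceptional
  curve it is \<open>x \<mapsto> [q(x)]\<close>. At the point of the exceptional curve given by a line \<open>L\<close> through \<open>P\<close>,
  all the conics vanish at \<open>P\<close>, and dividing by the local equation of the exceptional curve leaves
  the derivative of \<open>q\<close> at \<open>P\<close> in the direction of \<open>L\<close>.\<close>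

definition conic_map ::
  "3 proj \<Rightarrow> (complex ^ 3 \<Rightarrow> complex ^ 5) \<Rightarrow> 3 proj \<times> 3 proj set \<Rightarrow> 5 proj" where
  "conic_map P q = (\<lambda>(x, L). THE y.
     if x \<noteq> P then \<forall>v \<in> lin x. q v \<in> lin y
     else \<forall>v \<in> lin P. \<forall>z \<in> L. \<forall>w \<in> lin z. (\<chi> i. dir_deriv (\<lambda>u. q u $ i) v w) \<in> lin y)"

definition blow_up_embedded :: "3 proj \<Rightarrow> (complex ^ 3 \<Rightarrow> complex ^ 5) \<Rightarrow> 5 proj set \<Rightarrow> bool" where
  "blow_up_embedded P q S \<longleftrightarrow> conic_basis P q \<and> S = conic_map P q ` blow_up P"

text \<open>The inverse image in the embedded blow-up of a set of points of the plane.\<close>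

definition preimage_on ::
  "3 proj \<Rightarrow> (complex ^ 3 \<Rightarrow> complex ^ 5) \<Rightarrow> 3 proj set \<Rightarrow> 5 proj set" where
  "preimage_on P q D = conic_map P q ` {(x, L) \<in> blow_up P. x \<in> D}"

text \<open>The curve \<open>C\<close> has class \<open>a h - b e\<close>. Here \<open>e\<close> is the class of the exceptional curve, the inverse
  image of \<open>P\<close>, and \<open>h\<close> is the pullback of the class of a line, represented by the inverse image of
  any line not through \<open>P\<close>.\<close>

definition has_class :: "3 proj \<Rightarrow> (complex ^ 3 \<Rightarrow> complex ^ 5) \<Rightarrow> 5 proj set \<Rightarrow>
    5 proj set \<Rightarrow> int \<Rightarrow> int \<Rightarrow> bool" where
  "has_class P q S C a b \<longleftrightarrow> (\<forall>H. proj_line H \<and> P \<notin> H \<longrightarrow>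
     lin_equiv S (frag_of C)
       (frag_cmul a (frag_of (preimage_on P q H)) - frag_cmul b (frag_of (preimage_on P q {P}))))"


section \<open>The bound\<close>

text \<open>All divisions are exact. The two formulas agree when \<open>d1 = d2\<close> is even.\<close>

definition B :: "nat \<Rightarrow> nat \<Rightarrow> nat" where
  "B d1 d2 =
     (if even d1 \<and> even d2 \<and> d1 \<le> d2 \<or> even d1 \<and> odd d2 then d1 * (d2 - 1) div 2
      else if even d1 \<and> even d2 \<and> d1 \<ge> d2 \<or> odd d1 \<and> even d2 then (d1 - 1) * d2 div 2
      else (d1 - 1) * (d2 - 1) div 2 + 1)"

end

theory Submission
  imports Defs "HOL-Computational_Algebra.Field_as_Ring" "HOL-Computational_Algebra.Polynomial_Factorial"
    "HOL-Computational_Algebra.Fundamental_Theorem_Algebra"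
begin

text \<open>In suitable coordinates \<open>S\<close> is the scroll parametrized by
  \<open>(x\<^sup>2 e, x y e, y\<^sup>2 e, x z, y z)\<close>, and its part where \<open>x e\<close> does not vanish is an affine plane with
  coordinates \<open>t = y / x\<close>, \<open>u = z / (x e)\<close>. A curve on \<open>S\<close> other than a line is the closure of the
  zero set of an irreducible polynomial \<open>f (t, u)\<close>. If \<open>f\<close> has total degree \<open>a\<close> and degree \<open>m\<close> in \<open>u\<close>,
  the curve has class \<open>a h - (a - m) e\<close> and degree \<open>a + m\<close>, since substituting the equation of a
  general hyperplane into \<open>f\<close> leaves a separable polynomial of this degree. A dimension count in the
  space of sections of a large class bounds the number of intersection points of two such curves by
  \<open>a1 m2 + a2 m1 - m1 m2\<close>. This is bilinear in \<open>(m1, m2)\<close> once the degrees are fixed, so it is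
  maximal at a corner of \<open>1 \<le> m \<le> d / 2\<close>, which gives \<open>B\<close>. Equality is attained by monomial curves
  meeting \<open>u = t ^ k\<close>.\<close>

text \<open>The number a1 m2 + a2 m1 - m1 m2 is the intersection number a1 a2 - (a1 - m1) (a2 - m2)
  of the two classes. The dimension count reaches it without local multiplicities. The relation f2
  f1 - f1 f2 = 0 is the smallest syzygy and has u-degree m1 + m2, so in a class of u-degree m1 + m2
  - 1 the multiples of f1 and those of f2 are independent. Sections that separate the common points
  are independent modulo these multiples, hence there are at most as many points as dimensions left.
  The inequality m \<le> d / 2 comes from m \<le> a, since the leading term in u already has total
  degree at least m. When the degrees are ordered as in the listed parity cases, the corner m1 = d1
  div 2, m2 = 1 attains \<open>B\<close>; this dictates the classes of the extremal curves. The
  chart misses two lines, the exceptional one and one line of the ruling. Statements about them are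
  carried over from the chart by continuity in x or e. The classes of the extremal curves need exact
  orders of vanishing, also along these two lines: explicit identities between forms bound the
  orders below, test curves bound them above.\<close>

section \<open>Polynomials in two variables: coprimality and zeros\<close>

lemma card_roots_rsquarefree:
  fixes p :: "complex poly"
  assumes "rsquarefree p"
  shows "card {z. poly p z = 0} = degree p"
proof -
  have p: "p \<noteq> 0"
    using assms by (auto simp: rsquarefree_def)
  have "degree p = degree (\<Prod>z|poly p z = 0. [:-z, 1:])"
    by (subst complex_poly_decompose_rsquarefree[OF assms, symmetric]) (use p in simp)
  also have "\<dots> = card {z. poly p z = 0}"
    by (subst degree_prod_sum_eq) auto
  finally show ?thesis ..
qed

text \<open>Over the field of rational functions of t, f and p are coprime, and clearing
  denominators in a Bezout identity gives r. The proof stays inside the polynomial ring and uses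
  pseudo-division instead.\<close>

lemma prime_combination_const:
  fixes f p :: "complex poly poly"
  assumes f: "irreducible f" and df: "degree f > 0" and fp: "\<not> f dvd p"
  obtains a b r where "a * f + b * p = [:r:]" "r \<noteq> 0"
proof -
  have prime: "prime_elem f"
    using f by (simp add: irreducible_imp_prime_elem)
  define J where "J = {g. (\<exists>a b. g = a * f + b * p) \<and> \<not> f dvd g}"
  have "p \<in> J"
    unfolding J_def using fp by (auto intro: exI[of _ 0] exI[of _ 1])
  then obtain g where g: "g \<in> J" and gmin: "\<And>h. h \<in> J \<Longrightarrow> degree g \<le> degree h"
    using arg_min_nat_lemma[of "\<lambda>x. x \<in> J" p degree] by blast
  obtain a b where gab: "g = a * f + b * p"
    using g by (auto simp: J_def)
  have fg: "\<not> f dvd g"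
    using g by (simp add: J_def)
  then have g0: "g \<noteq> 0"
    by auto
  have f0: "f \<noteq> 0"
    using f by auto
  have in_J: "h \<in> J" if "h = c * f + d * g" "\<not> f dvd h" for h c d
  proof -
    have "h = (c + d * a) * f + (d * b) * p"
      using that(1) gab by (simp add: algebra_simps)
    then show ?thesis
      using that(2) unfolding J_def by blast
  qed
  \<comment> \<open>Minimality makes f divide every combination of smaller degree than g, in
    particular the pseudo-remainder r of f by g. As f is prime and does not divide g, it divides the
    pseudo-quotient; cancelling f leaves a nonzero constant in u equal to g * q' + r'.\<close>
  have "degree g = 0"
  proof (rule ccontr)
    assume dg: "degree g \<noteq> 0"
    obtain q r where qr: "pseudo_divmod f g = (q, r)"
      by fastforce
    obtain n where n: "smult (lead_coeff g ^ n) f = g * q + r" and r: "r = 0 \<or> degree r < degree g"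
      using pseudo_divmod[OF g0 qr] by blast
    have "r = smult (lead_coeff g ^ n) f - g * q"
      using n by simp
    then have rJ: "r = [:lead_coeff g ^ n:] * f + (- q) * g"
      by (simp add: algebra_simps)
    have fr: "f dvd r"
      using in_J[OF rJ] gmin[of r] r by (metis dvd_0_right linorder_not_le)
    then have "f dvd g * q"
      using rJ by (metis (no_types, opaque_lifting) dvd_add_right_iff dvd_triv_right mult.commute mult_minus_left dvd_minus_iff)
    then have "f dvd q"
      using prime fg prime_elem_dvd_mult_iff by blast
    then obtain q' where q': "q = f * q'" ..
    obtain r' where r': "r = f * r'"
      using fr ..
    have "f * [:lead_coeff g ^ n:] = f * (g * q' + r')"
      using n unfolding q' r' by (simp add: algebra_simps)
    then have eq: "[:lead_coeff g ^ n:] = g * q' + r'"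
      using f0 mult_left_cancel by blast
    show False
    proof (cases "r = 0")
      case True
      then have "r' = 0"
        using r' f0 by auto
      then have "degree (g * q') = 0" "g * q' \<noteq> 0"
        using eq g0 by (metis add.right_neutral degree_pCons_0, metis add.right_neutral leading_coeff_0_iff pCons_eq_0_iff power_not_zero)
      then show False
        using dg by (metis add_is_0 degree_mult_eq mult_eq_0_iff)
    next
      case False
      show False
      \<comment> \<open>If f is not longer than g, pseudo-dividing g by f gives a remainder that f
        must divide, so f would divide a power of its own leading coefficient. If f is longer, it
        cannot divide the shorter nonzero r.\<close>
      proof (cases "degree f \<le> degree g")
        case True
        obtain q1 r1 where qr1: "pseudo_divmod g f = (q1, r1)"
          by fastforce
        obtain n1 where n1: "smult (lead_coeff f ^ n1) g = f * q1 + r1" and r1: "r1 = 0 \<or> degree r1 < degree f"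
          using pseudo_divmod[OF f0 qr1] by blast
        have "r1 = (- q1) * f + [:lead_coeff f ^ n1:] * g"
          using n1 by (simp add: algebra_simps)
        from in_J[OF this] have "f dvd r1"
          using gmin[of r1] r1 True by (metis dvd_0_right leD le_trans)
        then have "f dvd [:lead_coeff f ^ n1:] * g"
          using n1 by (simp add: dvd_add)
        then have "f dvd [:lead_coeff f ^ n1:]"
          using prime fg prime_elem_dvd_mult_iff by blast
        then have "degree f = 0"
          using f0 by (metis degree_pCons_0 dvd_imp_degree_le le_zero_eq leading_coeff_0_iff pCons_eq_0_iff power_not_zero)
        then show False
          using df by simp
      next
        case False
        then have "degree r < degree f"
          using r \<open>r \<noteq> 0\<close> by auto
        then show False
          using fr \<open>r \<noteq> 0\<close> by (meson dvd_imp_degree_le linorder_not_le)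
      qed
    qed
  qed
  then obtain r where "g = [:r:]"
    by (metis degree_eq_zeroE)
  then show ?thesis
    using that[of a b r] gab g0 by auto
qed

definition ev2 :: "complex poly poly \<Rightarrow> complex \<Rightarrow> complex \<Rightarrow> complex" where
  "ev2 p t u = poly (poly p [:u:]) t"

definition slice :: "complex poly poly \<Rightarrow> complex \<Rightarrow> complex poly" where
  "slice p t = map_poly (\<lambda>c. poly c t) p"

lemma ev2_simps [simp]:
  "ev2 (p + q) t u = ev2 p t u + ev2 q t u"
  "ev2 (p - q) t u = ev2 p t u - ev2 q t u"
  "ev2 (- p) t u = - ev2 p t u"
  "ev2 (p * q) t u = ev2 p t u * ev2 q t u"
  "ev2 (p ^ n) t u = ev2 p t u ^ n"
  "ev2 (smult c p) t u = poly c t * ev2 p t u"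
  "ev2 (pCons c p) t u = poly c t + u * ev2 p t u"
  "ev2 (monom c n) t u = poly c t * u ^ n"
  "ev2 0 t u = 0"
  "ev2 1 t u = 1"
  by (simp_all add: ev2_def poly_monom poly_const_pow)

lemma coeff_slice [simp]: "coeff (slice p t) k = poly (coeff p k) t"
  by (simp add: slice_def coeff_map_poly)

lemma slice_simps [simp]: "slice 0 t = 0" "slice (pCons c p) t = pCons (poly c t) (slice p t)"
  by (auto intro!: poly_eqI simp: coeff_pCons split: nat.splits)

lemma ev2_slice: "ev2 p t u = poly (slice p t) u"
  by (induction p) simp_all

lemma degree_slice_le: "degree (slice p t) \<le> degree p"
  by (rule degree_le) (simp add: coeff_eq_0)

lemma ev2_eqI:
  assumes "\<And>t u. ev2 p t u = ev2 q t u"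
  shows "p = q"
proof (rule poly_eqI)
  fix k
  have "slice p t = slice q t" for t
    using assms by (auto simp: poly_eq_poly_eq_iff[symmetric] ev2_slice fun_eq_iff)
  then have "poly (coeff p k) t = poly (coeff q k) t" for t
    using coeff_slice by metis
  then show "coeff p k = coeff q k"
    by (auto simp: poly_eq_poly_eq_iff[symmetric] fun_eq_iff)
qed

text \<open>A zero slice lets a linear factor in the inner variable alone split off from f.
  Irreducibility makes the cofactor a unit, so f would have degree 0 in u.\<close>

lemma slice_nonzero:
  assumes f: "irreducible f" and df: "degree f > 0"
  shows "slice f t \<noteq> 0"
proof
  assume "slice f t = 0"
  then have "poly (coeff f k) t = 0" for k
    by (metis coeff_0 coeff_slice)
  then have "[:[:-t, 1:]:] dvd f"
    by (simp add: const_poly_dvd_iff poly_eq_0_iff_dvd)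
  then obtain g where g: "f = [:[:-t, 1:]:] * g" ..
  have "\<not> is_unit [:[:-t, 1:]:]"
    by (simp add: is_unit_const_poly_iff is_unit_poly_iff)
  then have "is_unit g"
    using f g irreducibleD by blast
  then have "degree g = 0"
    by (auto simp: is_unit_poly_iff)
  then show False
    using g df by simp
qed

lemma infinite_not_root:
  fixes r :: "complex poly"
  assumes "r \<noteq> 0" "finite T"
  obtains t where "poly r t \<noteq> 0" "t \<notin> T"
proof -
  have "finite ({t. poly r t = 0} \<union> T)"
    using assms poly_roots_finite by auto
  then have "{t. poly r t = 0} \<union> T \<noteq> UNIV"
    using infinite_UNIV_char_0 by metis
  then show ?thesis
    using that by auto
qed

lemma slice_root:
  assumes df: "degree f > 0" and t: "poly (lead_coeff f) t \<noteq> 0"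
  obtains u where "ev2 f t u = 0"
proof -
  have "degree (slice f t) \<ge> degree f"
    by (rule le_degree) (use t in simp)
  then have "\<not> constant (poly (slice f t))"
    using df by (simp add: constant_degree)
  then obtain u where "poly (slice f t) u = 0"
    using fundamental_theorem_of_algebra by blast
  then show ?thesis
    using that by (simp add: ev2_slice)
qed

text \<open>If f did not divide p, some combination of them would be a nonzero r depending on t
  only. Over a t outside \<open>T\<close> where neither r nor the leading coefficient of f vanishes,
  f has a zero, and evaluating the combination there gives r (t) = 0.\<close>

lemma nullstellensatz_principal:
  assumes f: "irreducible f" and df: "degree f > 0" and T: "finite T"
    and van: "\<And>t u. t \<notin> T \<Longrightarrow> ev2 f t u = 0 \<Longrightarrow> ev2 p t u = 0"
  shows "f dvd p"
proof (rule ccontr)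
  assume "\<not> f dvd p"
  then obtain a b r where r: "a * f + b * p = [:r:]" "r \<noteq> 0"
    using prime_combination_const[OF f df] by blast
  have "r * lead_coeff f \<noteq> 0"
    using r df by auto
  then obtain t where t: "poly (r * lead_coeff f) t \<noteq> 0" "t \<notin> T"
    using T by (rule infinite_not_root)
  obtain u where u: "ev2 f t u = 0"
    using slice_root[OF df] t by auto
  have "ev2 (a * f + b * p) t u = 0"
    using u van[OF t(2) u] by simp
  then show False
    using t r by simp
qed

text \<open>The same combination r confines the first coordinates to its roots. Over each of them f
  has finitely many zeros, because its slice is not zero.\<close>

lemma finite_common_zeros:
  assumes f: "irreducible f" and df: "degree f > 0" and "\<not> f dvd p"
  shows "finite {t. \<exists>u. ev2 f t u = 0 \<and> ev2 p t u = 0}"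
    and "finite {(t, u). ev2 f t u = 0 \<and> ev2 p t u = 0}"
proof -
  obtain a b r where r: "a * f + b * p = [:r:]" "r \<noteq> 0"
    using prime_combination_const[OF f df] assms by blast
  have "poly r t = 0" if "ev2 f t u = 0" "ev2 p t u = 0" for t u
  proof -
    have "ev2 (a * f + b * p) t u = 0"
      using that by simp
    then show ?thesis
      using r by simp
  qed
  then have "{t. \<exists>u. ev2 f t u = 0 \<and> ev2 p t u = 0} \<subseteq> {t. poly r t = 0}"
    by blast
  then show fin: "finite {t. \<exists>u. ev2 f t u = 0 \<and> ev2 p t u = 0}"
    using r(2) poly_roots_finite finite_subset by blast
  have "finite (Sigma {t. \<exists>u. ev2 f t u = 0 \<and> ev2 p t u = 0} (\<lambda>t. {u. poly (slice f t) u = 0}))"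
    using fin slice_nonzero[OF f df] by (intro finite_SigmaI) (auto intro: poly_roots_finite)
  then show "finite {(t, u). ev2 f t u = 0 \<and> ev2 p t u = 0}"
    by (rule rev_finite_subset) (auto simp: ev2_slice)
qed

lemma infinite_zeros:
  assumes df: "degree f > 0"
  shows "infinite {t. \<exists>u. ev2 f t u = 0}"
proof
  assume "finite {t. \<exists>u. ev2 f t u = 0}"
  then obtain t where "poly (lead_coeff f) t \<noteq> 0" "t \<notin> {t. \<exists>u. ev2 f t u = 0}"
    using infinite_not_root[of "lead_coeff f"] df by (metis degree_0 leading_coeff_0_iff less_irrefl)
  then show False
    using slice_root[OF df] by blast
qed

section \<open>Bihomogeneous coordinates\<close>

text \<open>\<open>hat A M p\<close> is the section of \<open>A h - (A - M) e\<close> whose restriction to the affine chart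
  \<open>x = e = 1\<close> is the polynomial \<open>p\<close> in \<open>t = y\<close> (inner variable) and \<open>u = z\<close> (outer variable); it
  exists when \<open>cls A M p\<close>. The truncated subtractions in it only matter for vanishing coefficients.\<close>

definition cls :: "nat \<Rightarrow> nat \<Rightarrow> complex poly poly \<Rightarrow> bool" where
  "cls A M p \<longleftrightarrow> (\<forall>k i. coeff (coeff p k) i \<noteq> 0 \<longrightarrow> k \<le> M \<and> k + i \<le> A)"

definition hat :: "nat \<Rightarrow> nat \<Rightarrow> complex poly poly \<Rightarrow> complex \<Rightarrow> complex \<Rightarrow> complex \<Rightarrow> complex \<Rightarrow> complex" where
  "hat A M p x y z e =
     (\<Sum>k\<le>M. \<Sum>i\<le>A. coeff (coeff p k) i * x ^ (A - k - i) * y ^ i * z ^ k * e ^ (M - k))"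

lemma cls_degree: "cls A M p \<Longrightarrow> degree p \<le> M"
  unfolding cls_def by (metis coeff_0 leading_coeff_0_iff le0 degree_0)

lemma cls_coeff_degree: "cls A M p \<Longrightarrow> degree (coeff p k) \<le> A"
  unfolding cls_def by (metis add_leD2 coeff_0 leading_coeff_0_iff le0 degree_0)

lemma poly_altdef_le:
  fixes p :: "'a::comm_semiring_1 poly"
  assumes "degree p \<le> n"
  shows "poly p x = (\<Sum>i\<le>n. coeff p i * x ^ i)"
  unfolding poly_altdef
  by (rule sum.mono_neutral_left) (use assms in \<open>auto simp: coeff_eq_0\<close>)

lemma ev2_cls:
  assumes "cls A M p"
  shows "ev2 p t u = (\<Sum>k\<le>M. \<Sum>i\<le>A. coeff (coeff p k) i * t ^ i * u ^ k)"
proof -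
  have "ev2 p t u = (\<Sum>k\<le>M. poly (coeff p k) t * u ^ k)"
    unfolding ev2_slice using degree_slice_le cls_degree[OF assms]
    by (subst poly_altdef_le[of _ M]) (auto intro: order_trans)
  then show ?thesis
    using cls_coeff_degree[OF assms] by (simp add: poly_altdef_le[of _ A] sum_distrib_right)
qed

lemma hat_chart:
  assumes p: "cls A M p" and x: "x \<noteq> 0" and e: "e \<noteq> 0"
  shows "hat A M p x y z e = x ^ A * e ^ M * ev2 p (y / x) (z / (x * e))"
proof -
  have "coeff (coeff p k) i * x ^ (A - k - i) * y ^ i * z ^ k * e ^ (M - k)
      = x ^ A * e ^ M * (coeff (coeff p k) i * (y / x) ^ i * (z / (x * e)) ^ k)" for k i
  proof (cases "coeff (coeff p k) i = 0")
    case False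
    then have ki: "k \<le> M" "k + i \<le> A"
      using p by (auto simp: cls_def)
    have "x ^ A = x ^ (A - k - i) * x ^ i * x ^ k" "e ^ M = e ^ (M - k) * e ^ k"
      using ki by (simp_all flip: power_add)
    then show ?thesis
      using x e by (simp add: power_divide power_mult_distrib)
  qed simp
  then show ?thesis
    unfolding hat_def ev2_cls[OF p] sum_distrib_left by (intro sum.cong refl)
qed

lemma hat_1: "cls A M p \<Longrightarrow> hat A M p 1 t u 1 = ev2 p t u"
  by (simp add: hat_chart)

lemma continuous_hat [continuous_intros]:
  assumes "continuous_on X f" "continuous_on X g" "continuous_on X h" "continuous_on X k"
  shows "continuous_on X (\<lambda>s. hat A M p (f s) (g s) (h s) (k s))"
  unfolding hat_def by (intro continuous_intros assms)

lemma continuous_eq_at_0: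
  fixes f g :: "complex \<Rightarrow> complex"
  assumes "continuous_on UNIV f" "continuous_on UNIV g" "\<And>s. s \<noteq> 0 \<Longrightarrow> f s = g s"
  shows "f s = g s"
proof (cases "s = 0")
  case True
  have "(f \<longlongrightarrow> f 0) (at 0)" "(g \<longlongrightarrow> g 0) (at 0)"
    using assms by (auto simp: continuous_on_def)
  moreover have "(f \<longlongrightarrow> g 0) (at 0)"
    using \<open>(g \<longlongrightarrow> g 0) (at 0)\<close> assms(3) by (subst tendsto_cong[of f g]) (auto simp: eventually_at_filter)
  ultimately show ?thesis
    using True LIM_unique by blast
qed (use assms in auto)

text \<open>Identities between sections are checked where x and e are nonzero and extended by
  continuity, first in e and then in x.\<close>

lemma continuous_eq_chart:
  fixes f g :: "complex \<Rightarrow> complex \<Rightarrow> complex"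
  assumes "\<And>x. continuous_on UNIV (f x)" "\<And>x. continuous_on UNIV (g x)"
    and "\<And>e. continuous_on UNIV (\<lambda>x. f x e)" "\<And>e. continuous_on UNIV (\<lambda>x. g x e)"
    and "\<And>x e. x \<noteq> 0 \<Longrightarrow> e \<noteq> 0 \<Longrightarrow> f x e = g x e"
  shows "f x e = g x e"
proof -
  have "f x e = g x e" if "x \<noteq> 0" for x e
    by (rule continuous_eq_at_0) (use assms that in auto)
  then show ?thesis
    using continuous_eq_at_0[OF assms(3) assms(4)] by blast
qed

lemma cls_mult:
  assumes "cls A M p" "cls A' M' p'"
  shows "cls (A + A') (M + M') (p * p')"
  unfolding cls_def
proof (intro allI impI)
  fix k i assume "coeff (coeff (p * p') k) i \<noteq> 0"
  then have "(\<Sum>j\<le>k. \<Sum>l\<le>i. coeff (coeff p j) l * coeff (coeff p' (k - j)) (i - l)) \<noteq> 0"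
    by (simp add: coeff_mult coeff_sum)
  then obtain j where j: "j \<le> k" "(\<Sum>l\<le>i. coeff (coeff p j) l * coeff (coeff p' (k - j)) (i - l)) \<noteq> 0"
    by (meson atMost_iff sum.not_neutral_contains_not_neutral)
  then obtain l where l: "l \<le> i" "coeff (coeff p j) l * coeff (coeff p' (k - j)) (i - l) \<noteq> 0"
    by (meson atMost_iff sum.not_neutral_contains_not_neutral)
  then have "j \<le> M" "j + l \<le> A" "k - j \<le> M'" "(k - j) + (i - l) \<le> A'"
    using assms l(2) unfolding cls_def by (metis mult_eq_0_iff)+
  then show "k \<le> M + M' \<and> k + i \<le> A + A'"
    using j(1) l(1) by linarith
qed

lemma hat_mult:
  assumes "cls A M p" "cls A' M' p'"
  shows "hat (A + A') (M + M') (p * p') x y z e = hat A M p x y z e * hat A' M' p' x y z e"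
  by (rule continuous_eq_chart[of "\<lambda>x e. hat (A + A') (M + M') (p * p') x y z e"
        "\<lambda>x e. hat A M p x y z e * hat A' M' p' x y z e"])
     (auto intro!: continuous_intros
       simp: hat_chart[OF cls_mult[OF assms]] hat_chart[OF assms(1)] hat_chart[OF assms(2)] power_add)

lemma cls_1: "cls 0 0 1"
  by (auto simp: cls_def)

lemma hat_one: "hat 0 0 1 x y z e = 1"
  by (simp add: hat_def)

lemma cls_power: "cls A M p \<Longrightarrow> cls (n * A) (n * M) (p ^ n)"
  by (induction n) (auto simp: cls_1 intro: cls_mult)

lemma hat_power: "cls A M p \<Longrightarrow> hat (n * A) (n * M) (p ^ n) x y z e = hat A M p x y z e ^ n"
  by (induction n) (auto simp: hat_one hat_mult cls_power)

lemma cls_add: "cls A M p \<Longrightarrow> cls A M q \<Longrightarrow> cls A M (p + q)"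
  unfolding cls_def by (metis add.right_neutral coeff_add)

lemma hat_add: "hat A M (p + q) x y z e = hat A M p x y z e + hat A M q x y z e"
  by (simp add: hat_def sum.distrib algebra_simps)

lemma cls_0 [simp]: "cls A M 0"
  by (simp add: cls_def)

lemma hat_0 [simp]: "hat A M 0 x y z e = 0"
  by (simp add: hat_def)

lemma cls_smult: "cls A M p \<Longrightarrow> cls A M (smult [:c:] p)"
  by (auto simp: cls_def)

lemma hat_smult: "hat A M (smult [:c:] p) x y z e = c * hat A M p x y z e"
  by (simp add: hat_def sum_distrib_left mult.assoc)

lemma cls_sum: "(\<And>i. i \<in> X \<Longrightarrow> cls A M (g i)) \<Longrightarrow> cls A M (sum g X)"
  by (induction X rule: infinite_finite_induct) (auto intro: cls_add)

lemma hat_sum: "hat A M (sum g X) x y z e = (\<Sum>i\<in>X. hat A M (g i) x y z e)"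
  by (induction X rule: infinite_finite_induct) (auto simp: hat_add)

lemma cls_mono: "cls A M p \<Longrightarrow> A \<le> A' \<Longrightarrow> M \<le> M' \<Longrightarrow> cls A' M' p"
  unfolding cls_def by (meson le_trans)

lemma cls_monom: "k \<le> M \<Longrightarrow> k + i \<le> A \<Longrightarrow> cls A M (monom (monom c i) k)"
  by (auto simp: cls_def)

lemma hat_monom:
  assumes "k \<le> M" "k + i \<le> A"
  shows "hat A M (monom (monom c i) k) x y z e = c * x ^ (A - k - i) * y ^ i * z ^ k * e ^ (M - k)"
proof -
  have "hat A M (monom (monom c i) k) x y z e = (\<Sum>k'\<le>M. if k' = k then
          (\<Sum>i'\<le>A. if i' = i then c * x ^ (A - k - i) * y ^ i * z ^ k * e ^ (M - k) else 0) else 0)"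
    unfolding hat_def
  proof (rule sum.cong)
    fix k'
    show "(\<Sum>i'\<le>A. coeff (coeff (monom (monom c i) k) k') i' * x ^ (A - k' - i') * y ^ i' * z ^ k' * e ^ (M - k'))
      = (if k' = k then (\<Sum>i'\<le>A. if i' = i then c * x ^ (A - k - i) * y ^ i * z ^ k * e ^ (M - k) else 0) else 0)"
    proof (cases "k' = k")
      case True
      have "(\<Sum>i'\<le>A. coeff (coeff (monom (monom c i) k) k') i' * x ^ (A - k' - i') * y ^ i' * z ^ k' * e ^ (M - k'))
        = (\<Sum>i'\<le>A. if i' = i then c * x ^ (A - k - i) * y ^ i * z ^ k * e ^ (M - k) else 0)"
        using True by (intro sum.cong refl) auto
      then show ?thesis
        using True by simp
    qed simp
  qed simp
  also have "\<dots> = c * x ^ (A - k - i) * y ^ i * z ^ k * e ^ (M - k)"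
    using assms by simp
  finally show ?thesis .
qed

lemma cls_exists: "\<exists>a. cls a (degree p) p"
proof
  show "cls (degree p + (\<Sum>k\<le>degree p. degree (coeff p k))) (degree p) p"
    unfolding cls_def
  proof (intro allI impI)
    fix k i assume nz: "coeff (coeff p k) i \<noteq> 0"
    then have k: "k \<le> degree p"
      by (metis coeff_0 le_degree)
    have "i \<le> degree (coeff p k)"
      using nz by (rule le_degree)
    also have "\<dots> \<le> (\<Sum>k\<le>degree p. degree (coeff p k))"
      using k by (intro member_le_sum) auto
    finally show "k \<le> degree p \<and> k + i \<le> degree p + (\<Sum>k\<le>degree p. degree (coeff p k))"
      using k by simp
  qed
qed

lemma cls_decomp:
  assumes "cls A M p"
  shows "p = (\<Sum>k\<le>M. \<Sum>i\<le>A. monom (monom (coeff (coeff p k) i) i) k)"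
proof -
  have "p = (\<Sum>k\<le>M. monom (coeff p k) k)"
    using cls_degree[OF assms] by (metis poly_as_sum_of_monoms')
  also have "\<dots> = (\<Sum>k\<le>M. \<Sum>i\<le>A. monom (monom (coeff (coeff p k) i) i) k)"
  proof (rule sum.cong)
    fix k
    have "(\<Sum>i\<le>A. monom (coeff (coeff p k) i) i) = coeff p k"
      using cls_coeff_degree[OF assms] by (metis poly_as_sum_of_monoms')
    then show "monom (coeff p k) k = (\<Sum>i\<le>A. monom (monom (coeff (coeff p k) i) i) k)"
      by (metis (no_types, lifting) monom_sum sum.cong)
  qed simp
  finally show ?thesis .
qed

section \<open>Algebras of polynomial functions\<close>

lemma poly_alg_sum: "(\<And>i. i \<in> X \<Longrightarrow> f i \<in> poly_alg A) \<Longrightarrow> (\<lambda>x. \<Sum>i\<in>X. f i x) \<in> poly_alg A"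
  by (induction X rule: infinite_finite_induct) (auto intro: poly_alg.intros)

lemma poly_alg_prod: "(\<And>i. i \<in> X \<Longrightarrow> f i \<in> poly_alg A) \<Longrightarrow> (\<lambda>x. \<Prod>i\<in>X. f i x) \<in> poly_alg A"
  by (induction X rule: infinite_finite_induct) (auto intro: poly_alg.intros)

lemma poly_alg_power: "f \<in> poly_alg A \<Longrightarrow> (\<lambda>x. f x ^ n) \<in> poly_alg A"
  by (induction n) (auto intro: poly_alg.intros)

lemma poly_alg_cmult: "f \<in> poly_alg A \<Longrightarrow> (\<lambda>x. c * f x) \<in> poly_alg A"
  by (rule poly_alg.mult[OF poly_alg.const])

lemma poly_alg_uminus: "f \<in> poly_alg A \<Longrightarrow> (\<lambda>x. - f x) \<in> poly_alg A"
  using poly_alg_cmult[of f A "-1"] by simp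

lemma poly_alg_diff: "f \<in> poly_alg A \<Longrightarrow> g \<in> poly_alg A \<Longrightarrow> (\<lambda>x. f x - g x) \<in> poly_alg A"
  using poly_alg.add[OF _ poly_alg_uminus] by fastforce

lemmas poly_alg_intros = poly_alg.const poly_alg.add poly_alg.mult poly_alg_sum poly_alg_prod
  poly_alg_power poly_alg_uminus poly_alg_diff

text \<open>Gaussian elimination over the polynomial functions, with the pivots chosen at \<open>l0\<close>.\<close>

lemma injective_generic:
  fixes m :: "nat \<Rightarrow> nat \<Rightarrow> 'v \<Rightarrow> complex"
  assumes "\<And>r c. m r c \<in> poly_alg A"
    and "\<And>v. (\<And>r. r < R \<Longrightarrow> (\<Sum>c<n. m r c l0 * v c) = 0) \<Longrightarrow> (\<forall>c<n. v c = 0)"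
  shows "\<exists>G\<in>poly_alg A. G l0 \<noteq> 0 \<and>
    (\<forall>l v. G l \<noteq> 0 \<longrightarrow> (\<forall>r<R. (\<Sum>c<n. m r c l * v c) = 0) \<longrightarrow> (\<forall>c<n. v c = 0))"
  using assms
proof (induction n arbitrary: m)
  case 0
  show ?case
    by (rule bexI[of _ "\<lambda>_. 1"]) (auto intro: poly_alg.const)
next
  case (Suc n)
  \<comment> \<open>Otherwise the last unit vector would lie in the kernel at
    \<open>l0\<close>.\<close>
  have "\<exists>r<R. m r n l0 \<noteq> 0"
  proof (rule ccontr)
    assume "\<not> ?thesis"
    then have "\<forall>c<Suc n. (if c = n then 1 else 0 :: complex) = 0"
      by (intro Suc.prems(2)) (auto intro!: sum.neutral)
    then show False
      by auto
  qed
  then obtain r0 where r0: "r0 < R" "m r0 n l0 \<noteq> 0"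
    by blast
  \<comment> \<open>Elimination by cross-multiplication: without division the new entries remain
    polynomial functions of l.\<close>
  define m' where "m' r c l = m r0 n l * m r c l - m r n l * m r0 c l" for r c l
  have row: "(\<Sum>c<n. m' r c l * v c)
      = m r0 n l * (\<Sum>c<Suc n. m r c l * v c) - m r n l * (\<Sum>c<Suc n. m r0 c l * v c)" for r l v
    by (simp add: m'_def algebra_simps sum_distrib_left sum_subtractf)
  have "\<exists>G\<in>poly_alg A. G l0 \<noteq> 0 \<and>
    (\<forall>l v. G l \<noteq> 0 \<longrightarrow> (\<forall>r<R. (\<Sum>c<n. m' r c l * v c) = 0) \<longrightarrow> (\<forall>c<n. v c = 0))"
  proof (rule Suc.IH)
    show "m' r c \<in> poly_alg A" for r c
      unfolding m'_def by (intro poly_alg_intros Suc.prems)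
  next
    fix v assume v: "\<And>r. r < R \<Longrightarrow> (\<Sum>c<n. m' r c l0 * v c) = 0"
    \<comment> \<open>The last coordinate is chosen to solve the pivot row, so that a kernel vector
      of the reduced system extends to one of the full system.\<close>
    define w where "w = v(n := - (\<Sum>c<n. m r0 c l0 * v c) / m r0 n l0)"
    have 0: "(\<Sum>c<Suc n. m r0 c l0 * w c) = 0"
      using r0(2) by (simp add: w_def)
    have "(\<Sum>c<Suc n. m r c l0 * w c) = 0" if "r < R" for r
    proof -
      have "(\<Sum>c<n. m' r c l0 * w c) = 0"
        using v[OF that] by (simp add: w_def)
      then show ?thesis
        unfolding row 0 using r0(2) by simp
    qed
    then have "\<forall>c<Suc n. w c = 0"
      by (rule Suc.prems(2))
    then show "\<forall>c<n. v c = 0"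
      by (auto simp: w_def less_Suc_eq split: if_splits)
  qed
  then obtain G where G: "G \<in> poly_alg A" "G l0 \<noteq> 0"
    "\<forall>l v. G l \<noteq> 0 \<longrightarrow> (\<forall>r<R. (\<Sum>c<n. m' r c l * v c) = 0) \<longrightarrow> (\<forall>c<n. v c = 0)"
    by blast
  show ?case
  proof (intro bexI[of _ "\<lambda>l. G l * m r0 n l"] conjI allI impI)
    fix l v c
    assume nz: "G l * m r0 n l \<noteq> 0" and v: "\<forall>r<R. (\<Sum>c<Suc n. m r c l * v c) = 0" and c: "c < Suc n"
    have 0: "\<forall>c<n. v c = 0"
    proof -
      have "\<forall>r<R. (\<Sum>c<n. m' r c l * v c) = 0"
        using v r0(1) by (simp add: row del: sum.lessThan_Suc)
      then show ?thesis
        using G(3) nz by auto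
    qed
    have "(\<Sum>c<Suc n. m r0 c l * v c) = m r0 n l * v n"
      using 0 by simp
    then have "v n = 0"
      using v r0(1) nz by (metis mult_eq_0_iff)
    then show "v c = 0"
      using 0 c less_Suc_eq by auto
  qed (use G r0 Suc.prems(1) in \<open>auto intro: poly_alg.mult\<close>)
qed

lemma sum_lessThan_add:
  fixes m n :: nat
  shows "(\<Sum>c<m + n. g c) = (\<Sum>c<m. g c) + (\<Sum>c<n. g (m + c) :: 'a::comm_monoid_add)"
  by (induction n) (auto simp: add.assoc)

text \<open>The condition that a polynomial of degree d be coprime to its derivative is injectivity
  of the Sylvester map (h, g) \<mapsto> h \<phi> + g \<phi>' with deg h < d - 1 and deg g < d.
  Injectivity persists generically by \<open>injective_generic\<close>, so no discriminant has to be
  written down.\<close>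

lemma rsquarefree_generic:
  fixes \<phi> :: "'v \<Rightarrow> complex poly"
  assumes co: "\<And>i. (\<lambda>l. coeff (\<phi> l) i) \<in> poly_alg A"
    and deg: "\<And>l. degree (\<phi> l) \<le> d" and d: "d > 0"
    and l0: "degree (\<phi> l0) = d" "rsquarefree (\<phi> l0)"
  shows "\<exists>G\<in>poly_alg A. G l0 \<noteq> 0 \<and> (\<forall>l. G l \<noteq> 0 \<longrightarrow> degree (\<phi> l) = d \<and> rsquarefree (\<phi> l))"
proof -
  obtain d' where d': "d = Suc d'"
    using d gr0_implies_Suc by blast
  \<comment> \<open>The columns of the Sylvester matrix: d - 1 shifts of \<phi> followed by d shifts
    of its derivative. \<open>hi\<close> and \<open>lo\<close> read the two cofactors off a
    coefficient vector.\<close>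
  define bas where "bas c l = (if c < d' then monom 1 c * \<phi> l else monom 1 (c - d') * pderiv (\<phi> l))" for c l
  define n where "n = d' + d"
  define m where "m r c l = coeff (bas c l) r" for r c l
  define hi where "hi v = (\<Sum>c<d'. monom (v c) c :: complex poly)" for v
  define lo where "lo v = (\<Sum>c<d. monom (v (d' + c)) c :: complex poly)" for v
  have comb: "(\<Sum>c<n. m r c l * v c) = coeff (hi v * \<phi> l + lo v * pderiv (\<phi> l)) r" for r l v
  proof -
    have "(\<Sum>c<n. smult (v c) (bas c l))
        = (\<Sum>c<d'. smult (v c) (bas c l)) + (\<Sum>c<d. smult (v (d' + c)) (bas (d' + c) l))"
      unfolding n_def by (rule sum_lessThan_add)
    also have "(\<Sum>c<d'. smult (v c) (bas c l)) = hi v * \<phi> l"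
      unfolding hi_def sum_distrib_right by (intro sum.cong) (auto simp: bas_def smult_monom simp flip: mult_smult_left)
    also have "(\<Sum>c<d. smult (v (d' + c)) (bas (d' + c) l)) = lo v * pderiv (\<phi> l)"
      unfolding lo_def sum_distrib_right by (intro sum.cong) (auto simp: bas_def smult_monom simp flip: mult_smult_left)
    finally have "coeff (\<Sum>c<n. smult (v c) (bas c l)) r = coeff (hi v * \<phi> l + lo v * pderiv (\<phi> l)) r"
      by simp
    then show ?thesis
      by (simp add: coeff_sum m_def mult.commute)
  qed
  have coeff_hi: "coeff (hi v) c = v c" if "c < d'" for v c
    using that by (simp add: hi_def coeff_sum)
  have coeff_lo: "coeff (lo v) c = v (d' + c)" if "c < d" for v c
    using that by (simp add: lo_def coeff_sum)
  have deg_lo: "degree (lo v) < d" for v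
    unfolding lo_def using d by (intro degree_lessI) (auto simp: coeff_sum intro!: sum.neutral)
  have "\<exists>G\<in>poly_alg A. G l0 \<noteq> 0 \<and>
    (\<forall>l v. G l \<noteq> 0 \<longrightarrow> (\<forall>r<2 * d. (\<Sum>c<n. m r c l * v c) = 0) \<longrightarrow> (\<forall>c<n. v c = 0))"
  proof (rule injective_generic)
    fix r c
    show "m r c \<in> poly_alg A"
      unfolding m_def bas_def coeff_pderiv coeff_monom_mult
      by (cases "c < d'"; cases "r < c"; cases "r < c - d'") (auto simp: coeff_monom_mult coeff_pderiv intro!: poly_alg_intros co)
  next
    fix v assume v: "\<And>r. r < 2 * d \<Longrightarrow> (\<Sum>c<n. m r c l0 * v c) = 0"
    let ?w = "hi v * \<phi> l0 + lo v * pderiv (\<phi> l0)"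
    have "degree (hi v) \<le> d'"
      unfolding hi_def by (rule degree_le) (auto simp: coeff_sum intro!: sum.neutral)
    then have "degree (hi v * \<phi> l0) \<le> d' + d"
      using degree_mult_le[of "hi v" "\<phi> l0"] l0(1) by linarith
    moreover have "degree (lo v * pderiv (\<phi> l0)) \<le> d' + d"
      using degree_mult_le[of "lo v" "pderiv (\<phi> l0)"] degree_pderiv[of "\<phi> l0"] l0(1) deg_lo[of v] d' by linarith
    ultimately have "degree ?w < 2 * d"
      using degree_add_le[of "hi v * \<phi> l0" "d' + d"] d' by fastforce
    then have w0: "?w = 0"
      using v unfolding comb by (metis leading_coeff_0_iff)
    have "poly (lo v) z = 0" if "poly (\<phi> l0) z = 0" for z
    proof -
      have "poly ?w z = 0"
        using w0 by simp
      then have "poly (lo v) z * poly (pderiv (\<phi> l0)) z = 0"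
        using that by simp
      then show ?thesis
        using l0(2) that by (auto simp: rsquarefree_roots)
    qed
    then have sub: "{z. poly (\<phi> l0) z = 0} \<subseteq> {z. poly (lo v) z = 0}"
      by blast
    \<comment> \<open>At a root of \<phi> the derivative does not vanish, so \<open>lo v\<close>
      does. It has d distinct roots but degree less than d.\<close>
    have lo0: "lo v = 0"
    proof (rule ccontr)
      assume nz: "lo v \<noteq> 0"
      have "d \<le> card {z. poly (lo v) z = 0}"
        using card_mono[OF poly_roots_finite[OF nz] sub] card_roots_rsquarefree[OF l0(2)] l0(1) by simp
      also have "\<dots> \<le> degree (lo v)"
        using nz by (rule card_poly_roots_bound)
      finally show False
        using deg_lo[of v] by simp
    qed
    then have "hi v = 0"
      using w0 l0(1) d by auto
    show "\<forall>c<n. v c = 0"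
    proof (intro allI impI)
      fix c assume "c < n"
      show "v c = 0"
      proof (cases "c < d'")
        case True
        then show ?thesis
          using coeff_hi[of c v] \<open>hi v = 0\<close> by simp
      next
        case False
        then show ?thesis
          using coeff_lo[of "c - d'" v] lo0 \<open>c < n\<close> by (simp add: n_def)
      qed
    qed
  qed
  then obtain G where G: "G \<in> poly_alg A" "G l0 \<noteq> 0"
    and inj: "\<And>l v. G l \<noteq> 0 \<Longrightarrow> (\<forall>r<2 * d. (\<Sum>c<n. m r c l * v c) = 0) \<Longrightarrow> (\<forall>c<n. v c = 0)"
    by blast
  show ?thesis
  \<comment> \<open>The extra factor keeps the degree from dropping.\<close>
  proof (intro bexI[of _ "\<lambda>l. G l * coeff (\<phi> l) d"] conjI allI impI)
    show "(\<lambda>l. G l * coeff (\<phi> l) d) \<in> poly_alg A"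
      by (intro poly_alg_intros G co)
    show "G l0 * coeff (\<phi> l0) d \<noteq> 0"
      using G l0(1) d by auto
  next
    fix l assume nz: "G l * coeff (\<phi> l) d \<noteq> 0"
    then show dl: "degree (\<phi> l) = d"
      using deg[of l] le_degree[of "\<phi> l" d] by auto
    show "rsquarefree (\<phi> l)"
      unfolding rsquarefree_roots
    proof (intro allI notI)
      fix z assume z: "poly (\<phi> l) z = 0 \<and> poly (pderiv (\<phi> l)) z = 0"
      then obtain \<psi> \<xi> where \<psi>: "\<phi> l = [:-z, 1:] * \<psi>" and \<xi>: "pderiv (\<phi> l) = [:-z, 1:] * \<xi>"
        by (meson dvdE poly_eq_0_iff_dvd)
      have \<psi>0: "\<psi> \<noteq> 0"
        using \<psi> dl d by auto
      then have d\<psi>: "degree \<psi> = d'"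
        using dl d' unfolding \<psi> by (subst (asm) degree_mult_eq) auto
      have d\<xi>: "\<xi> = 0 \<or> degree \<xi> < d'"
      proof (cases "\<xi> = 0")
        case False
        then have "degree (pderiv (\<phi> l)) = Suc (degree \<xi>)"
          unfolding \<xi> by (subst degree_mult_eq) auto
        then show ?thesis
          using dl d' by (simp add: degree_pderiv)
      qed simp
      \<comment> \<open>A double root z divides out of both \<phi> and \<phi>', and the two
        quotients give a nonzero kernel vector: \<xi> \<phi> - \<psi> \<phi>' = 0.\<close>
      define v where "v c = (if c < d' then coeff \<xi> c else - coeff \<psi> (c - d'))" for c
      have "hi v = \<xi>"
        using d\<xi> by (auto intro!: poly_eqI simp: hi_def coeff_sum v_def coeff_eq_0 not_less)
      moreover have "lo v = - \<psi>"
        using d\<psi> d' by (auto intro!: poly_eqI simp: lo_def coeff_sum v_def coeff_eq_0 not_less)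
      ultimately have "hi v * \<phi> l + lo v * pderiv (\<phi> l) = 0"
        by (subst \<xi>, subst \<psi>) (simp add: algebra_simps)
      then have "\<forall>c<n. v c = 0"
        by (intro inj) (use nz in \<open>auto simp: comb simp del: coeff_add\<close>)
      then have "v (d' + d') = 0"
        by (simp add: n_def d')
      then show False
        using \<psi>0 d\<psi> by (simp add: v_def) (metis leading_coeff_0_iff)
    qed
  qed
qed

section \<open>Polynomial functions and forms\<close>

definition dot :: "complex ^ 'n \<Rightarrow> complex ^ 'n \<Rightarrow> complex" where
  "dot a v = (\<Sum>i\<in>UNIV. a $ i * v $ i)"

lemma dot_linear [simp]:
  "dot a (v + w) = dot a v + dot a w" "dot a (c *s v) = c * dot a v"
  "dot (a + b) v = dot a v + dot b v" "dot (c *s a) v = c * dot a v"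
  "dot a 0 = 0" "dot 0 a = 0" "dot a (v - w) = dot a v - dot a w"
  by (simp_all add: dot_def algebra_simps sum.distrib sum_distrib_left sum_subtractf)

lemma poly_alg_along:
  assumes "F \<in> poly_alg A" "\<And>f. f \<in> A \<Longrightarrow> \<exists>p. \<forall>s. f (\<gamma> s) = poly p s"
  shows "\<exists>p. \<forall>s::complex. F (\<gamma> s) = poly p s"
  using assms(1)
proof induction
  case (const c)
  show ?case
    by (rule exI[of _ "[:c:]"]) simp
next
  case (add f g)
  then show ?case
    by (metis poly_add)
next
  case (mult f g)
  then show ?case
    by (metis poly_mult)
qed (rule assms)

lemma polys_along:
  fixes \<gamma> :: "complex \<Rightarrow> complex ^ 'n"
  assumes "F \<in> polys" "\<And>i. \<exists>p. \<forall>s. \<gamma> s $ i = poly p s"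
  shows "\<exists>p. \<forall>s::complex. F (\<gamma> s) = poly p s"
proof (rule poly_alg_along[where A = "range (\<lambda>i x. x $ i)" and F = F and \<gamma> = \<gamma>])
  show "F \<in> poly_alg (range (\<lambda>i x. x $ i))"
    using assms(1) by (simp add: polys_def)
  fix f assume "f \<in> range (\<lambda>i (x :: complex ^ 'n). x $ i)"
  then obtain i where "f = (\<lambda>x. x $ i)"
    by blast
  then show "\<exists>p. \<forall>s. f (\<gamma> s) = poly p s"
    using assms(2)[of i] by simp
qed

lemma continuous_on_polys: "F \<in> polys \<Longrightarrow> continuous_on X F"
  unfolding polys_def by (induction rule: poly_alg.induct) (auto intro!: continuous_intros)

lemma continuous_on_polys' [continuous_intros]:
  "F \<in> polys \<Longrightarrow> continuous_on X g \<Longrightarrow> continuous_on X (\<lambda>x. F (g x))"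
  by (rule continuous_on_compose2[OF continuous_on_polys[of F UNIV]]) auto

lemma continuous_on_vector_smult [continuous_intros]:
  assumes "continuous_on X f" "continuous_on X g"
  shows "continuous_on X (\<lambda>x. f x *s (g x :: complex ^ 'n))"
proof -
  have "(\<lambda>x. f x *s g x) = (\<lambda>x. \<chi> i. f x * g x $ i)"
    by (simp add: vector_scalar_mult_def)
  then show ?thesis
    using assms by (simp only:) (intro continuous_on_vec_lambda continuous_intros)
qed

lemma dot_polys: "dot a \<in> polys"
  unfolding dot_def[abs_def] polys_def
  by (intro poly_alg_sum poly_alg.mult poly_alg.const poly_alg.gen) auto

lemma hom_poly_dot: "hom_poly 1 (dot a)"
  by (simp add: hom_poly_def dot_polys)

lemma hom_poly_const: "hom_poly 0 (\<lambda>_. c)"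
  by (simp add: hom_poly_def polys_def poly_alg.const)

lemma hom_poly_zero: "hom_poly d (\<lambda>_. 0)"
  by (simp add: hom_poly_def polys_def poly_alg.const)

lemma hom_poly_add: "hom_poly d F \<Longrightarrow> hom_poly d G \<Longrightarrow> hom_poly d (\<lambda>v. F v + G v)"
  by (auto simp: hom_poly_def polys_def algebra_simps intro: poly_alg.add)

lemma hom_poly_diff: "hom_poly d F \<Longrightarrow> hom_poly d G \<Longrightarrow> hom_poly d (\<lambda>v. F v - G v)"
  by (auto simp: hom_poly_def polys_def algebra_simps intro: poly_alg_diff)

lemma hom_poly_cmult: "hom_poly d F \<Longrightarrow> hom_poly d (\<lambda>v. c * F v)"
  by (auto simp: hom_poly_def polys_def algebra_simps intro: poly_alg_cmult)

lemma hom_poly_mult: "hom_poly d F \<Longrightarrow> hom_poly e G \<Longrightarrow> hom_poly (d + e) (\<lambda>v. F v * G v)"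
  by (auto simp: hom_poly_def polys_def power_add intro: poly_alg.mult)

lemma hom_poly_power: "hom_poly d F \<Longrightarrow> hom_poly (n * d) (\<lambda>v. F v ^ n)"
  by (auto simp: hom_poly_def polys_def power_mult_distrib power_mult mult.commute[of n] intro: poly_alg_power)

lemma hom_poly_sum: "(\<And>i. i \<in> X \<Longrightarrow> hom_poly d (F i)) \<Longrightarrow> hom_poly d (\<lambda>v. \<Sum>i\<in>X. F i v)"
  by (induction X rule: infinite_finite_induct) (auto intro: hom_poly_add hom_poly_zero)

lemma hom_polyD: "hom_poly d F \<Longrightarrow> F \<in> polys" "hom_poly d F \<Longrightarrow> F (c *s x) = c ^ d * F x"
  by (auto simp: hom_poly_def)

text \<open>An inductive description of the forms of degree d. It agrees with
  \<open>hom_poly\<close> by \<open>monomials_span_hom\<close> and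
  \<open>hom_poly_monomials_span\<close>, and it permits induction on the shape of a form, which the
  functional equation in \<open>hom_poly\<close> does not.\<close>

inductive monomials_span :: "nat \<Rightarrow> (complex ^ 'n \<Rightarrow> complex) \<Rightarrow> bool" where
  const: "monomials_span 0 (\<lambda>_. c)"
| coord: "monomials_span d f \<Longrightarrow> monomials_span (Suc d) (\<lambda>v. v $ i * f v)"
| add: "monomials_span d f \<Longrightarrow> monomials_span d g \<Longrightarrow> monomials_span d (\<lambda>v. f v + g v)"

lemma monomials_span_hom: "monomials_span d f \<Longrightarrow> hom_poly d f"
proof (induction rule: monomials_span.induct)
  case (coord d f i)
  then show ?case
    using poly_alg.mult[OF poly_alg.gen[of "\<lambda>x. x $ i" "range (\<lambda>i x. x $ i)"]]
    by (auto simp: hom_poly_def polys_def algebra_simps)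
qed (auto intro: hom_poly_const hom_poly_add)

lemma monomials_span_0: "monomials_span d (\<lambda>_. 0)"
proof (induction d)
  case (Suc d)
  from monomials_span.coord[OF this] show ?case
    by simp
qed (rule monomials_span.const)

lemma monomials_span_cmult: "monomials_span d f \<Longrightarrow> monomials_span d (\<lambda>v. c * f v)"
proof (induction rule: monomials_span.induct)
  case (coord d f i)
  have "(\<lambda>v. c * (v $ i * f v)) = (\<lambda>v. v $ i * (c * f v))"
    by (simp add: algebra_simps)
  then show ?case
    using monomials_span.coord[OF coord.IH] by simp
qed (auto simp: distrib_left intro: monomials_span.const monomials_span.add)

lemma monomials_span_mult:
  "monomials_span d f \<Longrightarrow> monomials_span e g \<Longrightarrow> monomials_span (d + e) (\<lambda>v. f v * g v)"
proof (induction rule: monomials_span.induct)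
  case (const c)
  then show ?case
    by (simp add: monomials_span_cmult)
next
  case (coord d f i)
  from monomials_span.coord[OF coord.IH[OF coord.prems], of i] show ?case
    by (simp add: mult.assoc)
next
  case (add d f1 f2)
  then show ?case
    by (simp add: distrib_right monomials_span.add)
qed

lemma monomials_span_sum: "(\<And>i. i \<in> X \<Longrightarrow> monomials_span d (F i)) \<Longrightarrow> monomials_span d (\<lambda>v. \<Sum>i\<in>X. F i v)"
  by (induction X rule: infinite_finite_induct) (auto intro: monomials_span.add monomials_span_0)

lemma homogeneous_components:
  assumes "F \<in> polys"
  shows "\<exists>Fs N. (\<forall>d. monomials_span d (Fs d)) \<and> (\<forall>d>N. Fs d = (\<lambda>_. 0)) \<and> (\<forall>v. F v = (\<Sum>d\<le>N. Fs d v))"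
  using assms unfolding polys_def
proof induction
  case (gen f)
  then obtain i where i: "f = (\<lambda>v. v $ i)"
    by auto
  have "monomials_span 1 f"
    using monomials_span.coord[OF monomials_span.const[of 1]] i by simp
  then show ?case
    by (intro exI[of _ "\<lambda>d. if d = 1 then f else (\<lambda>_. 0)"] exI[of _ 1])
       (auto intro: monomials_span_0)
next
  case (const c)
  show ?case
    by (intro exI[of _ "\<lambda>d. if d = 0 then (\<lambda>_. c) else (\<lambda>_. 0)"] exI[of _ 0])
       (auto intro: monomials_span_0 monomials_span.const)
next
  case (add f g)
  then obtain Fs N Gs M where
    F: "\<And>d. monomials_span d (Fs d)" "\<And>d. d > N \<Longrightarrow> Fs d = (\<lambda>_. 0)" "\<And>v. f v = (\<Sum>d\<le>N. Fs d v)" and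
    G: "\<And>d. monomials_span d (Gs d)" "\<And>d. d > M \<Longrightarrow> Gs d = (\<lambda>_. 0)" "\<And>v. g v = (\<Sum>d\<le>M. Gs d v)"
    by metis
  have "f v = (\<Sum>d\<le>max N M. Fs d v)" for v
    unfolding F(3) by (rule sum.mono_neutral_left) (auto simp: F(2))
  moreover have "g v = (\<Sum>d\<le>max N M. Gs d v)" for v
    unfolding G(3) by (rule sum.mono_neutral_left) (auto simp: G(2))
  ultimately show ?case
    by (intro exI[of _ "\<lambda>d v. Fs d v + Gs d v"] exI[of _ "max N M"])
       (use F(1,2) G(1,2) in \<open>auto simp: sum.distrib intro: monomials_span.add\<close>)
next
  case (mult f g)
  then obtain Fs N Gs M where
    F: "\<And>d. monomials_span d (Fs d)" "\<And>d. d > N \<Longrightarrow> Fs d = (\<lambda>_. 0)" "\<And>v. f v = (\<Sum>d\<le>N. Fs d v)" and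
    G: "\<And>d. monomials_span d (Gs d)" "\<And>d. d > M \<Longrightarrow> Gs d = (\<lambda>_. 0)" "\<And>v. g v = (\<Sum>d\<le>M. Gs d v)"
    by metis
  define H where "H n v = (\<Sum>d\<le>n. Fs d v * Gs (n - d) v)" for n v
  have "f v * g v = (\<Sum>n\<le>N + M. H n v)" for v
    using polynomial_product[of N "\<lambda>d. Fs d v" M "\<lambda>d. Gs d v" 1] F(2) G(2)
    by (simp add: F(3) G(3) H_def)
  moreover have "monomials_span n (H n)" for n
    unfolding H_def
  proof (rule monomials_span_sum)
    fix d assume "d \<in> {..n}"
    then show "monomials_span n (\<lambda>v. Fs d v * Gs (n - d) v)"
      using monomials_span_mult[OF F(1)[of d] G(1)[of "n - d"]] by simp
  qed
  moreover have "H n = (\<lambda>_. 0)" if "n > N + M" for n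
  proof
    fix v
    have "Fs d v * Gs (n - d) v = 0" if "d \<le> n" for d
      using F(2)[of d] G(2)[of "n - d"] \<open>n > N + M\<close> that by (cases "d > N") auto
    then show "H n v = 0"
      unfolding H_def by (intro sum.neutral) auto
  qed
  ultimately show ?case
    by (intro exI[of _ H] exI[of _ "N + M"]) auto
qed

text \<open>Comparing coefficients of the powers of c in F (c v) = c ^ D F v shows that only the
  component of degree D survives.\<close>

lemma hom_poly_monomials_span:
  assumes "hom_poly D F"
  shows "monomials_span D F"
proof -
  obtain Fs N where F: "\<And>d. monomials_span d (Fs d)" "\<And>d. d > N \<Longrightarrow> Fs d = (\<lambda>_. 0)"
      "\<And>v. F v = (\<Sum>d\<le>N. Fs d v)"
    using homogeneous_components[of F] hom_polyD(1)[OF assms] by metis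
  have "F v = Fs D v" for v
  proof -
    have eq: "(\<Sum>d\<le>max N D. Fs d v * c ^ d) = (\<Sum>d\<le>max N D. (if d = D then F v else 0) * c ^ d)" for c
    proof -
      have "(\<Sum>d\<le>max N D. Fs d v * c ^ d) = (\<Sum>d\<le>N. Fs d v * c ^ d)"
        by (rule sum.mono_neutral_right) (auto simp: F(2))
      also have "\<dots> = F (c *s v)"
        unfolding F(3) hom_polyD(2)[OF monomials_span_hom[OF F(1)]] by (simp add: mult.commute)
      also have "\<dots> = c ^ D * F v"
        by (rule hom_polyD(2)[OF assms])
      also have "\<dots> = (\<Sum>d\<le>max N D. if d = D then c ^ D * F v else 0)"
        by simp
      also have "\<dots> = (\<Sum>d\<le>max N D. (if d = D then F v else 0) * c ^ d)"
        by (intro sum.cong) auto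
      finally show ?thesis .
    qed
      have "\<forall>i\<le>max N D. Fs i v = (if i = D then F v else 0)"
      using iffD1[OF polyfun_eq_coeffs[where c = "\<lambda>d. Fs d v" and d = "\<lambda>d. if d = D then F v else 0"
            and n = "max N D"], OF allI, OF eq] .
    then show ?thesis
      by auto
  qed
  then have "F = Fs D"
    by auto
  then show ?thesis
    using F(1) by simp
qed

section \<open>Points and closed sets of projective space\<close>

definition pt :: "complex ^ 'n \<Rightarrow> ('n::finite) proj" where
  "pt v = Abs_proj (vec.span {v})"

lemma lin_pt:
  assumes "v \<noteq> 0"
  shows "lin (pt v) = range (\<lambda>c. c *s v)"
proof -
  have "vec.independent {v}"
    using assms by simp
  then have "vec.dim (vec.span {v}) = 1"
    by (metis card.empty card_insert_disjoint empty_iff finite.emptyI vec.dim_eq_card_independent vec.dim_span One_nat_def)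
  then have "lin (pt v) = vec.span {v}"
    unfolding pt_def by (intro Abs_proj_inverse) (auto simp: vec.subspace_span)
  then show ?thesis
    by (simp add: vec.span_singleton)
qed

lemma pt_cases:
  obtains v where "v \<noteq> 0" "p = pt v"
proof -
  have L: "vec.subspace (lin p)" "vec.dim (lin p) = 1"
    using lin[of p] by auto
  obtain X where X: "X \<subseteq> lin p" "vec.independent X" "lin p \<subseteq> vec.span X" "card X = 1"
    using vec.basis_exists[of "lin p"] L(2) by metis
  then obtain v where v: "X = {v}"
    by (metis card_1_singletonE)
  have "vec.span X = lin p"
    using X(1,3) L(1) vec.span_minimal by blast
  then have "p = pt v"
    using v by (simp add: pt_def lin_inverse)
  moreover have "v \<noteq> 0"
    using X(2) v by auto
  ultimately show ?thesis
    using that by blast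
qed

lemma pt_eqI: "w \<noteq> 0 \<Longrightarrow> w \<in> lin p \<Longrightarrow> p = pt w"
proof -
  assume w: "w \<noteq> 0" "w \<in> lin p"
  obtain v where v: "v \<noteq> 0" "p = pt v"
    by (rule pt_cases)
  then obtain c where c: "w = c *s v"
    using w lin_pt by auto
  then have "c \<noteq> 0"
    using w by auto
  have "lin (pt w) = lin (pt v)"
  proof -
    have "k *s v = (k / c) *s w" "k *s w = (k * c) *s v" for k
      using c \<open>c \<noteq> 0\<close> by (simp_all add: vector_smult_assoc)
    then show ?thesis
      unfolding lin_pt[OF w(1)] lin_pt[OF v(1)] by blast
  qed
  then show ?thesis
    using v(2) lin_inject by metis
qed

lemma pt_eq_iff:
  assumes "v \<noteq> 0" "w \<noteq> 0"
  shows "pt v = pt w \<longleftrightarrow> (\<exists>c. w = c *s v)"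
proof
  assume "pt v = pt w"
  then have "range (\<lambda>c. c *s v) = range (\<lambda>c. c *s w)"
    using lin_pt[OF assms(1)] lin_pt[OF assms(2)] by simp
  moreover have "w \<in> range (\<lambda>c. c *s w)"
    by (rule image_eqI[of _ _ 1]) simp_all
  ultimately have "w \<in> range (\<lambda>c. c *s v)"
    by simp
  then show "\<exists>c. w = c *s v"
    by blast
next
  assume "\<exists>c. w = c *s v"
  then have "w \<in> lin (pt v)"
    using lin_pt[OF assms(1)] by auto
  then show "pt v = pt w"
    by (rule pt_eqI[OF assms(2)])
qed

lemma pt_smult: "c \<noteq> 0 \<Longrightarrow> v \<noteq> 0 \<Longrightarrow> pt (c *s v) = pt v"
  using pt_eq_iff[of v "c *s v"] by auto

lemma vanishes_pt: "v \<noteq> 0 \<Longrightarrow> vanishes F (pt v) \<longleftrightarrow> (\<forall>c. F (c *s v) = 0)"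
  by (auto simp: vanishes_def lin_pt)

lemma vanishes_hom: "hom_poly d F \<Longrightarrow> v \<noteq> 0 \<Longrightarrow> vanishes F (pt v) \<longleftrightarrow> F v = 0"
proof -
  assume F: "hom_poly d F" and v: "v \<noteq> 0"
  have "F v = F (1 *s v)"
    by simp
  then show ?thesis
    unfolding vanishes_pt[OF v] using hom_polyD(2)[OF F] by auto
qed

lemma hyperplane_dot: "hyperplane a = {p. vanishes (dot a) p}"
  by (simp add: hyperplane_def dot_def[abs_def])

lemma in_hyperplane: "v \<noteq> 0 \<Longrightarrow> pt v \<in> hyperplane a \<longleftrightarrow> dot a v = 0"
  by (simp add: hyperplane_dot vanishes_hom[OF hom_poly_dot])

text \<open>On the line through v a form is a constant times c ^ d. If the constant is nonzero, the
  other factor vanishes for c \<noteq> 0, hence also at c = 0. One factor is allowed to be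
  inhomogeneous because the denominators in \<open>vanishing_order\<close> are.\<close>

lemma vanishes_mult:
  assumes "hom_poly d F" "G \<in> polys"
  shows "vanishes (\<lambda>v. G v * F v) p \<longleftrightarrow> vanishes F p \<or> vanishes G p"
proof -
  obtain v where v: "v \<noteq> 0" "p = pt v"
    by (rule pt_cases)
  have "vanishes G p" if *: "\<And>c. G (c *s v) * (c ^ d * F v) = 0" and nz: "F v \<noteq> 0"
  proof -
    have "G (c *s v) = 0" for c
      by (rule continuous_eq_at_0[where f = "\<lambda>c. G (c *s v)" and g = "\<lambda>_. 0"])
         (use * nz assms(2) in \<open>auto intro!: continuous_intros\<close>)
    then show ?thesis
      using v by (simp add: vanishes_pt)
  qed
  then show ?thesis
    using v hom_polyD(2)[OF assms(1)] by (auto simp: vanishes_pt)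
qed

lemma proj_closedI:
  assumes "\<And>p. p \<notin> X \<Longrightarrow> \<exists>d F. hom_poly d F \<and> (\<forall>x\<in>X. vanishes F x) \<and> \<not> vanishes F p"
  shows "proj_closed X"
  unfolding proj_closed_def
proof (intro exI conjI)
  let ?T = "{F. (\<exists>d. hom_poly d F) \<and> (\<forall>x\<in>X. vanishes F x)}"
  show "\<forall>F\<in>?T. \<exists>d. hom_poly d F"
    by auto
  show "X = {p. \<forall>F\<in>?T. vanishes F p}"
    using assms by blast
qed

lemma proj_closedD:
  assumes "proj_closed X" "p \<notin> X"
  obtains d F where "hom_poly d F" "\<forall>x\<in>X. vanishes F x" "\<not> vanishes F p"
  using assms unfolding proj_closed_def by blast

lemma proj_closed_form: "hom_poly d F \<Longrightarrow> proj_closed {p. vanishes F p}"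
  by (rule proj_closedI) auto

lemma proj_closed_Int: "proj_closed X \<Longrightarrow> proj_closed Y \<Longrightarrow> proj_closed (X \<inter> Y)"
proof (rule proj_closedI)
  fix p assume X: "proj_closed X" and Y: "proj_closed Y" and "p \<notin> X \<inter> Y"
  then consider "p \<notin> X" | "p \<notin> Y"
    by blast
  then show "\<exists>d F. hom_poly d F \<and> (\<forall>x\<in>X \<inter> Y. vanishes F x) \<and> \<not> vanishes F p"
  proof cases
    case 1
    obtain d F where "hom_poly d F" "\<forall>x\<in>X. vanishes F x" "\<not> vanishes F p"
      by (rule proj_closedD[OF X 1])
    then show ?thesis
      by (intro exI[of _ d] exI[of _ F]) auto
  next
    case 2
    obtain d F where "hom_poly d F" "\<forall>x\<in>Y. vanishes F x" "\<not> vanishes F p"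
      by (rule proj_closedD[OF Y 2])
    then show ?thesis
      by (intro exI[of _ d] exI[of _ F]) auto
  qed
qed

lemma proj_closed_Un:
  assumes "proj_closed X" "proj_closed Y"
  shows "proj_closed (X \<union> Y)"
proof (rule proj_closedI)
  fix p assume "p \<notin> X \<union> Y"
  then have p: "p \<notin> X" "p \<notin> Y"
    by auto
  obtain d F where F: "hom_poly d F" "\<forall>x\<in>X. vanishes F x" "\<not> vanishes F p"
    by (rule proj_closedD[OF assms(1) p(1)])
  obtain e G where G: "hom_poly e G" "\<forall>x\<in>Y. vanishes G x" "\<not> vanishes G p"
    by (rule proj_closedD[OF assms(2) p(2)])
  have "hom_poly (e + d) (\<lambda>v. G v * F v)"
    using F G by (intro hom_poly_mult)
  moreover have "vanishes (\<lambda>v. G v * F v) x \<longleftrightarrow> vanishes F x \<or> vanishes G x" for x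
    using F(1) hom_polyD(1)[OF G(1)] by (rule vanishes_mult)
  ultimately show "\<exists>d F. hom_poly d F \<and> (\<forall>x\<in>X \<union> Y. vanishes F x) \<and> \<not> vanishes F p"
    using F G by (intro exI[of _ "e + d"] exI[of _ "\<lambda>v. G v * F v"]) auto
qed

text \<open>A polynomial vanishes on a line through the origin iff each of its homogeneous
  components does.\<close>

lemma proj_closed_vanishes:
  assumes "F \<in> polys"
  shows "proj_closed {p. vanishes F p}"
proof -
  obtain Fs N where F: "\<And>d. monomials_span d (Fs d)" "\<And>v. F v = (\<Sum>d\<le>N. Fs d v)"
    using homogeneous_components[OF assms] by metis
  have "vanishes F p \<longleftrightarrow> (\<forall>d\<le>N. vanishes (Fs d) p)" for p
  proof -
    obtain v where v: "v \<noteq> 0" "p = pt v"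
      by (rule pt_cases)
    have "F (c *s v) = (\<Sum>d\<le>N. Fs d v * c ^ d)" for c
      unfolding F(2) hom_polyD(2)[OF monomials_span_hom[OF F(1)]] by (simp add: mult.commute)
    then have "vanishes F p \<longleftrightarrow> (\<forall>c. (\<Sum>d\<le>N. Fs d v * c ^ d) = 0)"
      using v by (simp add: vanishes_pt)
    also have "\<dots> \<longleftrightarrow> (\<forall>d\<le>N. Fs d v = 0)"
      by (rule polyfun_eq_0)
    also have "\<dots> \<longleftrightarrow> (\<forall>d\<le>N. vanishes (Fs d) p)"
      using v vanishes_hom[OF monomials_span_hom[OF F(1)]] by simp
    finally show ?thesis .
  qed
  then show ?thesis
    using monomials_span_hom[OF F(1)] unfolding proj_closed_def
    by (intro exI[of _ "Fs ` {..N}"]) auto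
qed

lemma proj_closed_empty: "proj_closed {}"
proof (rule proj_closedI)
  fix p :: "'a proj"
  obtain v where "v \<noteq> 0" "p = pt v"
    by (rule pt_cases)
  then show "\<exists>d F. hom_poly d F \<and> (\<forall>x\<in>{}. vanishes F x) \<and> \<not> vanishes F p"
    using vanishes_hom[OF hom_poly_const[of 1]] hom_poly_const[of 1] by (intro exI[of _ 0] exI[of _ "\<lambda>_. 1"]) auto
qed

text \<open>The form is a 2 x 2 minor v_i x_j - v_j x_i of the pair (v, x).\<close>

lemma separating_linear_form:
  assumes "v \<noteq> 0" "pt v \<noteq> pt w" "w \<noteq> 0"
  obtains a where "dot a v = 0" "dot a w \<noteq> 0"
proof -
  obtain i where i: "v $ i \<noteq> 0"
    using assms(1) by (metis vec_eq_iff zero_index)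
  have "w \<noteq> (w $ i / v $ i) *s v"
    using assms pt_eq_iff by blast
  then obtain j where j: "w $ j \<noteq> w $ i / v $ i * v $ j"
    by (auto simp: vec_eq_iff)
  define a where "a = v $ i *s axis j 1 - v $ j *s axis i (1::complex)"
  have axis: "dot (axis l 1) x = x $ l" for l and x :: "complex ^ 'a"
    by (simp add: dot_def axis_def if_distrib if_distribR cong: if_cong)
  have "dot a x = v $ i * x $ j - v $ j * x $ i" for x
  proof -
    have "a = v $ i *s axis j 1 + (- v $ j) *s axis i 1"
      by (simp add: a_def vec_eq_iff)
    then have "dot a x = v $ i * dot (axis j 1) x + (- v $ j) * dot (axis i 1) x"
      by (simp only: dot_linear)
    then show ?thesis
      by (simp add: axis)
  qed
  then have "dot a v = 0" "dot a w = v $ i * w $ j - v $ j * w $ i"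
    by simp_all
  then show ?thesis
    using i j by (intro that[of a]) (auto simp: field_simps simp del: dot_linear)
qed

lemma proj_closed_singleton: "proj_closed {p}"
proof (rule proj_closedI)
  fix p' assume "p' \<notin> {p}"
  moreover obtain v w where v: "v \<noteq> 0" "p = pt v" "w \<noteq> 0" "p' = pt w"
    by (rule pt_cases[of p], rule pt_cases[of p'])
  ultimately have "pt v \<noteq> pt w"
    by auto
  from separating_linear_form[OF v(1) this v(3)] obtain a where "dot a v = 0" "dot a w \<noteq> 0"
    by blast
  then show "\<exists>d F. hom_poly d F \<and> (\<forall>x\<in>{p}. vanishes F x) \<and> \<not> vanishes F p'"
    using v hom_poly_dot[of a] vanishes_hom[OF hom_poly_dot] by (intro exI[of _ 1] exI[of _ "dot a"]) auto
qed

lemma proj_closed_finite: "finite X \<Longrightarrow> proj_closed X"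
proof (induction X rule: finite_induct)
  case (insert x X)
  then show ?case
    using proj_closed_Un[OF proj_closed_singleton[of x] insert.IH] by simp
qed (rule proj_closed_empty)

section \<open>Varieties, dimension and degree\<close>

lemma variety_subset_Un:
  assumes "variety X" "proj_closed Y" "proj_closed Z" "X \<subseteq> Y \<union> Z"
  shows "X \<subseteq> Y \<or> X \<subseteq> Z"
proof -
  have "X = (X \<inter> Y) \<union> (X \<inter> Z)"
    using assms(4) by blast
  moreover have "proj_closed (X \<inter> Y)" "proj_closed (X \<inter> Z)"
    using assms proj_closed_Int unfolding variety_def by auto
  ultimately have "X = X \<inter> Y \<or> X = X \<inter> Z"
    using assms(1) unfolding variety_def by blast
  then show ?thesis
    by blast
qed

text \<open>Two proper closed pieces are separated from suitable points by forms F and G, so it is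
  enough that the homogeneous ideal is prime.\<close>

lemma varietyI:
  assumes "proj_closed X" "X \<noteq> {}"
    and "\<And>d e F G. hom_poly d F \<Longrightarrow> hom_poly e G \<Longrightarrow> (\<forall>p\<in>X. vanishes F p \<or> vanishes G p) \<Longrightarrow>
      (\<forall>p\<in>X. vanishes F p) \<or> (\<forall>p\<in>X. vanishes G p)"
  shows "variety X"
  unfolding variety_def
proof (intro conjI allI impI)
  fix Y Z assume YZ: "proj_closed Y" "proj_closed Z" "X = Y \<union> Z"
  show "X = Y \<or> X = Z"
  proof (rule ccontr)
    assume "\<not> ?thesis"
    then obtain p p' where p: "p \<in> X" "p \<notin> Y" "p' \<in> X" "p' \<notin> Z"
      using YZ(3) by blast
    obtain d F where F: "hom_poly d F" "\<forall>x\<in>Y. vanishes F x" "\<not> vanishes F p"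
      by (rule proj_closedD[OF YZ(1) p(2)])
    obtain e G where G: "hom_poly e G" "\<forall>x\<in>Z. vanishes G x" "\<not> vanishes G p'"
      by (rule proj_closedD[OF YZ(2) p(4)])
    show False
      using assms(3)[OF F(1) G(1)] F(2,3) G(2,3) p YZ(3) by auto
  qed
qed (use assms in auto)

lemma variety_singleton: "variety {p}"
  by (rule varietyI) (auto intro: proj_closed_singleton)

lemma variety_in_finite:
  assumes "variety X" "finite Y" "X \<subseteq> Y"
  obtains p where "X = {p}"
proof -
  have "\<exists>p. X = {p}"
    using assms(2,3)
  proof (induction Y rule: finite_induct)
    case empty
    then show ?case
      using assms(1) by (auto simp: variety_def)
  next
    case (insert x Y)
    then have "X \<subseteq> {x} \<union> Y"
      by auto
    then have "X \<subseteq> {x} \<or> X \<subseteq> Y"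
      using variety_subset_Un[OF assms(1) proj_closed_singleton proj_closed_finite[OF insert.hyps(1)]] by blast
    then show ?case
      using insert.IH assms(1) by (auto simp: variety_def)
  qed
  then show ?thesis
    using that by blast
qed

text \<open>Density principle: the part of a variety outside a closed set not containing it is
  dense. With the hyperplane \<open>X 0\<close> = 0 as that closed set, it transfers equations from
  the affine chart to whole curves.\<close>

lemma variety_subset_vanishes:
  assumes "variety X" "F \<in> polys" "proj_closed Y" "\<not> X \<subseteq> Y" "\<And>p. p \<in> X \<Longrightarrow> p \<notin> Y \<Longrightarrow> vanishes F p"
    and "p \<in> X"
  shows "vanishes F p"
  using variety_subset_Un[OF assms(1) proj_closed_vanishes[OF assms(2)] assms(3)] assms(4-6) by blast

lemma variety_chain_mono:
  assumes "variety_chain X k" "j \<le> k"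
  shows "variety_chain X j"
proof -
  obtain Z where "\<forall>i\<le>k. variety (Z i) \<and> Z i \<subseteq> X" "\<forall>i<k. Z i \<subset> Z (Suc i)"
    using assms(1) unfolding variety_chain_def by (elim exE conjE)
  then show ?thesis
    unfolding variety_chain_def using assms(2) by (intro exI[of _ Z]) auto
qed

lemma has_dim_unique:
  assumes "has_dim X k" "has_dim X j"
  shows "k = j"
  using assms variety_chain_mono[of X k "Suc j"] variety_chain_mono[of X j "Suc k"]
  unfolding has_dim_def by (cases j k rule: linorder_cases) auto

lemma variety_chain_Cons:
  assumes "variety Y" "variety_chain X k" "Y \<subseteq> X'" "X \<subset> Y"
  shows "variety_chain X' (Suc k)"
proof -
  obtain Z where Z: "\<forall>i\<le>k. variety (Z i) \<and> Z i \<subseteq> X" "\<forall>i<k. Z i \<subset> Z (Suc i)"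
    using assms(2) unfolding variety_chain_def by (elim exE conjE)
  define W where "W i = (if i \<le> k then Z i else Y)" for i
  have "variety (W i) \<and> W i \<subseteq> X'" for i
    using Z(1) assms(1,3,4) by (cases "i \<le> k") (auto simp: W_def)
  moreover have "W i \<subset> W (Suc i)" if "i < Suc k" for i
  proof (cases "i < k")
    case True
    then show ?thesis
      using Z(2) by (simp add: W_def)
  next
    case False
    then have "i = k"
      using that by simp
    then show ?thesis
      using Z(1) assms(4) by (auto simp: W_def)
  qed
  ultimately show ?thesis
    unfolding variety_chain_def by (intro exI[of _ W]) simp
qed

lemma variety_chain_1:
  assumes "variety X" "p \<in> X" "p' \<in> X" "p \<noteq> p'"
  shows "variety_chain X 1"
proof -
  have "variety_chain {p} 0"
    unfolding variety_chain_def by (rule exI[of _ "\<lambda>_. {p}"]) (auto intro: variety_singleton)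
  then have "variety_chain X (Suc 0)"
    by (rule variety_chain_Cons[OF assms(1)]) (use assms in auto)
  then show ?thesis
    by simp
qed

text \<open>A chain of length 2 in C could be prolonged by S to one of length 3; two points give a
  chain of length 1.\<close>

lemma curve_in_surface:
  assumes S: "variety S" "has_dim S 2" and C: "variety C" "C \<subset> S" "p \<in> C" "p' \<in> C" "p \<noteq> p'"
  shows "curve_on S C"
proof -
  have "\<not> variety_chain C 2"
    using variety_chain_Cons[OF S(1) _ subset_refl C(2), of 2] S(2) unfolding has_dim_def by auto
  then show ?thesis
    using C variety_chain_1[OF C(1,3,4,5)] unfolding curve_on_def has_dim_def by (auto simp: numeral_2_eq_2)
qed

lemma curve_on_proper:
  assumes "has_dim S 2" "curve_on S C"
  shows "C \<subset> S"
  using assms has_dim_unique[of S 1 2] unfolding curve_on_def by auto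

text \<open>A strict inclusion of C in D, followed by D in S, would prolong a chain in C to one of
  length 3 in S.\<close>

lemma curve_eq:
  assumes "has_dim S 2" "variety S" "curve_on S C" "variety D" "C \<subseteq> D" "D \<subset> S"
  shows "C = D"
proof (rule ccontr)
  assume "C \<noteq> D"
  then have "C \<subset> D"
    using assms by auto
  moreover have "variety_chain C 1"
    using assms by (simp add: curve_on_def has_dim_def)
  ultimately have "variety_chain D 2"
    using variety_chain_Cons[OF assms(4) _ subset_refl, of C 1] by (simp add: numeral_2_eq_2)
  then have "variety_chain S 3"
    using variety_chain_Cons[OF assms(2) _ subset_refl assms(6), of 2] by (simp add: numeral_3_eq_3 numeral_2_eq_2)
  then show False
    using assms(1) by (simp add: has_dim_def numeral_3_eq_3 numeral_2_eq_2)
qed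

lemma curve_infinite:
  assumes "curve_on S C"
  shows "infinite C"
proof
  assume fin: "finite C"
  have "variety_chain C 1"
    using assms by (simp add: curve_on_def has_dim_def)
  then obtain Z where Z: "\<forall>i\<le>1. variety (Z i) \<and> Z i \<subseteq> C" "\<forall>i<1. Z i \<subset> Z (Suc i)"
    unfolding variety_chain_def by (elim exE conjE)
  then have "variety (Z 0)" "variety (Z 1)" "Z 0 \<subset> Z 1" "Z 1 \<subseteq> C"
    by auto
  moreover obtain p where "Z 1 = {p}"
    using variety_in_finite[OF \<open>variety (Z 1)\<close> fin \<open>Z 1 \<subseteq> C\<close>] by blast
  ultimately show False
    by (auto simp: variety_def)
qed

section \<open>Degrees of curves via general hyperplanes\<close>

definition coefficient_functions :: "nat \<Rightarrow> ((nat \<Rightarrow> complex ^ 'n) \<Rightarrow> complex) set" where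
  "coefficient_functions k = {(\<lambda>l. l j $ i) | j i. j < k}"

lemma coefficient_functionsI: "j < k \<Longrightarrow> (\<lambda>l. l j $ i) \<in> coefficient_functions k"
  by (auto simp: coefficient_functions_def)

lemma poly_alg_line:
  fixes l1 l2 :: "nat \<Rightarrow> complex ^ 'n"
  assumes "G \<in> poly_alg (coefficient_functions k)"
  shows "\<exists>p. \<forall>s. G (\<lambda>j. l1 j + s *s l2 j) = poly p s"
proof (rule poly_alg_along[where \<gamma> = "\<lambda>s j. l1 j + s *s l2 j", OF assms])
  fix f :: "(nat \<Rightarrow> complex ^ 'n) \<Rightarrow> complex" assume "f \<in> (coefficient_functions k)"
  then obtain j i where "f = (\<lambda>l. l j $ i)"
    unfolding coefficient_functions_def by blast
  then show "\<exists>p. \<forall>s. f (\<lambda>j. l1 j + s *s l2 j) = poly p s"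
    by (intro exI[of _ "[:l1 j $ i, l2 j $ i:]"]) auto
qed

text \<open>On the line joining \<open>l1\<close> and \<open>l2\<close> both functions become
  nonzero polynomials in one parameter, with finitely many roots. Thus two generic conditions can be
  met together, and degrees are unique.\<close>

lemma poly_alg_nonzero_Int:
  fixes G H :: "(nat \<Rightarrow> complex ^ 'n) \<Rightarrow> complex"
  assumes "G \<in> poly_alg (coefficient_functions k)" "H \<in> poly_alg (coefficient_functions k)"
    and "G l1 \<noteq> 0" "H l2 \<noteq> 0"
  obtains l where "G l \<noteq> 0" "H l \<noteq> 0"
proof -
  define \<gamma> where "\<gamma> s = (\<lambda>j. l1 j + s *s (l2 j - l1 j))" for s
  obtain p q where pq: "\<And>s. G (\<gamma> s) = poly p s" "\<And>s. H (\<gamma> s) = poly q s"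
    using poly_alg_line[OF assms(1)] poly_alg_line[OF assms(2)] unfolding \<gamma>_def by metis
  have "\<gamma> 0 = l1" "\<gamma> 1 = l2"
    by (auto simp: \<gamma>_def)
  then have "p \<noteq> 0" "q \<noteq> 0"
    using pq[of 0] pq[of 1] assms(3,4) by auto
  then obtain s where "poly p s \<noteq> 0" "s \<notin> {s. poly q s = 0}"
    using infinite_not_root[of p "{s. poly q s = 0}"] poly_roots_finite by blast
  then have "G (\<gamma> s) \<noteq> 0" "H (\<gamma> s) \<noteq> 0"
    using pq by auto
  then show ?thesis
    by (rule that)
qed

lemma curve_degreeE:
  assumes "has_dim C 1" "has_degree (C :: ('n::finite) proj set) d"
  obtains G l0 where "G \<in> poly_alg (coefficient_functions 1)" "G l0 \<noteq> 0"
    "\<forall>l. G l \<noteq> 0 \<longrightarrow> finite (C \<inter> hyperplane (l 0))" "\<forall>l. G l \<noteq> 0 \<longrightarrow> card (C \<inter> hyperplane (l 0)) = d"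
proof -
  obtain k G where k: "has_dim C k" and G: "G \<in> poly_alg (coefficient_functions k)"
    "\<exists>l. G l \<noteq> 0" "\<forall>l. G l \<noteq> 0 \<longrightarrow> finite (C \<inter> (\<Inter>j<k. hyperplane (l j))) \<and>
                          card (C \<inter> (\<Inter>j<k. hyperplane (l j))) = d"
    using assms(2) unfolding has_degree_def coefficient_functions_def by blast
  have "k = 1"
    using k assms(1) by (rule has_dim_unique)
  then show ?thesis
    using that G by (auto simp: lessThan_Suc)
qed

lemma curve_degreeI:
  assumes "has_dim C 1" "G \<in> poly_alg (coefficient_functions 1)" "G l0 \<noteq> 0"
    "\<forall>l. G l \<noteq> 0 \<longrightarrow> finite (C \<inter> hyperplane (l 0))" "\<forall>l. G l \<noteq> 0 \<longrightarrow> card (C \<inter> hyperplane (l 0)) = d"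
  shows "has_degree (C :: ('n::finite) proj set) d"
  unfolding has_degree_def coefficient_functions_def[symmetric]
proof (intro exI[of _ 1] conjI bexI[of _ G])
  show "G \<in> poly_alg (coefficient_functions 1)"
    by (rule assms(2))
qed (use assms in \<open>auto simp: lessThan_Suc\<close>)

lemma curve_degree_unique:
  fixes C :: "('n::finite) proj set"
  assumes "has_dim C 1" "has_degree C d" "has_degree C e"
  shows "d = e"
proof -
  obtain G l1 where G: "G \<in> poly_alg (coefficient_functions 1)" "G l1 \<noteq> 0"
      "\<forall>l. G l \<noteq> 0 \<longrightarrow> finite (C \<inter> hyperplane (l 0))"
      "\<forall>l. G l \<noteq> 0 \<longrightarrow> card (C \<inter> hyperplane (l 0)) = d"
    by (rule curve_degreeE[OF assms(1,2)])
  obtain H l2 where H: "H \<in> poly_alg (coefficient_functions 1)" "H l2 \<noteq> 0"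
      "\<forall>l. H l \<noteq> 0 \<longrightarrow> finite (C \<inter> hyperplane (l 0))"
      "\<forall>l. H l \<noteq> 0 \<longrightarrow> card (C \<inter> hyperplane (l 0)) = e"
    by (rule curve_degreeE[OF assms(1,3)])
  obtain l where "G l \<noteq> 0" "H l \<noteq> 0"
    using poly_alg_nonzero_Int[OF G(1) H(1) G(2) H(2)] by blast
  then show ?thesis
    using G(4) H(4) by auto
qed

text \<open>A general hyperplane does not contain the point v, so it meets the line through v and w
  in one point at most.\<close>

lemma degree_le_1_in_line:
  fixes v w :: "complex ^ ('n::finite)"
  assumes C: "has_dim C 1" "has_degree C d" and v: "v \<noteq> 0"
    and line: "\<And>p. p \<in> C \<Longrightarrow> \<exists>s t. s *s v + t *s w \<noteq> 0 \<and> p = pt (s *s v + t *s w)"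
  shows "d \<le> 1"
proof -
  obtain G l1 where G: "G \<in> poly_alg (coefficient_functions 1)" "G l1 \<noteq> 0"
      "\<forall>l. G l \<noteq> 0 \<longrightarrow> finite (C \<inter> hyperplane (l 0))"
      "\<forall>l. G l \<noteq> 0 \<longrightarrow> card (C \<inter> hyperplane (l 0)) = d"
    by (rule curve_degreeE[OF C])
  define H where "H l = dot (l 0) v" for l :: "nat \<Rightarrow> complex ^ 'n"
  have H: "H \<in> poly_alg (coefficient_functions 1)"
    unfolding H_def dot_def by (intro poly_alg_intros poly_alg.gen coefficient_functionsI) auto
  obtain i where "v $ i \<noteq> 0"
    using v by (metis vec_eq_iff zero_index)
  then have "H (\<lambda>_. axis i 1) \<noteq> 0"
    by (simp add: H_def dot_def axis_def if_distrib if_distribR cong: if_cong)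
  then obtain l where l: "G l \<noteq> 0" "H l \<noteq> 0"
    using poly_alg_nonzero_Int[OF G(1) H G(2)] by blast
  define a where "a = l 0"
  have av: "dot a v \<noteq> 0"
    using l by (simp add: H_def a_def)
  \<comment> \<open>The one point of the line in the hyperplane, obtained by solving s * dot a v + t
    * dot a w = 0.\<close>
  have "p = pt (- dot a w *s v + dot a v *s w)" if p: "p \<in> C" "p \<in> hyperplane a" for p
  proof -
    obtain s t where st: "s *s v + t *s w \<noteq> 0" "p = pt (s *s v + t *s w)"
      using line[OF p(1)] by blast
    then have "s * dot a v + t * dot a w = 0"
      using p(2) by (simp add: in_hyperplane)
    then have s: "s = - t * dot a w / dot a v"
      using av by (simp add: field_simps eq_neg_iff_add_eq_0)
    have eq: "s *s v + t *s w = (t / dot a v) *s (- dot a w *s v + dot a v *s w)"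
      using av unfolding s by (simp add: vector_add_ldistrib vector_smult_assoc)
    have "(t / dot a v) *s (- dot a w *s v + dot a v *s w) \<noteq> 0"
      using st(1) unfolding eq .
    then have "t / dot a v \<noteq> 0" "- dot a w *s v + dot a v *s w \<noteq> 0"
      unfolding vector_mul_eq_0 by blast+
    then show ?thesis
      using st(2) eq pt_smult by metis
  qed
  then have "C \<inter> hyperplane a \<subseteq> {pt (- dot a w *s v + dot a v *s w)}"
    by blast
  then have "card (C \<inter> hyperplane a) \<le> 1"
    by (metis card.empty card_insert_disjoint card_mono empty_iff finite.emptyI finite.insertI One_nat_def)
  then show ?thesis
    using G(4) l(1) by (simp add: a_def)
qed

section \<open>The cubic scroll\<close>

definition scroll_map :: "(nat \<Rightarrow> complex ^ 5) \<Rightarrow> complex \<Rightarrow> complex \<Rightarrow> complex \<Rightarrow> complex \<Rightarrow> complex ^ 5" where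
  "scroll_map M x y z e = (x\<^sup>2 * e) *s M 0 + (x * y * e) *s M 1 + (y\<^sup>2 * e) *s M 2 + (x * z) *s M 3 + (y * z) *s M 4"

text \<open>Homogeneous (Cox) coordinates on the blow-up: \<open>x\<close>, \<open>y\<close> are sections of \<open>h - e\<close>, \<open>z\<close> of \<open>h\<close>
  and \<open>e\<close> of the exceptional class. The two pairs may not vanish simultaneously.\<close>

definition valid :: "complex \<Rightarrow> complex \<Rightarrow> complex \<Rightarrow> complex \<Rightarrow> bool" where
  "valid x y z e \<longleftrightarrow> (x \<noteq> 0 \<or> y \<noteq> 0) \<and> (z \<noteq> 0 \<or> e \<noteq> 0)"

text \<open>The dual family \<open>N\<close> provides linear coordinates in which S is the standard
  cubic scroll. Working with these forms replaces a change of coordinates of the ambient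
  space.\<close>

locale scroll =
  fixes M N :: "nat \<Rightarrow> complex ^ 5" and S :: "5 proj set"
  assumes dual: "\<And>i j. i < 5 \<Longrightarrow> j < 5 \<Longrightarrow> dot (N i) (M j) = (if i = j then 1 else 0)"
    and S_eq: "S = {pt (scroll_map M x y z e) | x y z e. valid x y z e}"
    and S_variety: "variety S" and S_dim: "has_dim S 2"
begin

abbreviation \<Phi> where "\<Phi> \<equiv> scroll_map M"

abbreviation X where "X i \<equiv> dot (N i)"

lemma X_\<Phi> [simp]:
  "X 0 (\<Phi> x y z e) = x\<^sup>2 * e" "X (Suc 0) (\<Phi> x y z e) = x * y * e" "X 2 (\<Phi> x y z e) = y\<^sup>2 * e"
  "X 3 (\<Phi> x y z e) = x * z" "X 4 (\<Phi> x y z e) = y * z"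
  by (simp_all add: scroll_map_def dual)

lemma \<Phi>_nonzero: "valid x y z e \<Longrightarrow> \<Phi> x y z e \<noteq> 0"
proof
  assume v: "valid x y z e" and "\<Phi> x y z e = 0"
  then have "X i (\<Phi> x y z e) = 0" for i
    by simp
  from this[of 0] this[of 2] this[of 3] this[of 4] show False
    using v by (auto simp: valid_def)
qed

lemma \<Phi>_scale: "\<Phi> x y (c * z) (c * e) = c *s \<Phi> x y z e"
  "\<Phi> (c * x) (c * y) (c * z) e = c\<^sup>2 *s \<Phi> x y z e"
  by (simp_all add: scroll_map_def vector_add_ldistrib vector_smult_assoc power2_eq_square algebra_simps)

lemma \<Phi>_chart:
  assumes "x \<noteq> 0" "e \<noteq> 0"
  shows "\<Phi> x y z e = (x\<^sup>2 * e) *s \<Phi> 1 (y / x) (z / (x * e)) 1"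
  using assms by (simp add: scroll_map_def vec_eq_iff power2_eq_square algebra_simps)

lemma continuous_\<Phi> [continuous_intros]:
  assumes "continuous_on Y f" "continuous_on Y g" "continuous_on Y h" "continuous_on Y k"
  shows "continuous_on Y (\<lambda>s. \<Phi> (f s) (g s) (h s) (k s))"
  unfolding scroll_map_def by (intro continuous_intros assms)

definition upt where "upt t u = pt (\<Phi> 1 t u 1)"

lemma valid_1 [simp]: "valid 1 t u 1" "valid 1 y z 1"
  by (simp_all add: valid_def)

lemma upt_in_S: "upt t u \<in> S"
  unfolding S_eq upt_def using valid_1 by blast

lemma pt_\<Phi>_in_S: "valid x y z e \<Longrightarrow> pt (\<Phi> x y z e) \<in> S"
  unfolding S_eq by blast

lemma pt_\<Phi>_chart:
  assumes "x \<noteq> 0" "e \<noteq> 0"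
  shows "pt (\<Phi> x y z e) = upt (y / x) (z / (x * e))"
  unfolding \<Phi>_chart[OF assms] upt_def using assms by (intro pt_smult \<Phi>_nonzero) auto

lemma upt_inject: "upt t u = upt t' u' \<longleftrightarrow> t = t' \<and> u = u'"
proof
  assume "upt t u = upt t' u'"
  then obtain c where c: "\<Phi> 1 t' u' 1 = c *s \<Phi> 1 t u 1"
    unfolding upt_def by (subst (asm) pt_eq_iff) (auto simp: \<Phi>_nonzero)
  have X: "X i (\<Phi> 1 t' u' 1) = c * X i (\<Phi> 1 t u 1)" for i
    unfolding c by simp
  from X[of 0] X[of "Suc 0"] X[of 3] show "t = t' \<and> u = u'"
    by simp
qed simp

lemma vanishes_\<Phi>: "hom_poly d F \<Longrightarrow> valid x y z e \<Longrightarrow> vanishes F (pt (\<Phi> x y z e)) \<longleftrightarrow> F (\<Phi> x y z e) = 0"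
  by (simp add: vanishes_hom \<Phi>_nonzero)

lemma vanishes_upt: "hom_poly d F \<Longrightarrow> vanishes F (upt t u) \<longleftrightarrow> F (\<Phi> 1 t u 1) = 0"
  by (simp add: upt_def vanishes_\<Phi>)

lemma hom_poly_X: "hom_poly 1 (X i)"
  by (rule hom_poly_dot)

definition Exc where "Exc = {pt (\<Phi> x y 1 0) | x y. x \<noteq> 0 \<or> y \<noteq> 0}"

text \<open>The line of the ruling over (x : y). \<open>fibre 0 1\<close> is the one that the affine
  chart misses.\<close>

definition fibre where "fibre x y = {pt (\<Phi> x y z e) | z e. z \<noteq> 0 \<or> e \<noteq> 0}"

lemma in_Exc: "valid x y z 0 \<Longrightarrow> pt (\<Phi> x y z 0) \<in> Exc"
proof -
  assume v: "valid x y z 0"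
  have "\<Phi> x y z 0 = z *s \<Phi> x y 1 0"
    using \<Phi>_scale(1)[of x y z 1 0] by simp
  moreover have "\<Phi> x y 1 0 \<noteq> 0"
    using v by (intro \<Phi>_nonzero) (simp add: valid_def)
  ultimately have "pt (\<Phi> x y z 0) = pt (\<Phi> x y 1 0)"
    using v pt_smult[of z "\<Phi> x y 1 0"] by (simp add: valid_def)
  then show ?thesis
    using v by (auto simp: Exc_def valid_def)
qed

lemma in_fibre:
  assumes "valid x y z e" "c \<noteq> 0"
  shows "pt (\<Phi> (c * x) (c * y) z e) \<in> fibre x y"
proof -
  have "\<Phi> (c * x) (c * y) z e = c\<^sup>2 *s \<Phi> x y (z / c) e"
    using \<Phi>_scale(2)[of c x y "z / c" e] assms(2) by simp
  moreover have "\<Phi> x y (z / c) e \<noteq> 0"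
    using assms by (intro \<Phi>_nonzero) (simp add: valid_def)
  ultimately have "pt (\<Phi> (c * x) (c * y) z e) = pt (\<Phi> x y (z / c) e)"
    using assms pt_smult[of "c\<^sup>2" "\<Phi> x y (z / c) e"] by simp
  moreover have "z / c \<noteq> 0 \<or> e \<noteq> 0"
    using assms by (simp add: valid_def)
  ultimately show ?thesis
    unfolding fibre_def by blast
qed

lemma S_cases:
  assumes "p \<in> S"
  obtains t u where "p = upt t u" | "p \<in> Exc" | "p \<in> fibre 0 1"
proof -
  obtain x y z e where p: "p = pt (\<Phi> x y z e)" "valid x y z e"
    using assms unfolding S_eq by blast
  show ?thesis
  proof (cases "x = 0")
    case True
    then show ?thesis
      using in_fibre[of 0 1 z e y] p that(3) by (simp add: valid_def)
  next
    case False
    then show ?thesis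
      using in_Exc[of x y z] p that(1,2) pt_\<Phi>_chart by (cases "e = 0") auto
  qed
qed

lemma Exc_subset: "Exc \<subseteq> S" and fibre_subset: "x \<noteq> 0 \<or> y \<noteq> 0 \<Longrightarrow> fibre x y \<subseteq> S"
  unfolding Exc_def fibre_def by (auto intro!: pt_\<Phi>_in_S simp: valid_def)

lemma Exc_eq: "Exc = S \<inter> ({p. vanishes (X 0) p} \<inter> {p. vanishes (X 2) p})"
proof (intro equalityI subsetI)
  fix p assume "p \<in> Exc"
  then obtain x y where "p = pt (\<Phi> x y 1 0)" "x \<noteq> 0 \<or> y \<noteq> 0"
    unfolding Exc_def by blast
  moreover from this have "valid x y 1 0"
    by (simp add: valid_def)
  ultimately show "p \<in> S \<inter> ({p. vanishes (X 0) p} \<inter> {p. vanishes (X 2) p})"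
    using vanishes_\<Phi>[OF hom_poly_X] pt_\<Phi>_in_S by simp
next
  fix p assume p: "p \<in> S \<inter> ({p. vanishes (X 0) p} \<inter> {p. vanishes (X 2) p})"
  then obtain x y z e where p': "p = pt (\<Phi> x y z e)" "valid x y z e"
    unfolding S_eq by blast
  then have "x\<^sup>2 * e = 0" "y\<^sup>2 * e = 0"
    using p vanishes_\<Phi>[OF hom_poly_X] by auto
  then have "e = 0"
    using p'(2) by (auto simp: valid_def)
  then show "p \<in> Exc"
    using p' in_Exc by simp
qed

lemma fibre_01_eq: "fibre 0 1 = S \<inter> ({p. vanishes (X 0) p} \<inter> {p. vanishes (X 3) p})"
proof (intro equalityI subsetI)
  fix p assume "p \<in> fibre 0 1"
  then obtain z e where "p = pt (\<Phi> 0 1 z e)" "z \<noteq> 0 \<or> e \<noteq> 0"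
    unfolding fibre_def by blast
  moreover from this have "valid 0 1 z e"
    by (simp add: valid_def)
  ultimately show "p \<in> S \<inter> ({p. vanishes (X 0) p} \<inter> {p. vanishes (X 3) p})"
    using vanishes_\<Phi>[OF hom_poly_X] pt_\<Phi>_in_S by simp
next
  fix p assume p: "p \<in> S \<inter> ({p. vanishes (X 0) p} \<inter> {p. vanishes (X 3) p})"
  then obtain x y z e where p': "p = pt (\<Phi> x y z e)" "valid x y z e"
    unfolding S_eq by blast
  then have "x\<^sup>2 * e = 0" "x * z = 0"
    using p vanishes_\<Phi>[OF hom_poly_X] by auto
  then have "x = 0"
    using p'(2) by (auto simp: valid_def)
  then show "p \<in> fibre 0 1"
    using p' in_fibre[of 0 1 z e y] by (simp add: valid_def)
qed

lemma S_closed: "proj_closed S"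
  using S_variety by (simp add: variety_def)

lemma Exc_closed: "proj_closed Exc"
  unfolding Exc_eq by (intro proj_closed_Int S_closed proj_closed_form[OF hom_poly_X])

lemma fibre_01_closed: "proj_closed (fibre 0 1)"
  unfolding fibre_01_eq by (intro proj_closed_Int S_closed proj_closed_form[OF hom_poly_X])

lemma upt_iff: "p \<in> S \<Longrightarrow> \<not> vanishes (X 0) p \<longleftrightarrow> (\<exists>t u. p = upt t u)"
proof
  assume p: "p \<in> S" "\<not> vanishes (X 0) p"
  then have "p \<notin> Exc" "p \<notin> fibre 0 1"
    unfolding Exc_eq fibre_01_eq by auto
  then show "\<exists>t u. p = upt t u"
    using p(1) by (metis S_cases)
next
  assume "\<exists>t u. p = upt t u"
  then show "\<not> vanishes (X 0) p"
    using vanishes_upt[OF hom_poly_X] by auto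
qed

lemma polys_on_chart: "F \<in> polys \<Longrightarrow> \<exists>p. \<forall>t u. F (\<Phi> 1 t u 1) = ev2 p t u"
  unfolding polys_def
proof (induction rule: poly_alg.induct)
  case (gen f)
  then obtain i where "f = (\<lambda>v. v $ i)"
    by blast
  then show ?case
    by (intro exI[of _ "[:[:M 0 $ i, M 1 $ i, M 2 $ i:], [:M 3 $ i, M 4 $ i:]:]"])
       (simp add: scroll_map_def power2_eq_square algebra_simps)
next
  case (const c)
  show ?case
    by (intro exI[of _ "[:[:c:]:]"]) simp
next
  case (add f g)
  then show ?case
    by (metis ev2_simps(1))
next
  case (mult f g)
  then show ?case
    by (metis ev2_simps(4))
qed

text \<open>The restriction of F to the chart. The choice is unique for polynomial F by
  \<open>ev2_eqI\<close>.\<close>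

definition dehom :: "(complex ^ 5 \<Rightarrow> complex) \<Rightarrow> complex poly poly" where
  "dehom F = (SOME p. \<forall>t u. F (\<Phi> 1 t u 1) = ev2 p t u)"

lemma dehom: "F \<in> polys \<Longrightarrow> F (\<Phi> 1 t u 1) = ev2 (dehom F) t u"
  unfolding dehom_def using someI_ex[OF polys_on_chart] by blast

lemma dehom_eqI: "F \<in> polys \<Longrightarrow> (\<And>t u. F (\<Phi> 1 t u 1) = ev2 p t u) \<Longrightarrow> dehom F = p"
  by (rule ev2_eqI) (simp flip: dehom)

lemma dehom_mult: "F \<in> polys \<Longrightarrow> G \<in> polys \<Longrightarrow> dehom (\<lambda>v. F v * G v) = dehom F * dehom G"
  by (rule dehom_eqI) (auto simp: dehom polys_def intro: poly_alg.mult)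

lemma dehom_power: "F \<in> polys \<Longrightarrow> dehom (\<lambda>v. F v ^ n) = dehom F ^ n"
  by (rule dehom_eqI) (auto simp: dehom polys_def intro: poly_alg_power)

lemma dehom_X: "dehom (X 0) = 1" "dehom (X (Suc 0)) = [:[:0, 1:]:]" "dehom (X 2) = [:[:0, 0, 1:]:]"
    "dehom (X 3) = [:0, 1:]" "dehom (X 4) = [:0, [:0, 1:]:]"
  by (rule dehom_eqI; simp add: dot_polys power2_eq_square)+

lemma form_\<Phi>:
  assumes "hom_poly D F" "x \<noteq> 0" "e \<noteq> 0"
  shows "F (\<Phi> x y z e) = (x\<^sup>2 * e) ^ D * ev2 (dehom F) (y / x) (z / (x * e))"
  unfolding \<Phi>_chart[OF assms(2,3)] hom_polyD(2)[OF assms(1)] dehom[OF hom_polyD(1)[OF assms(1)]] ..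

lemma form_on_S:
  assumes F: "hom_poly D F" and 0: "dehom F = 0" and p: "p \<in> S"
  shows "vanishes F p"
proof -
  have "vanishes F q" if "q \<in> S" "q \<notin> {q. vanishes (X 0) q}" for q
    using that upt_iff vanishes_upt[OF F] dehom[OF hom_polyD(1)[OF F]] 0 by fastforce
  moreover have "\<not> S \<subseteq> {q. vanishes (X 0) q}"
    using upt_in_S upt_iff by blast
  ultimately show ?thesis
    using variety_subset_vanishes[OF S_variety hom_polyD(1)[OF F] proj_closed_form[OF hom_poly_X] _ _ p]
    by blast
qed

text \<open>The monomials in question span the sections of D (2h - e). Each is a product of D of the
  five monomials restricting \<open>X 0\<close>, ..., \<open>X 4\<close>; the induction splits off
  one of them according to which exponents are still positive.\<close>

lemma monomial_form:
  assumes "k \<le> D" "k + i \<le> 2 * D"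
  shows "\<exists>F. hom_poly D F \<and> (\<forall>x y z e. F (\<Phi> x y z e) = x ^ (2 * D - k - i) * y ^ i * z ^ k * e ^ (D - k))"
  using assms
proof (induction D arbitrary: k i)
  case 0
  then show ?case
    by (intro exI[of _ "\<lambda>_. 1"]) (simp add: hom_poly_const)
next
  case (Suc D)
  have step: ?case if ki: "k' \<le> D" "k' + i' \<le> 2 * D" and j: "j < 5"
    and eq: "\<And>x y z e. X j (\<Phi> x y z e) * (x ^ (2 * D - k' - i') * y ^ i' * z ^ k' * e ^ (D - k'))
      = x ^ (2 * Suc D - k - i) * y ^ i * z ^ k * e ^ (Suc D - k)" for k' i' j
  proof -
    obtain F where F: "hom_poly D F"
        "\<And>x y z e. F (\<Phi> x y z e) = x ^ (2 * D - k' - i') * y ^ i' * z ^ k' * e ^ (D - k')"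
      using Suc.IH[OF ki] by blast
    show ?thesis
      using hom_poly_mult[OF hom_poly_X F(1), of j] F(2) eq
      by (intro exI[of _ "\<lambda>v. X j v * F v"]) simp
  qed
  show ?case
  proof (cases k)
    case 0
    have "i \<le> 2 * D \<or> i = Suc (2 * D) \<or> i = Suc (Suc (2 * D))"
      using Suc.prems 0 by auto
    then consider "i \<le> 2 * D" | "i = Suc (2 * D)" | "i = Suc (Suc (2 * D))"
      by blast
    then show ?thesis
    proof cases
      case 1
      then have "2 * Suc D - k - i = Suc (Suc (2 * D - i))"
        using 0 by simp
      then show ?thesis
        using 0 1 by (intro step[of 0 i 0]) (auto simp: power2_eq_square)
    next
      case 2
      then show ?thesis
        using 0 by (intro step[of 0 "i - 1" 1]) auto
    next
      case 3
      then show ?thesis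
        using 0 by (intro step[of 0 "i - 2" 2]) (auto simp: power2_eq_square)
    qed
  next
    case (Suc k')
    show ?thesis
    \<comment> \<open>With z present, x z is split off as long as x occurs, and y z
      afterwards.\<close>
    proof (cases "k' + i \<le> 2 * D")
      case True
      then have "2 * Suc D - k - i = Suc (2 * D - k' - i)"
        using Suc by simp
      then show ?thesis
        using True Suc Suc.prems \<open>k = Suc k'\<close> by (intro step[of k' i 3]) auto
    next
      case False
      then have i: "i = Suc (2 * D - k')" "k' \<le> D"
        using Suc.prems \<open>k = Suc k'\<close> by auto
      then have "2 * Suc D - k - i = 0" "i - 1 = 2 * D - k'" "k' + (i - 1) \<le> 2 * D" "2 * D - k' - (i - 1) = 0"
        using \<open>k = Suc k'\<close> by auto
      then show ?thesis
        using i \<open>k = Suc k'\<close> by (intro step[of k' "i - 1" 4]) auto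
    qed
  qed
qed

text \<open>Every section of D (2h - e) comes from a form of degree D on the ambient space, so forms
  can be prescribed by their polynomial on the chart.\<close>

lemma form_exists:
  assumes "cls (2 * D) D p"
  obtains F where "hom_poly D F" "\<forall>x y z e. F (\<Phi> x y z e) = hat (2 * D) D p x y z e" "dehom F = p"
proof -
  have "\<exists>F. hom_poly D F \<and> (\<forall>x y z e. F (\<Phi> x y z e) =
      hat (2 * D) D (monom (monom (coeff (coeff p k) i) i) k) x y z e)" for k i
  proof (cases "coeff (coeff p k) i = 0")
    case True
    then show ?thesis
      by (intro exI[of _ "\<lambda>_. 0"]) (simp add: hom_poly_zero)
  next
    case False
    then have ki: "k \<le> D" "k + i \<le> 2 * D"
      using assms by (auto simp: cls_def)
    obtain F where "hom_poly D F"
      "\<And>x y z e. F (\<Phi> x y z e) = x ^ (2 * D - k - i) * y ^ i * z ^ k * e ^ (D - k)"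
      using monomial_form[OF ki] by blast
    then show ?thesis
      using hat_monom[OF ki] by (intro exI[of _ "\<lambda>v. coeff (coeff p k) i * F v"]) (simp add: hom_poly_cmult)
  qed
  then have "\<exists>F. \<forall>k i. hom_poly D (F k i) \<and> (\<forall>x y z e. F k i (\<Phi> x y z e) =
      hat (2 * D) D (monom (monom (coeff (coeff p k) i) i) k) x y z e)"
    by (intro choice allI)
  then obtain F where F: "\<And>k i. hom_poly D (F k i)" "\<And>k i x y z e. F k i (\<Phi> x y z e) =
      hat (2 * D) D (monom (monom (coeff (coeff p k) i) i) k) x y z e"
    by blast
  define G where "G v = (\<Sum>k\<le>D. \<Sum>i\<le>2 * D. F k i v)" for v
  have G: "hom_poly D G"
    unfolding G_def by (intro hom_poly_sum F)
  have "G (\<Phi> x y z e) = hat (2 * D) D (\<Sum>k\<le>D. \<Sum>i\<le>2 * D. monom (monom (coeff (coeff p k) i) i) k) x y z e" for x y z e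
    by (simp add: G_def F hat_sum)
  then have hat: "G (\<Phi> x y z e) = hat (2 * D) D p x y z e" for x y z e
    using cls_decomp[OF assms] by simp
  have "dehom G = p"
    by (rule dehom_eqI) (use hom_polyD(1)[OF G] hat hat_1[OF assms] in auto)
  then show ?thesis
    using that G hat by blast
qed

lemma dehom_surj:
  obtains D F where "hom_poly D F" "dehom F = p"
proof -
  obtain a where "cls a (degree p) p"
    using cls_exists by blast
  then have "cls (2 * (a + degree p)) (a + degree p) p"
    by (rule cls_mono) auto
  then show ?thesis
    using form_exists that by metis
qed

section \<open>Curves on the scroll\<close>

text \<open>The closure of the affine curve \<open>f = 0\<close>.\<close>

definition curve :: "complex poly poly \<Rightarrow> 5 proj set" where
  "curve f = {p \<in> S. \<forall>D F. hom_poly D F \<longrightarrow> f dvd dehom F \<longrightarrow> vanishes F p}"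

lemma curve_closed: "proj_closed (curve f)"
proof -
  have "curve f = S \<inter> {p. \<forall>F\<in>{F. (\<exists>D. hom_poly D F) \<and> f dvd dehom F}. vanishes F p}"
    unfolding curve_def by auto
  moreover have "proj_closed {p. \<forall>F\<in>{F. (\<exists>D. hom_poly D F) \<and> f dvd dehom F}. vanishes F p}"
    unfolding proj_closed_def by (intro exI[of _ "{F. (\<exists>D. hom_poly D F) \<and> f dvd dehom F}"]) simp
  ultimately show ?thesis
    using proj_closed_Int[OF S_closed] by simp
qed

lemma upt_in_curve: "upt t u \<in> curve f \<longleftrightarrow> ev2 f t u = 0"
proof
  assume *: "upt t u \<in> curve f"
  obtain D F where F: "hom_poly D F" "dehom F = f"
    by (rule dehom_surj)
  then have "vanishes F (upt t u)"
    using * by (auto simp: curve_def)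
  then show "ev2 f t u = 0"
    using F vanishes_upt[OF F(1)] dehom[OF hom_polyD(1)[OF F(1)]] by simp
next
  assume 0: "ev2 f t u = 0"
  have "vanishes F (upt t u)" if "hom_poly D F" "f dvd dehom F" for D F
    using that 0 vanishes_upt[OF that(1)] dehom[OF hom_polyD(1)[OF that(1)]] by (auto elim!: dvdE)
  then show "upt t u \<in> curve f"
    by (auto simp: curve_def upt_in_S)
qed

lemma vanishes_on_curve_iff:
  assumes f: "irreducible f" "degree f > 0" and F: "hom_poly D F"
  shows "(\<forall>p\<in>curve f. vanishes F p) \<longleftrightarrow> f dvd dehom F"
proof
  assume *: "\<forall>p\<in>curve f. vanishes F p"
  have "ev2 (dehom F) t u = 0" if "ev2 f t u = 0" for t u
    using * that upt_in_curve[of t u f] vanishes_upt[OF F, of t u] dehom[OF hom_polyD(1)[OF F]] by auto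
  then show "f dvd dehom F"
    by (intro nullstellensatz_principal[OF f, of "{}"]) auto
qed (use F in \<open>auto simp: curve_def\<close>)

lemma zero_off_finite:
  assumes "degree f > 0" "finite T"
  obtains t u where "ev2 f t u = 0" "t \<notin> T"
proof -
  have "\<not> {t. \<exists>u. ev2 f t u = 0} \<subseteq> T"
    using infinite_zeros[OF assms(1)] assms(2) finite_subset by blast
  then show ?thesis
    using that by blast
qed

lemma curve_variety:
  assumes f: "irreducible f" "degree f > 0"
  shows "variety (curve f)"
proof (rule varietyI)
  show "curve f \<noteq> {}"
  proof -
    obtain t u where "ev2 f t u = 0"
      by (rule zero_off_finite[OF f(2) finite.emptyI])
    then have "upt t u \<in> curve f"
      by (simp add: upt_in_curve)
    then show ?thesis
      by blast
  qed
next
  fix d e F G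
  assume F: "hom_poly d F" and G: "hom_poly e G" and FG: "\<forall>p\<in>curve f. vanishes F p \<or> vanishes G p"
  have "ev2 (dehom F * dehom G) t u = 0" if "ev2 f t u = 0" for t u
    using FG that upt_in_curve[of t u f] vanishes_upt[OF F, of t u] vanishes_upt[OF G, of t u]
      dehom[OF hom_polyD(1)[OF F]] dehom[OF hom_polyD(1)[OF G]] by auto
  then have "f dvd dehom F * dehom G"
    by (intro nullstellensatz_principal[OF f, of "{}"]) auto
  then show "(\<forall>p\<in>curve f. vanishes F p) \<or> (\<forall>p\<in>curve f. vanishes G p)"
    unfolding vanishes_on_curve_iff[OF f F] vanishes_on_curve_iff[OF f G]
    using irreducible_imp_prime_elem[OF f(1)] by (simp add: prime_elem_dvd_mult_iff)
qed (rule curve_closed)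

lemma curve_subset: "curve f \<subseteq> S"
  by (auto simp: curve_def)

lemma curve_proper: "f \<noteq> 0 \<Longrightarrow> curve f \<subset> S"
proof
  assume "f \<noteq> 0"
  then have "\<exists>t u. ev2 f t u \<noteq> 0"
    using ev2_eqI[of f 0] by auto
  then show "curve f \<noteq> S"
    using upt_in_S upt_in_curve by blast
qed (rule curve_subset)

lemma curve_on_curve:
  assumes f: "irreducible f" "degree f > 0"
  shows "curve_on S (curve f)"
proof -
  obtain t u where t: "ev2 f t u = 0"
    using zero_off_finite[OF f(2) finite.emptyI] by blast
  obtain t' u' where "ev2 f t' u' = 0" "t' \<notin> {t}"
    by (rule zero_off_finite[OF f(2), of "{t}"]) auto
  then show ?thesis
    using t f(1) upt_in_curve upt_inject
    by (intro curve_in_surface[OF S_variety S_dim curve_variety[OF f] curve_proper, of "upt t u" "upt t' u'"]) auto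
qed

text \<open>The class of f itself need not be a multiple of 2h - e, so \<open>hat\<close> is not a
  form. Multiplying f by a monomial which does not vanish at the given point brings the product into
  the class (a + m) (2h - e), where forms are available.\<close>

lemma hat_zero_on_curve:
  assumes f: "cls a m f" and v: "valid x y z e" and p: "pt (\<Phi> x y z e) \<in> curve f"
  shows "hat a m f x y z e = 0"
proof -
  \<comment> \<open>The monomial becomes a power of e or z times a power of x or y, using in each
    pair a coordinate that is nonzero at the point.\<close>
  define j where "j = (if e \<noteq> 0 then 0 else a)"
  define i where "i = (if x \<noteq> 0 then 0 else a + 2 * m - j)"
  let ?g = "monom (monom 1 i) j"
  have ji: "j \<le> a" "j + i \<le> a + 2 * m"
    by (auto simp: j_def i_def)
  have g: "cls (a + 2 * m) a ?g"
    using ji by (rule cls_monom)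
  have "cls ((a + 2 * m) + a) (a + m) (?g * f)"
    using g f by (rule cls_mult)
  then have gf: "cls (2 * (a + m)) (a + m) (?g * f)"
    by (rule cls_mono) auto
  obtain F where F: "hom_poly (a + m) F" "F (\<Phi> x y z e) = hat (2 * (a + m)) (a + m) (?g * f) x y z e"
      "dehom F = ?g * f"
    using form_exists[OF gf] by metis
  have "f dvd dehom F"
    using F(3) by simp
  then have "vanishes F (pt (\<Phi> x y z e))"
    using p F(1) by (auto simp: curve_def)
  then have "hat (2 * (a + m)) (a + m) (?g * f) x y z e = 0"
    using vanishes_\<Phi>[OF F(1) v] F(2) by simp
  moreover have "hat (2 * (a + m)) (a + m) (?g * f) x y z e = hat (a + 2 * m) a ?g x y z e * hat a m f x y z e"
    using hat_mult[OF g f, of x y z e] by (simp add: mult_2 add.commute add.left_commute)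
  moreover have "hat (a + 2 * m) a ?g x y z e \<noteq> 0"
    using v unfolding hat_monom[OF ji] by (auto simp: valid_def j_def i_def)
  ultimately show ?thesis
    by simp
qed

lemma curve_off_chart:
  assumes C: "variety C" "C \<subseteq> S" and nE: "\<not> C \<subseteq> Exc" and nf: "\<not> C \<subseteq> fibre 0 1"
  shows "\<not> C \<subseteq> {p. vanishes (X 0) p}"
proof
  assume C0: "C \<subseteq> {p. vanishes (X 0) p}"
  have "C \<subseteq> Exc \<union> fibre 0 1"
  proof
    fix p assume p: "p \<in> C"
    then have "p \<in> S"
      using C(2) by blast
    then show "p \<in> Exc \<union> fibre 0 1"
      by (cases rule: S_cases) (use p C0 upt_iff[OF \<open>p \<in> S\<close>] in auto)
  qed
  then show False
    using variety_subset_Un[OF C(1) Exc_closed fibre_01_closed] nE nf by blast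
qed

lemma vanishes_from_chart:
  assumes C: "variety C" "C \<subseteq> S" and n0: "\<not> C \<subseteq> {p. vanishes (X 0) p}" and F: "F \<in> polys"
    and van: "\<forall>t u. upt t u \<in> C \<longrightarrow> vanishes F (upt t u)" and p: "p \<in> C"
  shows "vanishes F p"
proof (rule variety_subset_vanishes[OF C(1) F proj_closed_form[OF hom_poly_X] n0 _ p])
  fix q assume "q \<in> C" "q \<notin> {p. vanishes (X 0) p}"
  then show "vanishes F q"
    using van upt_iff[of q] C(2) by blast
qed

lemma prod_mset_in_prime_ideal:
  fixes I :: "'a::comm_monoid_mult set"
  assumes "\<forall>a b. a * b \<in> I \<longrightarrow> a \<in> I \<or> b \<in> I" "1 \<notin> I" "prod_mset Y \<in> I"
  shows "\<exists>x\<in>#Y. x \<in> I"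
  using assms(3)
proof (induction Y)
  case empty
  then show ?case
    using assms(2) by simp
next
  case (add x Y)
  then have "x * prod_mset Y \<in> I"
    by simp
  then show ?case
    using assms(1) add.IH by auto
qed

text \<open>The polynomials vanishing on the affine part of C form a prime ideal, nonzero as C is
  not all of S. It contains an irreducible f. If f involves u, then C lies in \<open>curve f\<close>
  and equals it by dimension; otherwise f is linear in t and C lies in a line of the ruling.\<close>

lemma curve_cases:
  assumes C: "curve_on S C" and nE: "\<not> C \<subseteq> Exc" and nf: "\<not> C \<subseteq> fibre 0 1"
  obtains f where "irreducible f" "degree f > 0" "C = curve f" | t where "C \<subseteq> fibre 1 t"
proof -
  have Cv: "variety C" "C \<subseteq> S"
    using C by (auto simp: curve_on_def)
  have n0: "\<not> C \<subseteq> {p. vanishes (X 0) p}"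
    by (rule curve_off_chart[OF Cv nE nf])
  define I where "I = {p. \<forall>t u. upt t u \<in> C \<longrightarrow> ev2 p t u = 0}"
  have I_form: "\<forall>q\<in>C. vanishes F q" if "hom_poly D F" "dehom F \<in> I" for D F
    using that vanishes_upt[OF that(1)] dehom[OF hom_polyD(1)[OF that(1)]]
    by (intro ballI vanishes_from_chart[OF Cv n0]) (auto simp: I_def hom_polyD(1))
  have form_I: "dehom F \<in> I" if "hom_poly D F" "\<forall>q\<in>C. vanishes F q" for D F
    using that vanishes_upt[OF that(1)] dehom[OF hom_polyD(1)[OF that(1)]] by (auto simp: I_def)
  have "1 \<notin> I"
    using n0 upt_iff Cv by (auto simp: I_def)
  moreover have prime: "\<forall>a b. a * b \<in> I \<longrightarrow> a \<in> I \<or> b \<in> I"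
  proof (intro allI impI)
    fix a b assume ab: "a * b \<in> I"
    obtain D F where F: "hom_poly D F" "dehom F = a"
      by (rule dehom_surj)
    obtain D' G where G: "hom_poly D' G" "dehom G = b"
      by (rule dehom_surj)
    have FG: "hom_poly (D' + D) (\<lambda>v. G v * F v)"
      using F G by (intro hom_poly_mult)
    have "dehom (\<lambda>v. G v * F v) = b * a"
      using F G dehom_mult hom_polyD(1) by metis
    then have "\<forall>q\<in>C. vanishes (\<lambda>v. G v * F v) q"
      using I_form[OF FG] ab by (simp add: mult.commute)
    then have "C \<subseteq> {p. vanishes F p} \<union> {p. vanishes G p}"
      using vanishes_mult[OF F(1) hom_polyD(1)[OF G(1)]] by auto
    then have "C \<subseteq> {p. vanishes F p} \<or> C \<subseteq> {p. vanishes G p}"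
      using variety_subset_Un[OF Cv(1) proj_closed_form[OF F(1)] proj_closed_form[OF G(1)]] by blast
    then show "a \<in> I \<or> b \<in> I"
      using form_I[OF F(1)] form_I[OF G(1)] F G by auto
  qed
  moreover obtain p where p: "p \<in> I" "p \<noteq> 0"
  proof -
    have "C \<subset> S"
      using curve_on_proper[OF S_dim C] .
    then obtain q where q: "q \<in> S" "q \<notin> C"
      by blast
    have "proj_closed C"
      using Cv by (simp add: variety_def)
    then obtain D F where F: "hom_poly D F" "\<forall>x\<in>C. vanishes F x" "\<not> vanishes F q"
      by (rule proj_closedD[OF _ q(2)])
    then have "dehom F \<noteq> 0"
      using form_on_S q(1) by blast
    then show ?thesis
      using that form_I[OF F(1,2)] by blast
  qed
  have "prod_mset (prime_factorization p) \<in> I"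
  proof -
    have "p dvd prod_mset (prime_factorization p)"
      using prod_mset_prime_factorization_weak[OF p(2)] by (metis associatedD2)
    then show ?thesis
      using p(1) by (auto simp: I_def elim!: dvdE)
  qed
  ultimately obtain f where f: "f \<in># prime_factorization p" "f \<in> I"
    using prod_mset_in_prime_ideal[OF prime] by blast
  have irr: "irreducible f"
    using f(1) by (intro prime_elem_imp_irreducible prime_imp_prime_elem) (auto dest: in_prime_factors_imp_prime)
  show ?thesis
  proof (cases "degree f = 0")
    case True
    then obtain r where r: "f = [:r:]"
      by (metis degree_eq_zeroE)
    have "\<not> is_unit r" "r \<noteq> 0"
      using irr r by (auto simp: irreducible_def is_unit_const_poly_iff)
    then have "degree r \<noteq> 0"
      by (auto simp: is_unit_iff_degree)
    then obtain t0 where "poly r t0 = 0"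
      using fundamental_theorem_of_algebra[of r] constant_degree[of r] by auto
    then obtain s where s: "r = [:- t0, 1:] * s"
      by (auto simp: poly_eq_0_iff_dvd elim: dvdE)
    then have "f = [:[:- t0, 1:]:] * [:s:]"
      using r by simp
    moreover have "\<not> is_unit [:[:- t0, 1:]:]"
      by (simp add: is_unit_const_poly_iff is_unit_poly_iff)
    ultimately have "is_unit [:s:]"
      using irr irreducibleD by blast
    then obtain c where c: "s = [:c:]" "c \<noteq> 0"
      by (auto simp: is_unit_const_poly_iff is_unit_poly_iff dvd_field_iff)
    have t0: "t = t0" if "upt t u \<in> C" for t u
    proof -
      have "ev2 f t u = 0"
        using f(2) that by (auto simp: I_def)
      then show ?thesis
        unfolding r s c using c(2) by (simp add: ev2_simps algebra_simps)
    qed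
    have "C \<subseteq> fibre 1 t0"
    proof
      fix q assume q: "q \<in> C"
      \<comment> \<open>On the chart the pairs (\<open>X 1\<close>, \<open>X 0\<close>),
        (\<open>X 2\<close>, \<open>X 1\<close>) and (\<open>X 4\<close>, \<open>X 3\<close>) have
        ratio t. The resulting three linear equations hold on all of C and force y = t0 x.\<close>
      have van: "vanishes (dot (N i - t0 *s N j)) q"
        if "\<And>t u. X i (\<Phi> 1 t u 1) = t * X j (\<Phi> 1 t u 1)" for i j
        by (rule vanishes_from_chart[OF Cv n0 dot_polys _ q])
           (use that t0 vanishes_upt[OF hom_poly_dot] in \<open>auto simp: algebra_simps dot_def sum_subtractf sum_distrib_left\<close>)
      obtain x y z e where p: "q = pt (\<Phi> x y z e)" "valid x y z e"
        using q Cv unfolding S_eq by blast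
      have "X i (\<Phi> x y z e) = t0 * X j (\<Phi> x y z e)"
        if "\<And>t u. X i (\<Phi> 1 t u 1) = t * X j (\<Phi> 1 t u 1)" for i j
        using van[OF that] unfolding p(1) vanishes_\<Phi>[OF hom_poly_dot p(2)]
        by (simp add: dot_def algebra_simps sum_subtractf sum_distrib_left)
      from this[of "Suc 0" 0] this[of 2 "Suc 0"] this[of 4 3]
      have "x * y * e = t0 * (x\<^sup>2 * e)" "y\<^sup>2 * e = t0 * (x * y * e)" "y * z = t0 * (x * z)"
        by (simp_all add: power2_eq_square)
      then have "(y - t0 * x) * x * e = 0" "(y - t0 * x) * y * e = 0" "(y - t0 * x) * z = 0"
        by (simp_all add: algebra_simps power2_eq_square)
      then have y: "y = t0 * x"
        using p(2) by (auto simp: valid_def)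
      then have "x \<noteq> 0"
        using p(2) by (auto simp: valid_def)
      then show "q \<in> fibre 1 t0"
        using in_fibre[of 1 t0 z e x] p y by (simp add: valid_def mult.commute)
    qed
    then show ?thesis
      by (rule that(2))
  next
    case False
    then have df: "degree f > 0"
      by simp
    have "C \<subseteq> curve f"
    proof
      fix q assume q: "q \<in> C"
      have "vanishes F q" if F: "hom_poly D F" "f dvd dehom F" for D F
      proof -
        have "dehom F \<in> I"
          using F(2) f(2) by (auto simp: I_def elim!: dvdE)
        then show ?thesis
          using I_form[OF F(1)] q by blast
      qed
      then show "q \<in> curve f"
        using q Cv by (auto simp: curve_def)
    qed
    then have "C = curve f"
      by (rule curve_eq[OF S_dim S_variety C curve_variety[OF irr df] _ curve_proper]) (use irr in auto)
    then show ?thesis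
      using that(1) irr df by blast
  qed
qed

end

section \<open>Hyperplane sections\<close>

lemma hat_scale:
  assumes "cls a m f"
  shows "hat a m f (c * x) (c * y) (c * z) e = c ^ a * hat a m f x y z e"
    and "hat a m f x y (c * z) (c * e) = c ^ m * hat a m f x y z e"
proof -
  have "coeff (coeff f k) i * (c * x) ^ (a - k - i) * (c * y) ^ i * (c * z) ^ k * e ^ (m - k)
      = c ^ a * (coeff (coeff f k) i * x ^ (a - k - i) * y ^ i * z ^ k * e ^ (m - k))" for k i
  proof (cases "coeff (coeff f k) i = 0")
    case False
    then have "k + i \<le> a"
      using assms by (auto simp: cls_def)
    then have "c ^ a = c ^ (a - k - i) * c ^ i * c ^ k"
      by (simp flip: power_add)
    then show ?thesis
      by (simp add: power_mult_distrib)
  qed simp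
  then show "hat a m f (c * x) (c * y) (c * z) e = c ^ a * hat a m f x y z e"
    unfolding hat_def sum_distrib_left by (intro sum.cong refl)
  have "coeff (coeff f k) i * x ^ (a - k - i) * y ^ i * (c * z) ^ k * (c * e) ^ (m - k)
      = c ^ m * (coeff (coeff f k) i * x ^ (a - k - i) * y ^ i * z ^ k * e ^ (m - k))" if "k \<le> m" for k i
  proof -
    have "c ^ m = c ^ k * c ^ (m - k)"
      using that by (simp flip: power_add)
    then show ?thesis
      by (simp add: power_mult_distrib)
  qed
  then show "hat a m f x y (c * z) (c * e) = c ^ m * hat a m f x y z e"
    unfolding hat_def sum_distrib_left by (intro sum.cong refl) auto
qed

lemma hat_x1:
  assumes "cls a m f"
  shows "hat a m f 1 t z e = (\<Sum>k\<le>m. poly (coeff f k) t * z ^ k * e ^ (m - k))"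
  unfolding hat_def using cls_coeff_degree[OF assms]
  by (simp add: poly_altdef_le[of _ a] sum_distrib_right)

lemma hat_x1_e0:
  assumes "cls a m f"
  shows "hat a m f 1 t z 0 = poly (coeff f m) t * z ^ m"
proof -
  have "hat a m f 1 t z 0 = (\<Sum>k\<le>m. if k = m then poly (coeff f m) t * z ^ m else 0)"
    unfolding hat_x1[OF assms] by (intro sum.cong) (auto simp: power_0_left)
  then show ?thesis
    by simp
qed

text \<open>At x = 0 only the terms of total degree a survive. That this restriction is not
  identically zero is the condition that a is the exact total degree.\<close>

lemma hat_x0:
  assumes "cls a m f"
  shows "hat a m f 0 1 z e = (\<Sum>k\<le>m. coeff (coeff f k) (a - k) * z ^ k * e ^ (m - k))"
proof -
  have "coeff (coeff f k) i * 0 ^ (a - k - i) = (if i = a - k then coeff (coeff f k) (a - k) else 0)" for k i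
    using assms by (cases "k + i \<le> a") (auto simp: cls_def power_0_left)
  then have "hat a m f 0 1 z e =
      (\<Sum>k\<le>m. (\<Sum>i\<le>a. if i = a - k then coeff (coeff f k) (a - k) else 0) * (z ^ k * e ^ (m - k)))"
    unfolding hat_def sum_distrib_right by (intro sum.cong refl) (simp add: mult.assoc)
  then show ?thesis
    by (simp add: mult.assoc)
qed

text \<open>A hyperplane restricts to Q (t) + u L (t) on the chart. This is f with u = -Q / L
  substituted and the denominator L ^ m cleared; equivalently, it is the section \<open>hat\<close>
  at z = -Q, e = L.\<close>

definition section_poly :: "nat \<Rightarrow> complex poly poly \<Rightarrow> complex poly \<Rightarrow> complex poly \<Rightarrow> complex poly" where
  "section_poly m f Q L = (\<Sum>k\<le>m. coeff f k * (- Q) ^ k * L ^ (m - k))"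

lemma poly_section_poly: "cls a m f \<Longrightarrow> poly (section_poly m f Q L) t = hat a m f 1 t (- poly Q t) (poly L t)"
  by (simp add: section_poly_def hat_x1 poly_sum)

lemma section_poly_root_iff:
  assumes "cls a m f" "poly L t \<noteq> 0"
  shows "poly (section_poly m f Q L) t = poly L t ^ m * ev2 f t (- poly Q t / poly L t)"
  using assms by (simp add: poly_section_poly hat_chart)

lemma degree_section_poly:
  assumes f: "cls a m f" and Q: "degree Q \<le> 2" and L: "degree L \<le> 1"
  shows "degree (section_poly m f Q L) \<le> a + m"
  unfolding section_poly_def
proof (rule degree_sum_le)
  fix k assume k: "k \<in> {..m}"
  show "degree (coeff f k * (- Q) ^ k * L ^ (m - k)) \<le> a + m"
  proof (cases "coeff f k = 0")
    case False
    then have "k + degree (coeff f k) \<le> a"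
      using f unfolding cls_def by (metis leading_coeff_0_iff)
    moreover have "degree ((- Q) ^ k) \<le> 2 * k"
      using le_trans[OF degree_power_le mult_le_mono1[of "degree (- Q)" 2 k]] Q by simp
    moreover have "degree (L ^ (m - k)) \<le> m - k"
      using le_trans[OF degree_power_le mult_le_mono1[OF L]] by simp
    moreover have "degree (coeff f k * (- Q) ^ k * L ^ (m - k))
        \<le> degree (coeff f k) + degree ((- Q) ^ k) + degree (L ^ (m - k))"
      using degree_mult_le[of "coeff f k * (- Q) ^ k" "L ^ (m - k)"] degree_mult_le[of "coeff f k" "(- Q) ^ k"]
      by linarith
    moreover have "k \<le> m"
      using k by simp
    ultimately show ?thesis
      by linarith
  qed simp
qed simp

text \<open>The coefficient at the expected degree is the value at t = \<infinity>. Reversing the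
  polynomial, i.e. passing to the coordinate x = 1 / t, turns it into \<open>hat\<close> near x = 0,
  and continuity gives the value at x = 0.\<close>

lemma coeff_section_poly_top:
  assumes f: "cls a m f"
  shows "coeff (section_poly m f [:b0, b1, b2:] [:b3, b4:]) (a + m) = hat a m f 0 1 (- b2) b4"
proof -
  let ?\<phi> = "section_poly m f [:b0, b1, b2:] [:b3, b4:]"
  have deg: "degree ?\<phi> \<le> a + m"
    by (rule degree_section_poly[OF f]) auto
  have "(\<Sum>i\<le>a + m. coeff ?\<phi> i * x ^ (a + m - i)) = hat a m f x 1 (- (b0 * x\<^sup>2 + b1 * x + b2)) (b3 * x + b4)" for x
  proof (rule continuous_eq_at_0[where f = "\<lambda>x. \<Sum>i\<le>a + m. coeff ?\<phi> i * x ^ (a + m - i)"])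
    fix x :: complex assume x: "x \<noteq> 0"
    have "coeff ?\<phi> i * x ^ (a + m - i) = x ^ (a + m) * (coeff ?\<phi> i * (1 / x) ^ i)" if "i \<le> a + m" for i
    proof -
      have "x ^ (a + m) = x ^ (a + m - i) * x ^ i"
        using that by (simp flip: power_add)
      then show ?thesis
        using x by (simp add: power_divide)
    qed
    then have "(\<Sum>i\<le>a + m. coeff ?\<phi> i * x ^ (a + m - i)) = x ^ (a + m) * poly ?\<phi> (1 / x)"
      unfolding poly_altdef_le[OF deg] sum_distrib_left by (intro sum.cong) auto
    also have "\<dots> = x ^ a * (x ^ m * hat a m f 1 (1 / x) (- poly [:b0, b1, b2:] (1 / x)) (poly [:b3, b4:] (1 / x)))"
      by (simp only: poly_section_poly[OF f] power_add mult.assoc)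
    also have "\<dots> = hat a m f (x * 1) (x * (1 / x)) (x * (x * - poly [:b0, b1, b2:] (1 / x))) (x * poly [:b3, b4:] (1 / x))"
      unfolding hat_scale[OF f] by simp
    also have "\<dots> = hat a m f x 1 (- (b0 * x\<^sup>2 + b1 * x + b2)) (b3 * x + b4)"
    proof -
      have xw: "x * (1 / x) = 1"
        using x by simp
      have "x * (x * - poly [:b0, b1, b2:] w) = - (b0 * x\<^sup>2 + b1 * x * (x * w) + b2 * ((x * w) * (x * w)))"
        "x * poly [:b3, b4:] w = b3 * x + b4 * (x * w)" for w
        by (simp_all add: algebra_simps power2_eq_square)
      then show ?thesis
        by (simp only: xw mult_1_right)
    qed
    finally show "(\<Sum>i\<le>a + m. coeff ?\<phi> i * x ^ (a + m - i)) = hat a m f x 1 (- (b0 * x\<^sup>2 + b1 * x + b2)) (b3 * x + b4)" .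
  qed (intro continuous_intros)+
  from this[of 0] have "(\<Sum>i\<le>a + m. coeff ?\<phi> i * 0 ^ (a + m - i)) = hat a m f 0 1 (- b2) b4"
    by simp
  moreover have "(\<Sum>i\<le>a + m. coeff ?\<phi> i * 0 ^ (a + m - i)) = (\<Sum>i\<le>a + m. if i = a + m then coeff ?\<phi> i else 0)"
    by (intro sum.cong) (auto simp: power_0_left)
  ultimately show ?thesis
    by simp
qed

text \<open>Chain rule: \<open>map_poly pderiv\<close> is the partial derivative in the inner
  variable t and \<open>pderiv\<close> the one in u.\<close>

lemma has_field_derivative_ev2:
  assumes "(v has_field_derivative v') (at t)"
  shows "((\<lambda>s. ev2 f s (v s)) has_field_derivative
    ev2 (map_poly pderiv f) t (v t) + ev2 (pderiv f) t (v t) * v') (at t)"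
proof (induction f)
  case 0
  then show ?case
    by simp
next
  case (pCons c p)
  have 1: "((\<lambda>s. poly c s + v s * ev2 p s (v s)) has_field_derivative
      poly (pderiv c) t + (v' * ev2 p t (v t) + (ev2 (map_poly pderiv p) t (v t) + ev2 (pderiv p) t (v t) * v') * v t)) (at t)"
    by (intro DERIV_add DERIV_mult poly_DERIV assms pCons.IH)
  have 2: "map_poly pderiv (pCons c p) = pCons (pderiv c) (map_poly pderiv p)"
    using pCons.hyps by (intro poly_eqI) (auto simp: coeff_map_poly coeff_pCons split: nat.splits)
  show ?case
    using 1 unfolding 2 by (simp add: pderiv_pCons algebra_simps)
qed

text \<open>The double roots of \<open>section_poly m f (c + Q) L\<close> are common zeros of \<open>f\<close> and of a polynomial
  which does not depend on \<open>c\<close>.\<close>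

lemma double_root_section_poly:
  assumes f: "cls a m f" and L: "poly L t \<noteq> 0"
    and t: "poly (section_poly m f Q L) t = 0" "poly (pderiv (section_poly m f Q L)) t = 0"
  defines "u \<equiv> - poly Q t / poly L t"
  shows "ev2 f t u = 0"
    and "poly L t * ev2 (map_poly pderiv f) t u - (poly (pderiv Q) t + u * poly (pderiv L) t) * ev2 (pderiv f) t u = 0"
proof -
  define v where "v s = - poly Q s / poly L s" for s
  show f0: "ev2 f t u = 0"
    using t(1) L section_poly_root_iff[OF f L] by (simp add: u_def)
  have v: "(v has_field_derivative - (poly (pderiv Q) t + u * poly (pderiv L) t) / poly L t) (at t)"
    unfolding v_def u_def using L
    by (auto intro!: derivative_eq_intros poly_DERIV simp: field_simps power2_eq_square)
  \<comment> \<open>Both expressions agree on the open set where L does not vanish, so they have the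
    same derivative at t. In the product rule the term with the derivative of L ^ m drops out
    because f vanishes at (t, u).\<close>
  have D1: "((\<lambda>s. poly L s ^ m * ev2 f s (v s)) has_field_derivative poly (pderiv (section_poly m f Q L)) t) (at t)"
  proof (rule has_field_derivative_transform_within_open[OF poly_DERIV])
    have "L \<noteq> 0"
      using L by auto
    then show "open (- {s. poly L s = 0})"
      by (intro open_Compl finite_imp_closed poly_roots_finite)
  qed (use L in \<open>auto simp: section_poly_root_iff[OF f] v_def\<close>)
  have "((\<lambda>s. poly L s ^ m) has_field_derivative of_nat m * poly L t ^ (m - 1) * poly (pderiv L) t) (at t)"
    by (auto intro!: derivative_eq_intros poly_DERIV)
  from DERIV_mult[OF this has_field_derivative_ev2[OF v, of f]]
  have "((\<lambda>s. poly L s ^ m * ev2 f s (v s)) has_field_derivative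
      poly L t ^ m * (ev2 (map_poly pderiv f) t u - ev2 (pderiv f) t u * ((poly (pderiv Q) t + u * poly (pderiv L) t) / poly L t))) (at t)"
  proof (rule DERIV_cong)
    have vt: "v t = u"
      by (simp add: v_def u_def)
    have eq: "(p + q * (- k / y)) * w = w * (p - q * (k / y))" for p q k y w :: complex
      by (simp add: algebra_simps)
    show "of_nat m * poly L t ^ (m - 1) * poly (pderiv L) t * ev2 f t (v t) +
        (ev2 (map_poly pderiv f) t (v t) + ev2 (pderiv f) t (v t) * (- (poly (pderiv Q) t + u * poly (pderiv L) t) / poly L t)) * poly L t ^ m =
      poly L t ^ m * (ev2 (map_poly pderiv f) t u - ev2 (pderiv f) t u * ((poly (pderiv Q) t + u * poly (pderiv L) t) / poly L t))"
      by (simp only: vt f0 eq mult_zero_right add_0)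
  qed
  from DERIV_unique[OF D1 this] t(2) L
  have "ev2 (map_poly pderiv f) t u - ev2 (pderiv f) t u * ((poly (pderiv Q) t + u * poly (pderiv L) t) / poly L t) = 0"
    by simp
  then show "poly L t * ev2 (map_poly pderiv f) t u - (poly (pderiv Q) t + u * poly (pderiv L) t) * ev2 (pderiv f) t u = 0"
    using L by (simp add: field_simps)
qed

lemma rsquarefree_section_exists:
  assumes f: "cls a m f" and irr: "irreducible f" and m: "degree f = m" "m > 0"
    and top: "\<exists>k\<le>a. coeff (coeff f k) (a - k) \<noteq> 0"
  obtains b0 b1 b2 b3 b4 where "degree (section_poly m f [:b0, b1, b2:] [:b3, b4:]) = a + m"
    "rsquarefree (section_poly m f [:b0, b1, b2:] [:b3, b4:])"
proof -
  have f0: "f \<noteq> 0"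
    using irr by auto
  define ft fu where "ft = map_poly pderiv f" and "fu = pderiv f"
  \<comment> \<open>\<open>D1 q\<close> + lam \<open>D2\<close> is the derivative condition of
    \<open>double_root_section_poly\<close> for these Q and L, ordered by powers of lam.\<close>
  define D1 where "D1 q = ft - smult [:q, -2:] fu" for q
  define D2 where "D2 = smult [:0, 1:] ft - pCons 0 fu"
  have "fu \<noteq> 0" "degree fu < degree f"
    using m by (auto simp: fu_def pderiv_eq_0_iff degree_pderiv)
  then have f_fu: "\<not> f dvd fu"
    using dvd_imp_degree_le[of f fu] by linarith
  \<comment> \<open>\<open>D1 0\<close> and \<open>D1 1\<close> differ by \<open>fu\<close>, which f
    does not divide for reasons of degree, so 0 or 1 works.\<close>
  obtain q where q: "\<not> f dvd D1 q"
  proof -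
    have "D1 0 - D1 1 = smult ([:1, -2:] - [:0, -2:]) fu"
      unfolding D1_def smult_diff_left by simp
    then have "D1 0 - D1 1 = fu"
      by (simp flip: one_pCons)
    then have "\<not> (f dvd D1 0 \<and> f dvd D1 1)"
      using f_fu dvd_diff[of f "D1 0" "D1 1"] by auto
    then show ?thesis
      using that by blast
  qed
  define bad1 where "bad1 = {lam. f dvd D1 q + smult [:lam:] D2}"
  have "finite bad1"
  proof (rule finite_subset)
    \<comment> \<open>At most one value is bad: two of them would make f divide \<open>D2\<close>
      and therefore \<open>D1 q\<close>.\<close>
    show "bad1 \<subseteq> {SOME lam. lam \<in> bad1}"
    proof
      fix lam assume lam: "lam \<in> bad1"
      show "lam \<in> {SOME lam. lam \<in> bad1}"
      proof (rule ccontr)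
        let ?mu = "SOME lam. lam \<in> bad1"
        assume "lam \<notin> {?mu}"
        then have ne: "lam - ?mu \<noteq> 0"
          by simp
        have mu: "?mu \<in> bad1"
          using lam by (rule someI)
        have "f dvd (D1 q + smult [:lam:] D2) - (D1 q + smult [:?mu:] D2)"
          using lam mu by (intro dvd_diff) (auto simp: bad1_def)
        also have "\<dots> = smult [:lam - ?mu:] D2"
          by (simp flip: smult_diff_left)
        finally have "f dvd smult [:1 / (lam - ?mu):] (smult [:lam - ?mu:] D2)"
          by (rule dvd_smult)
        then have "f dvd D2"
          using ne by (simp flip: one_pCons)
        then have "f dvd (D1 q + smult [:lam:] D2) - smult [:lam:] D2"
          using lam by (intro dvd_diff dvd_smult) (auto simp: bad1_def)
        then show False
          using q by simp
      qed
    qed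
  qed simp
  define r where "r = (\<Sum>k\<le>m. monom (coeff (coeff f k) (a - k)) (m - k))"
  have hat01: "hat a m f 0 1 1 lam = poly r lam" for lam
    by (simp add: hat_x0[OF f] r_def poly_sum poly_monom)
  have "r \<noteq> 0"
  proof -
    obtain k where k: "k \<le> a" "coeff (coeff f k) (a - k) \<noteq> 0"
      using top by blast
    then have "k \<le> m"
      using f by (auto simp: cls_def)
    have "coeff r (m - k) = (\<Sum>k'\<le>m. if k' = k then coeff (coeff f k) (a - k) else 0)"
      unfolding r_def coeff_sum using \<open>k \<le> m\<close> by (intro sum.cong) auto
    then show ?thesis
      using k \<open>k \<le> m\<close> by auto
  qed
  define gm where "gm = coeff f m"
  have "gm \<noteq> 0"
    using f0 m by (auto simp: gm_def)
  have fin: "finite (bad1 \<union> (\<lambda>t. - 1 / t) ` {t. poly gm t = 0})"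
    using \<open>finite bad1\<close> \<open>gm \<noteq> 0\<close> by (simp add: poly_roots_finite)
  \<comment> \<open>The first condition makes the top coefficient nonzero. Avoiding the values -1 /
    t keeps L nonzero at the roots of the leading coefficient of f.\<close>
  obtain lam where lam: "poly r lam \<noteq> 0" "lam \<notin> bad1 \<union> (\<lambda>t. - 1 / t) ` {t. poly gm t = 0}"
    by (rule infinite_not_root[OF \<open>r \<noteq> 0\<close> fin])
  define L where "L = [:1, lam:]"
  have gmL: "poly gm t \<noteq> 0" if "poly L t = 0" for t
  proof
    assume "poly gm t = 0"
    moreover have "lam = - 1 / t"
      using that by (cases "t = 0") (auto simp: L_def field_simps eq_neg_iff_add_eq_0 add.commute)
    ultimately show False
      using lam(2) by blast
  qed
  define D where "D = D1 q + smult [:lam:] D2"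
  have fD: "\<not> f dvd D"
    using lam(2) by (auto simp: bad1_def D_def)
  have finb: "finite ((\<lambda>(t, u). t\<^sup>2 - q * t - u * poly L t) ` {(t, u). ev2 f t u = 0 \<and> ev2 D t u = 0}
      \<union> (\<lambda>t. t\<^sup>2 - q * t) ` {t. poly L t = 0})" (is "finite ?bad")
    using finite_common_zeros(2)[OF irr _ fD] m poly_roots_finite[of L] by (simp add: L_def)
  obtain c where c: "c \<notin> ?bad"
    using ex_new_if_finite[OF infinite_UNIV_char_0 finb] by (elim exE)
  define Q where "Q = [:c, q, -1:]"
  have "rsquarefree (section_poly m f Q L)"
    unfolding rsquarefree_roots
  proof (intro allI notI)
    fix t assume t: "poly (section_poly m f Q L) t = 0 \<and> poly (pderiv (section_poly m f Q L)) t = 0"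
    show False
    proof (cases "poly L t = 0")
      case True
      then have "poly gm t * (- poly Q t) ^ m = 0"
        using t poly_section_poly[OF f, of Q L t] hat_x1_e0[OF f] by (simp add: gm_def)
      then have "poly Q t = 0"
        using gmL[OF True] by simp
      then have "c = t\<^sup>2 - q * t"
        by (simp add: Q_def algebra_simps power2_eq_square)
      then show False
        using c True by blast
    next
      case False
      define u where "u = - poly Q t / poly L t"
      have 1: "ev2 f t u = 0"
        and 2: "poly L t * ev2 ft t u - (poly (pderiv Q) t + u * poly (pderiv L) t) * ev2 fu t u = 0"
        using double_root_section_poly[OF f False] t unfolding u_def ft_def fu_def by blast+
      have "ev2 D t u = 0"
        using 2 by (simp add: D_def D1_def D2_def L_def Q_def pderiv_pCons algebra_simps)
      moreover have "c = t\<^sup>2 - q * t - u * poly L t"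
        using False by (simp add: u_def Q_def algebra_simps power2_eq_square)
      ultimately have "c \<in> (\<lambda>(t, u). t\<^sup>2 - q * t - u * poly L t) ` {(t, u). ev2 f t u = 0 \<and> ev2 D t u = 0}"
        using 1 by (intro image_eqI[of _ _ "(t, u)"]) auto
      then show False
        using c by blast
    qed
  qed
  moreover have "degree (section_poly m f Q L) = a + m"
  proof (rule antisym)
    show "degree (section_poly m f Q L) \<le> a + m"
      by (rule degree_section_poly[OF f]) (auto simp: Q_def L_def)
    have "coeff (section_poly m f Q L) (a + m) \<noteq> 0"
      using coeff_section_poly_top[OF f, of c q "-1" 1 lam] lam(1) by (simp add: Q_def L_def hat01)
    then show "a + m \<le> degree (section_poly m f Q L)"
      by (rule le_degree)
  qed
  ultimately show ?thesis
    using that unfolding Q_def L_def by blast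
qed

section \<open>The degree of a curve on the scroll\<close>

definition coeffs_in :: "('v \<Rightarrow> complex) set \<Rightarrow> ('v \<Rightarrow> complex poly) \<Rightarrow> bool" where
  "coeffs_in A \<psi> \<longleftrightarrow> (\<forall>i. (\<lambda>l. coeff (\<psi> l) i) \<in> poly_alg A)"

lemma coeffs_in_const: "coeffs_in A (\<lambda>_. p)"
  by (simp add: coeffs_in_def poly_alg.const)

lemma coeffs_in_mult: "coeffs_in A p \<Longrightarrow> coeffs_in A q \<Longrightarrow> coeffs_in A (\<lambda>l. p l * q l)"
  unfolding coeffs_in_def coeff_mult by (auto intro!: poly_alg_intros)

lemma coeffs_in_uminus: "coeffs_in A p \<Longrightarrow> coeffs_in A (\<lambda>l. - p l)"
  unfolding coeffs_in_def coeff_minus by (auto intro!: poly_alg_intros)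

lemma coeffs_in_power: "coeffs_in A p \<Longrightarrow> coeffs_in A (\<lambda>l. p l ^ n)"
  by (induction n) (auto intro: coeffs_in_const coeffs_in_mult)

lemma coeffs_in_sum: "(\<And>k. k \<in> Y \<Longrightarrow> coeffs_in A (p k)) \<Longrightarrow> coeffs_in A (\<lambda>l. \<Sum>k\<in>Y. p k l)"
  unfolding coeffs_in_def coeff_sum by (auto intro!: poly_alg_intros)

lemma coeffs_in_pCons:
  assumes "c \<in> poly_alg A" "coeffs_in A p"
  shows "coeffs_in A (\<lambda>l. pCons (c l) (p l))"
  unfolding coeffs_in_def
proof
  show "(\<lambda>l. coeff (pCons (c l) (p l)) i) \<in> poly_alg A" for i
    using assms by (cases i) (auto simp: coeffs_in_def)
qed

lemma poly_alg_poly: "coeffs_in A p \<Longrightarrow> (\<And>l. degree (p l) \<le> n) \<Longrightarrow> (\<lambda>l. poly (p l) t) \<in> poly_alg A"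
  unfolding coeffs_in_def by (subst poly_altdef_le[of _ n]) (auto intro!: poly_alg_intros)

context scroll
begin

text \<open>The coefficients of the linear form \<open>l 0\<close> with respect to the coordinates
  \<open>X j\<close> on S; \<open>QQ\<close> and \<open>LL\<close> are the Q and L of its
  restriction to the chart.\<close>

definition b where "b j l = dot (l 0) (M j)" for l :: "nat \<Rightarrow> complex ^ 5"

definition QQ where "QQ l = [:b 0 l, b 1 l, b 2 l:]"

definition LL where "LL l = [:b 3 l, b 4 l:]"

lemma b_poly: "b j \<in> poly_alg (coefficient_functions 1)"
  unfolding b_def[abs_def] dot_def by (intro poly_alg_intros poly_alg.gen coefficient_functionsI) auto

lemma b_surj:
  obtains l where "b 0 l = c0" "b 1 l = c1" "b 2 l = c2" "b 3 l = c3" "b 4 l = c4"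
  by (rule that[of "\<lambda>_. c0 *s N 0 + c1 *s N 1 + c2 *s N 2 + c3 *s N 3 + c4 *s N 4"])
     (simp_all add: b_def dual)

lemma dot_\<Phi>: "dot (l 0) (\<Phi> x y z e) = e * (b 0 l * x\<^sup>2 + b 1 l * x * y + b 2 l * y\<^sup>2) + z * (b 3 l * x + b 4 l * y)"
  by (simp add: scroll_map_def b_def algebra_simps)

lemma in_hyperplane_\<Phi>: "valid x y z e \<Longrightarrow> pt (\<Phi> x y z e) \<in> hyperplane (l 0) \<longleftrightarrow>
    e * (b 0 l * x\<^sup>2 + b 1 l * x * y + b 2 l * y\<^sup>2) + z * (b 3 l * x + b 4 l * y) = 0"
  using in_hyperplane[OF \<Phi>_nonzero] by (simp add: dot_\<Phi>)

text \<open>The assumptions keep the section inside the chart and its points distinct. Full degree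
  excludes points with x = 0, \<open>l2\<close> excludes points with e = 0, and \<open>l3\<close>,
  the resultant of \<open>QQ\<close> and \<open>LL\<close>, prevents the hyperplane from containing
  a line of the ruling. What remains corresponds to the simple roots of
  \<open>section_poly\<close>.\<close>

lemma curve_section:
  assumes f: "cls a m f" and m: "degree f = m" "m > 0"
    and l1: "degree (section_poly m f (QQ l) (LL l)) = a + m" and sf: "rsquarefree (section_poly m f (QQ l) (LL l))"
    and l2: "\<forall>t. poly (coeff f m) t = 0 \<longrightarrow> poly (LL l) t \<noteq> 0"
    and l3: "b 0 l * (b 4 l)\<^sup>2 - b 1 l * b 3 l * b 4 l + b 2 l * (b 3 l)\<^sup>2 \<noteq> 0"
  shows "finite (curve f \<inter> hyperplane (l 0))" "card (curve f \<inter> hyperplane (l 0)) = a + m"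
proof -
  let ?\<phi> = "section_poly m f (QQ l) (LL l)"
  have "?\<phi> \<noteq> 0"
    using l1 m by auto
  then have "coeff ?\<phi> (a + m) \<noteq> 0"
    using l1 by (metis leading_coeff_0_iff)
  then have top: "hat a m f 0 1 (- b 2 l) (b 4 l) \<noteq> 0"
    unfolding QQ_def LL_def coeff_section_poly_top[OF f] .
  have QL: "poly (QQ l) t \<noteq> 0" if "poly (LL l) t = 0" for t
  proof
    assume Q: "poly (QQ l) t = 0"
    have 3: "b 3 l = - b 4 l * t"
      using that by (simp add: LL_def eq_neg_iff_add_eq_0 mult.commute)
    have "b 0 l * (b 4 l)\<^sup>2 - b 1 l * b 3 l * b 4 l + b 2 l * (b 3 l)\<^sup>2 = (b 4 l)\<^sup>2 * poly (QQ l) t"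
      unfolding 3 by (simp add: QQ_def algebra_simps power2_eq_square)
    then show False
      using l3 Q by simp
  qed
  have no01: False if p: "p \<in> curve f" "p \<in> hyperplane (l 0)" "p \<in> fibre 0 1" for p
  proof -
    obtain z e where ze: "p = pt (\<Phi> 0 1 z e)" "z \<noteq> 0 \<or> e \<noteq> 0"
      using p(3) unfolding fibre_def by blast
    then have v: "valid 0 1 z e"
      by (simp add: valid_def)
    have "e * b 2 l + z * b 4 l = 0"
      using p(2) in_hyperplane_\<Phi>[OF v] ze(1) by simp
    \<comment> \<open>On this line the hyperplane determines (z : e) as (-b2 : b4), where
      \<open>hat\<close> takes the nonzero value of the top coefficient.\<close>
    then obtain c where c: "- b 2 l = c * z" "b 4 l = c * e"
    proof (cases "e = 0")
      case True
      then show ?thesis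
        using that[of "- b 2 l / z"] ze(2) \<open>e * b 2 l + z * b 4 l = 0\<close> by auto
    next
      case False
      then show ?thesis
        using that[of "b 4 l / e"] add_eq_0_iff[THEN iffD1, OF \<open>e * b 2 l + z * b 4 l = 0\<close>]
        by (simp add: field_simps)
    qed
    have "hat a m f 0 1 z e = 0"
      using hat_zero_on_curve[OF f v] p(1) ze(1) by simp
    then show False
      using top unfolding c hat_scale(2)[OF f] by simp
  qed
  have noE: False if p: "p \<in> curve f" "p \<in> hyperplane (l 0)" "p \<in> Exc" for p
  proof -
    obtain x y where xy: "p = pt (\<Phi> x y 1 0)" "x \<noteq> 0 \<or> y \<noteq> 0"
      using p(3) unfolding Exc_def by blast
    then have v: "valid x y 1 0"
      by (simp add: valid_def)
    show False
    proof (cases "x = 0")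
      case True
      then have "p \<in> fibre 0 1"
        using in_fibre[of 0 1 1 0 y] xy by (simp add: valid_def)
      then show False
        using no01 p by blast
    next
      case False
      have "hat a m f (x * 1) (x * (y / x)) (x * (1 / x)) 0 = 0"
        using hat_zero_on_curve[OF f v] p(1) xy(1) False by simp
      then have "poly (coeff f m) (y / x) = 0"
        unfolding hat_scale(1)[OF f] hat_x1_e0[OF f] using False by simp
      then have "poly (LL l) (y / x) \<noteq> 0"
        using l2 by blast
      moreover have "b 3 l * x + b 4 l * y = 0"
        using p(2) in_hyperplane_\<Phi>[OF v] xy(1) by simp
      moreover have "x * poly (LL l) (y / x) = b 3 l * x + b 4 l * y"
        using False by (simp add: LL_def algebra_simps)
      ultimately show False
        using False by simp
    qed
  qed
  have eq: "curve f \<inter> hyperplane (l 0) = (\<lambda>t. upt t (- poly (QQ l) t / poly (LL l) t)) ` {t. poly ?\<phi> t = 0}"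
  proof (intro equalityI subsetI)
    fix p assume p: "p \<in> curve f \<inter> hyperplane (l 0)"
    then have "p \<in> S"
      using curve_subset by blast
    then obtain t u where tu: "p = upt t u"
      by (cases rule: S_cases) (use p no01 noE in auto)
    have "poly (QQ l) t + u * poly (LL l) t = 0"
      using p in_hyperplane_\<Phi>[OF valid_1(1), of t u l] unfolding tu upt_def
      by (simp add: QQ_def LL_def algebra_simps power2_eq_square)
    moreover from this have L: "poly (LL l) t \<noteq> 0"
      using QL[of t] by auto
    ultimately have u: "u = - poly (QQ l) t / poly (LL l) t"
      using add_eq_0_iff[of "poly (QQ l) t" "u * poly (LL l) t"] by (simp add: field_simps)
    have "ev2 f t u = 0"
      using p tu upt_in_curve by simp
    then have "poly ?\<phi> t = 0"
      using section_poly_root_iff[OF f L] u by simp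
    then show "p \<in> (\<lambda>t. upt t (- poly (QQ l) t / poly (LL l) t)) ` {t. poly ?\<phi> t = 0}"
      using tu u by blast
  next
    fix p assume "p \<in> (\<lambda>t. upt t (- poly (QQ l) t / poly (LL l) t)) ` {t. poly ?\<phi> t = 0}"
    then obtain t where t: "poly ?\<phi> t = 0" "p = upt t (- poly (QQ l) t / poly (LL l) t)"
      by blast
    have L: "poly (LL l) t \<noteq> 0"
    proof
      assume L: "poly (LL l) t = 0"
      then have "poly (coeff f m) t * (- poly (QQ l) t) ^ m = 0"
        using t(1) poly_section_poly[OF f, of "QQ l" "LL l" t] hat_x1_e0[OF f] by simp
      then show False
        using QL[OF L] l2 L by auto
    qed
    then have "ev2 f t (- poly (QQ l) t / poly (LL l) t) = 0"
      using t(1) section_poly_root_iff[OF f L] by simp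
    moreover have "p \<in> hyperplane (l 0)"
    proof -
      have "poly (QQ l) t + (- poly (QQ l) t / poly (LL l) t) * poly (LL l) t = 0"
        using L by simp
      then show ?thesis
        unfolding t(2) upt_def in_hyperplane_\<Phi>[OF valid_1(1)]
        by (simp add: QQ_def LL_def algebra_simps power2_eq_square)
    qed
    ultimately show "p \<in> curve f \<inter> hyperplane (l 0)"
      using t(2) upt_in_curve by simp
  qed
  show "finite (curve f \<inter> hyperplane (l 0))"
    unfolding eq using \<open>?\<phi> \<noteq> 0\<close> poly_roots_finite by blast
  show "card (curve f \<inter> hyperplane (l 0)) = a + m"
    unfolding eq using card_roots_rsquarefree[OF sf] l1 by (subst card_image) (auto simp: inj_on_def upt_inject)
qed

text \<open>The three conditions of \<open>curve_section\<close> are nonvanishing conditions on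
  polynomials in the coefficients of the hyperplane. \<open>rsquarefree_section_exists\<close> shows
  that the first can be met; a common hyperplane for all three then exists by
  \<open>poly_alg_nonzero_Int\<close>.\<close>

theorem curve_has_degree:
  assumes f: "cls a m f" and irr: "irreducible f" and m: "degree f = m" "m > 0"
    and top: "\<exists>k\<le>a. coeff (coeff f k) (a - k) \<noteq> 0"
  shows "has_degree (curve f) (a + m)"
proof -
  let ?A = "coefficient_functions 1 :: ((nat \<Rightarrow> complex ^ 5) \<Rightarrow> complex) set"
  let ?\<phi> = "\<lambda>l. section_poly m f (QQ l) (LL l)"
  have QQ: "coeffs_in ?A QQ" and LL: "coeffs_in ?A LL"
    unfolding QQ_def[abs_def] LL_def[abs_def] by (intro coeffs_in_pCons b_poly coeffs_in_const)+
  have \<phi>: "coeffs_in ?A ?\<phi>"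
    unfolding section_poly_def by (intro coeffs_in_sum coeffs_in_mult coeffs_in_power coeffs_in_uminus QQ LL coeffs_in_const)
  have gm: "coeff f m \<noteq> 0"
    using m by auto
  obtain c0 c1 c2 c3 c4 where c: "degree (section_poly m f [:c0, c1, c2:] [:c3, c4:]) = a + m"
    "rsquarefree (section_poly m f [:c0, c1, c2:] [:c3, c4:])"
    using rsquarefree_section_exists[OF f irr m top] by blast
  obtain l1 where "b 0 l1 = c0" "b 1 l1 = c1" "b 2 l1 = c2" "b 3 l1 = c3" "b 4 l1 = c4"
    by (rule b_surj)
  then have l1: "degree (?\<phi> l1) = a + m" "rsquarefree (?\<phi> l1)"
    using c by (simp_all add: QQ_def LL_def)
  have "\<exists>G\<in>poly_alg ?A. G l1 \<noteq> 0 \<and> (\<forall>l. G l \<noteq> 0 \<longrightarrow> degree (?\<phi> l) = a + m \<and> rsquarefree (?\<phi> l))"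
  proof (rule rsquarefree_generic[where \<phi> = ?\<phi>])
    show "(\<lambda>l. coeff (?\<phi> l) i) \<in> poly_alg ?A" for i
      using \<phi> by (simp add: coeffs_in_def)
    show "degree (?\<phi> l) \<le> a + m" for l
      by (rule degree_section_poly[OF f]) (auto simp: QQ_def LL_def)
  qed (use l1 m in auto)
  then obtain G1 where G1: "G1 \<in> poly_alg ?A" "G1 l1 \<noteq> 0"
    "\<forall>l. G1 l \<noteq> 0 \<longrightarrow> degree (?\<phi> l) = a + m \<and> rsquarefree (?\<phi> l)"
    by blast
  define G2 where "G2 l = (\<Prod>t | poly (coeff f m) t = 0. poly (LL l) t)" for l
  have G2: "G2 \<in> poly_alg ?A"
    unfolding G2_def by (intro poly_alg_prod poly_alg_poly[OF LL, of 1]) (simp add: LL_def)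
  define G3 where "G3 l = b 0 l * (b 4 l)\<^sup>2 - b 1 l * b 3 l * b 4 l + b 2 l * (b 3 l)\<^sup>2" for l
  have G3: "G3 \<in> poly_alg ?A"
    unfolding G3_def by (intro poly_alg_intros b_poly)
  obtain l2 where l2: "b 0 l2 = 0" "b 1 l2 = 0" "b 2 l2 = 1" "b 3 l2 = 1" "b 4 l2 = 0"
    by (rule b_surj)
  have G23: "(\<lambda>l. G2 l * G3 l) \<in> poly_alg ?A" "(\<lambda>l. G2 l * G3 l) l2 \<noteq> 0"
    using poly_alg.mult[OF G2 G3] l2 by (simp_all add: G2_def G3_def LL_def)
  obtain l3 where l3: "G1 l3 \<noteq> 0" "(\<lambda>l. G2 l * G3 l) l3 \<noteq> 0"
    using poly_alg_nonzero_Int[OF G1(1) G23(1) G1(2) G23(2)] by blast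
  show ?thesis
  proof (rule curve_degreeI)
    show "has_dim (curve f) 1"
      using curve_on_curve[OF irr] m by (simp add: curve_on_def)
    show "(\<lambda>l. G1 l * (G2 l * G3 l)) \<in> poly_alg ?A"
      using G1(1) G23(1) by (rule poly_alg.mult)
    show "G1 l3 * (G2 l3 * G3 l3) \<noteq> 0"
      using l3 by simp
    have "finite (curve f \<inter> hyperplane (l 0)) \<and> card (curve f \<inter> hyperplane (l 0)) = a + m"
      if "G1 l * (G2 l * G3 l) \<noteq> 0" for l
    proof -
      have "G2 l \<noteq> 0"
        using that by simp
      then have "\<forall>t. poly (coeff f m) t = 0 \<longrightarrow> poly (LL l) t \<noteq> 0"
        unfolding G2_def using poly_roots_finite[OF gm] by simp
      then show ?thesis
        using curve_section[OF f m, of l] G1(3) that by (simp add: G3_def)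
    qed
    then show "\<forall>l. G1 l * (G2 l * G3 l) \<noteq> 0 \<longrightarrow> finite (curve f \<inter> hyperplane (l 0))"
      "\<forall>l. G1 l * (G2 l * G3 l) \<noteq> 0 \<longrightarrow> card (curve f \<inter> hyperplane (l 0)) = a + m"
      by blast+
  qed
qed

end

section \<open>Counting intersection points\<close>

lemma (in vector_space) card_le_span:
  assumes I: "finite I" and ind: "\<And>c. (\<Sum>i\<in>I. scale (c i) (b i)) = 0 \<Longrightarrow> \<forall>i\<in>I. c i = 0"
    and T: "finite T" "b ` I \<subseteq> span T"
  shows "card I \<le> card T"
proof -
  have inj: "inj_on b I"
  proof (rule inj_onI, rule ccontr)
    fix i j assume ij: "i \<in> I" "j \<in> I" "b i = b j" "i \<noteq> j"
    define c where "c k = (if k = i then 1 else if k = j then - 1 else 0 :: 'a)" for k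
    have "(\<Sum>k\<in>I. scale (c k) (b k)) = (\<Sum>k\<in>{i, j}. scale (c k) (b k))"
      using I ij by (intro sum.mono_neutral_right) (auto simp: c_def)
    also have "\<dots> = 0"
      using ij by (simp add: c_def)
    finally have "c i = 0"
      using ind ij(1) by blast
    then show False
      by (simp add: c_def)
  qed
  have "independent (b ` I)"
  proof (rule independent_if_scalars_zero)
    fix g x assume g: "(\<Sum>x\<in>b ` I. scale (g x) x) = 0" and x: "x \<in> b ` I"
    have "(\<Sum>i\<in>I. scale (g (b i)) (b i)) = 0"
      using g by (simp add: sum.reindex[OF inj])
    from ind[OF this] show "g x = 0"
      using x by auto
  qed (use I in auto)
  then have "card (b ` I) \<le> card T"
    using independent_span_bound[OF T(1) _ T(2)] by blast
  then show ?thesis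
    by (simp add: card_image[OF inj])
qed

definition mon :: "nat \<times> nat \<Rightarrow> complex poly poly" where
  "mon = (\<lambda>(k, i). monom (monom 1 i) k)"

text \<open>The exponents of a monomial basis of the class \<open>cls a (n - 1)\<close>. The first
  argument counts the admissible powers of u, so it exceeds the bound in \<open>cls\<close> by one;
  this makes \<open>tri 0 a\<close> empty.\<close>

definition tri :: "nat \<Rightarrow> nat \<Rightarrow> (nat \<times> nat) set" where
  "tri n a = Sigma {..<n} (\<lambda>k. {..<Suc a - k})"

lemma finite_tri [simp]: "finite (tri n a)"
  by (simp add: tri_def)

text \<open>The sum of the row lengths a + 1 - k for k < n, doubled to avoid a division. The bound
  on n keeps every row length free of truncation.\<close>

lemma card_tri: "n \<le> Suc a \<Longrightarrow> 2 * int (card (tri n a)) = int n * (2 * int a + 3 - int n)"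
proof (induction n)
  case (Suc n)
  have "card (tri (Suc n) a) = card (tri n a) + (Suc a - n)"
    by (simp add: tri_def)
  then show ?case
    using Suc by (simp add: algebra_simps of_nat_diff)
qed (simp add: tri_def)

lemma cls_mon: "s \<in> tri (Suc n) a \<Longrightarrow> cls a n (mon s)"
  by (auto simp: tri_def mon_def intro: cls_monom)

lemma coeff_sum_mon:
  assumes "(k, i) \<in> tri n a"
  shows "coeff (coeff (\<Sum>s\<in>tri n a. smult [:c s:] (mon s)) k) i = c (k, i)"
proof -
  have "coeff (coeff (\<Sum>s\<in>tri n a. smult [:c s:] (mon s)) k) i
      = (\<Sum>s\<in>tri n a. if s = (k, i) then c (k, i) else 0)"
    unfolding coeff_sum by (intro sum.cong) (auto simp: mon_def split: prod.splits)
  then show ?thesis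
    using assms by simp
qed

interpretation poly2: vector_space "\<lambda>c (p :: complex poly poly). smult [:c:] p"
  by unfold_locales (simp_all add: smult_add_right algebra_simps flip: smult_add_left one_pCons)

lemma cls_span:
  assumes "cls a n p"
  shows "p \<in> poly2.span (mon ` tri (Suc n) a)"
proof -
  have mon: "monom (monom (coeff (coeff p k) i) i) k \<in> poly2.span (mon ` tri (Suc n) a)" for k i
  proof (cases "coeff (coeff p k) i = 0")
    case True
    then show ?thesis
      by (simp add: poly2.span_zero)
  next
    case False
    then have "k \<le> n" "k + i \<le> a"
      using assms by (auto simp: cls_def)
    then have "(k, i) \<in> tri (Suc n) a"
      by (auto simp: tri_def)
    then have "smult [:coeff (coeff p k) i:] (mon (k, i)) \<in> poly2.span (mon ` tri (Suc n) a)"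
      by (intro poly2.span_scale poly2.span_base) auto
    then show ?thesis
      by (simp add: mon_def smult_monom)
  qed
  show ?thesis
    by (subst cls_decomp[OF assms]) (intro poly2.span_sum mon)
qed

lemma cls_hat_prod:
  assumes "finite Y" "\<And>i. i \<in> Y \<Longrightarrow> cls a m (g i)"
  shows "cls (card Y * a) (card Y * m) (prod g Y) \<and>
    hat (card Y * a) (card Y * m) (prod g Y) x y z e = (\<Prod>i\<in>Y. hat a m (g i) x y z e)"
  using assms
proof (induction Y rule: finite_induct)
  case empty
  then show ?case
    by (simp add: cls_1 hat_one)
next
  case (insert i Y)
  then have "cls a m (g i)" "cls (card Y * a) (card Y * m) (prod g Y)"
    by auto
  from cls_mult[OF this] hat_mult[OF this] insert show ?case
    by simp
qed

text \<open>The linear forms in x, y are sections of h - e, the others of h. Products of such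
  sections suffice to separate points.\<close>

lemma cls_linear: "cls 1 0 [:[:c, d:]:]" "cls 1 1 [:[:c, d:], [:g:]:]"
  by (auto simp: cls_def coeff_pCons split: nat.splits)

lemma hat_linear: "hat 1 0 [:[:c, d:]:] x y z e = c * x + d * y"
  "hat 1 1 [:[:c, d:], [:g:]:] x y z e = (c * x + d * y) * e + g * z"
  by (simp_all add: hat_def algebra_simps)

text \<open>On a line of the ruling \<open>hat\<close> is a binary form of degree m in (z, e). It
  has at most m zeros with e \<noteq> 0, and at most one point has e = 0.\<close>

lemma binary_form_zeros:
  fixes W :: "'a set" and z e :: "'a \<Rightarrow> complex"
  assumes f: "cls a m f" and nz: "\<exists>u. hat a m f x y u 1 \<noteq> 0" and W: "finite W"
    and zero: "\<And>p. p \<in> W \<Longrightarrow> hat a m f x y (z p) (e p) = 0"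
    and distinct: "\<And>p p'. p \<in> W \<Longrightarrow> p' \<in> W \<Longrightarrow> p \<noteq> p' \<Longrightarrow> z p * e p' \<noteq> z p' * e p"
  shows "card W \<le> Suc m"
proof -
  define c where "c k = (\<Sum>i\<le>a. coeff (coeff f k) i * x ^ (a - k - i) * y ^ i)" for k
  define g where "g = (\<Sum>k\<le>m. monom (c k) k)"
  have g: "poly g u = hat a m f x y u 1" for u
    by (simp add: g_def hat_def poly_sum poly_monom c_def sum_distrib_right)
  then have "g \<noteq> 0"
    using nz by auto
  have "degree g \<le> m"
    unfolding g_def by (rule degree_sum_le) (auto intro: order_trans[OF degree_monom_le])
  define W1 where "W1 = {p \<in> W. e p \<noteq> 0}"
  have "(\<lambda>p. z p / e p) ` W1 \<subseteq> {u. poly g u = 0}"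
  proof
    fix u assume "u \<in> (\<lambda>p. z p / e p) ` W1"
    then obtain p where p: "p \<in> W" "e p \<noteq> 0" "u = z p / e p"
      by (auto simp: W1_def)
    then have "hat a m f x y (e p * u) (e p * 1) = 0"
      using zero[of p] by simp
    then show "u \<in> {u. poly g u = 0}"
      using p(2) unfolding hat_scale(2)[OF f] by (simp add: g)
  qed
  then have "card ((\<lambda>p. z p / e p) ` W1) \<le> card {u. poly g u = 0}"
    by (rule card_mono[OF poly_roots_finite[OF \<open>g \<noteq> 0\<close>]])
  also have "\<dots> \<le> m"
    using card_poly_roots_bound[OF \<open>g \<noteq> 0\<close>] \<open>degree g \<le> m\<close> by linarith
  also have "card ((\<lambda>p. z p / e p) ` W1) = card W1"
  proof (rule card_image, rule inj_onI, rule ccontr)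
    fix p p' assume p: "p \<in> W1" "p' \<in> W1" "z p / e p = z p' / e p'" "p \<noteq> p'"
    then have "z p * e p' = z p' * e p"
      by (simp add: W1_def field_simps)
    then show False
      using distinct p by (auto simp: W1_def)
  qed
  finally have W1: "card W1 \<le> m" .
  have "W - W1 \<subseteq> {SOME p. p \<in> W - W1}"
  proof
    fix p assume p: "p \<in> W - W1"
    then have "(SOME p. p \<in> W - W1) \<in> W - W1"
      by (rule someI)
    then show "p \<in> {SOME p. p \<in> W - W1}"
      using p distinct[of p "SOME p. p \<in> W - W1"] by (auto simp: W1_def)
  qed
  then have "card (W - W1) \<le> 1"
    using card_mono[of "{SOME p. p \<in> W - W1}" "W - W1"] by simp
  moreover have "card W = card W1 + card (W - W1)"
    using W by (subst card_Un_disjoint[symmetric]) (auto simp: W1_def intro: arg_cong[where f = card])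
  ultimately show ?thesis
    using W1 by simp
qed

context scroll
begin

section \<open>Separating points of the scroll and counting sections\<close>

text \<open>Only (x, y) is normalised, so that points on the same line of the ruling get equal first
  two coordinates. The pair (z, e) is left free up to a scalar.\<close>

definition coords :: "5 proj \<Rightarrow> complex \<times> complex \<times> complex \<times> complex" where
  "coords p = (SOME (x, y, z, e). p = pt (\<Phi> x y z e) \<and> (x = 1 \<or> x = 0 \<and> y = 1) \<and> (z \<noteq> 0 \<or> e \<noteq> 0))"

definition px where "px p = fst (coords p)"

definition py where "py p = fst (snd (coords p))"

definition pz where "pz p = fst (snd (snd (coords p)))"

definition pe where "pe p = snd (snd (snd (coords p)))"

lemma coords:
  assumes "p \<in> S"
  shows "p = pt (\<Phi> (px p) (py p) (pz p) (pe p))" "px p = 1 \<or> px p = 0 \<and> py p = 1" "pz p \<noteq> 0 \<or> pe p \<noteq> 0"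
    "valid (px p) (py p) (pz p) (pe p)"
proof -
  obtain x y z e where p: "p = pt (\<Phi> x y z e)" "valid x y z e"
    using assms unfolding S_eq by blast
  define c where "c = (if x = 0 then y else x)"
  have c: "c \<noteq> 0"
    using p(2) by (auto simp: c_def valid_def)
  have "p \<in> fibre (x / c) (y / c)"
    using in_fibre[of "x / c" "y / c" z e c] p c by (simp add: valid_def)
  then obtain z' e' where "p = pt (\<Phi> (x / c) (y / c) z' e')" "z' \<noteq> 0 \<or> e' \<noteq> 0"
    unfolding fibre_def by blast
  moreover have "x / c = 1 \<or> x / c = 0 \<and> y / c = 1"
    using c by (auto simp: c_def)
  ultimately have "\<exists>q. case q of (x, y, z, e) \<Rightarrow> p = pt (\<Phi> x y z e) \<and> (x = 1 \<or> x = 0 \<and> y = 1) \<and> (z \<noteq> 0 \<or> e \<noteq> 0)"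
    by (intro exI[of _ "(x / c, y / c, z', e')"]) simp
  then have "case coords p of (x, y, z, e) \<Rightarrow> p = pt (\<Phi> x y z e) \<and> (x = 1 \<or> x = 0 \<and> y = 1) \<and> (z \<noteq> 0 \<or> e \<noteq> 0)"
    unfolding coords_def by (rule someI_ex)
  then show "p = pt (\<Phi> (px p) (py p) (pz p) (pe p))" "px p = 1 \<or> px p = 0 \<and> py p = 1" "pz p \<noteq> 0 \<or> pe p \<noteq> 0"
    unfolding px_def py_def pz_def pe_def by (auto split: prod.splits)
  then show "valid (px p) (py p) (pz p) (pe p)"
    by (auto simp: valid_def)
qed

lemma coords_distinct:
  assumes "p \<in> S" "p' \<in> S" "p \<noteq> p'" "px p = px p'" "py p = py p'"
  shows "pz p * pe p' \<noteq> pz p' * pe p"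
proof
  assume eq: "pz p * pe p' = pz p' * pe p"
  obtain c where c: "pz p' = c * pz p" "pe p' = c * pe p"
  proof (cases "pe p = 0")
    case True
    then show ?thesis
      using that[of "pz p' / pz p"] eq coords(3)[OF assms(1)] by auto
  next
    case False
    then show ?thesis
      using that[of "pe p' / pe p"] eq by (simp add: field_simps)
  qed
  have "c \<noteq> 0"
    using c coords(3)[OF assms(2)] by auto
  have "\<Phi> (px p') (py p') (pz p') (pe p') = c *s \<Phi> (px p) (py p) (pz p) (pe p)"
    using \<Phi>_scale(1) c assms(4,5) by simp
  then have "pt (\<Phi> (px p') (py p') (pz p') (pe p')) = pt (\<Phi> (px p) (py p) (pz p) (pe p))"
    using pt_smult[OF \<open>c \<noteq> 0\<close> \<Phi>_nonzero[OF coords(4)[OF assms(1)]]] by simp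
  then show False
    using coords(1)[OF assms(1)] coords(1)[OF assms(2)] assms(3) by metis
qed

text \<open>The curve contains no line of the ruling: for those in the chart its slice is nonzero,
  and for x = 0 the top form of f is.\<close>

lemma hat_not_zero_on_fibre:
  assumes f: "cls a m f" and irr: "irreducible f" and m: "degree f = m" "m > 0"
    and top: "\<exists>k\<le>a. coeff (coeff f k) (a - k) \<noteq> 0" and xy: "x = 1 \<or> x = 0 \<and> y = 1"
  shows "\<exists>u. hat a m f x y u 1 \<noteq> 0"
proof (cases "x = 1")
  case True
  have "slice f y \<noteq> 0"
    using slice_nonzero[OF irr] m by simp
  then obtain u where "poly (slice f y) u \<noteq> 0"
    using poly_all_0_iff_0 by blast
  then show ?thesis
    using hat_1[OF f] True by (auto simp: ev2_slice)
next
  case False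
  then have x: "x = 0" "y = 1"
    using xy by auto
  define r where "r = (\<Sum>k\<le>m. monom (coeff (coeff f k) (a - k)) k)"
  have "hat a m f 0 1 u 1 = poly r u" for u
    by (simp add: hat_x0[OF f] r_def poly_sum poly_monom)
  moreover have "r \<noteq> 0"
  proof -
    obtain k where k: "k \<le> a" "coeff (coeff f k) (a - k) \<noteq> 0"
      using top by blast
    then have "k \<le> m"
      using f by (auto simp: cls_def)
    have "coeff r k = (\<Sum>k'\<le>m. if k' = k then coeff (coeff f k) (a - k) else 0)"
      unfolding r_def coeff_sum by (intro sum.cong) auto
    then show ?thesis
      using k \<open>k \<le> m\<close> by auto
  qed
  ultimately show ?thesis
    using x poly_all_0_iff_0[of r] by auto
qed

text \<open>A product of linear sections. \<open>g1\<close> removes the points on other lines of the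
  ruling without using u-degree, \<open>g2\<close> removes those on the line of p at the cost of one
  u-degree each, and powers of \<open>g3\<close> and \<open>g4\<close>, which do not vanish at p,
  fill up the class. Hence only the number of points on one line limits n.\<close>

lemma separating_form:
  assumes Z: "finite Z" "Z \<subseteq> S" and p: "p \<in> Z"
    and fib: "card {p' \<in> Z. px p' = px p \<and> py p' = py p} \<le> Suc n"
    and A: "n + card Z \<le> A"
  shows "\<exists>h. cls A n h \<and> hat A n h (px p) (py p) (pz p) (pe p) \<noteq> 0 \<and>
    (\<forall>p'\<in>Z - {p}. hat A n h (px p') (py p') (pz p') (pe p') = 0)"
proof -
  define x y z e where "x = px p" and "y = py p" and "z = pz p" and "e = pe p"
  have pS: "p \<in> S"
    using p Z by blast
  have xy: "x = 1 \<or> x = 0 \<and> y = 1" and ze: "z \<noteq> 0 \<or> e \<noteq> 0"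
    using coords[OF pS] by (simp_all add: x_def y_def z_def e_def)
  \<comment> \<open>Makes the linear form x X + o' Y equal to 1 on the line of the ruling through
    p.\<close>
  define o' where "o' = (if x = 0 then 1 else 0 :: complex)"
  have xo: "x * x + o' * y = 1"
    using xy by (auto simp: o'_def)
  define Z1 where "Z1 = {p' \<in> Z. \<not> (px p' = x \<and> py p' = y)}"
  define Z2 where "Z2 = {p' \<in> Z. px p' = x \<and> py p' = y} - {p}"
  have fin: "finite Z1" "finite Z2"
    using Z by (auto simp: Z1_def Z2_def)
  have "card Z2 = card {p' \<in> Z. px p' = x \<and> py p' = y} - 1"
    unfolding Z2_def using p Z by (subst card_Diff_singleton) (auto simp: x_def y_def)
  then have Z2: "card Z2 \<le> n"
    using fib by (simp add: x_def y_def)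
  have Z1: "card Z1 \<le> card Z"
    using Z by (auto simp: Z1_def intro: card_mono)
  define g1 where "g1 p' = [:[:py p', - px p':]:]" for p'
  \<comment> \<open>Up to the factor x X + o' Y, which is 1 on the common line, this is the
    determinant of (z, e) at the variable point and at p'. It vanishes at p', but not at p by
    \<open>coords_distinct\<close>.\<close>
  define g2 where "g2 p' = [:[:- pz p' * x, - pz p' * o':], [:pe p':]:]" for p'
  define g3 where "g3 = [:[:x, o':]:]"
  define \<alpha> \<beta> where "\<alpha> = (if z \<noteq> 0 then 1 / z else 0)" and "\<beta> = (if z \<noteq> 0 then 0 else 1 / e)"
  \<comment> \<open>Hence \<open>g4\<close> takes the value 1 at p.\<close>
  have \<alpha>\<beta>: "\<beta> * e + \<alpha> * z = 1"
    using ze by (auto simp: \<alpha>_def \<beta>_def)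
  define g4 where "g4 = [:[:\<beta> * x, \<beta> * o':], [:\<alpha>:]:]"
  define h where "h = prod g1 Z1 * prod g2 Z2 * (g3 ^ (A - card Z1 - n) * g4 ^ (n - card Z2))"
  have 1: "cls (card Z1) 0 (prod g1 Z1)" "hat (card Z1) 0 (prod g1 Z1) X Y U V = (\<Prod>p'\<in>Z1. py p' * X - px p' * Y)" for X Y U V
    using cls_hat_prod[OF fin(1), of 1 0 g1] cls_linear(1) by (simp_all add: g1_def hat_linear del: One_nat_def)
  have 2: "cls (card Z2) (card Z2) (prod g2 Z2)" "hat (card Z2) (card Z2) (prod g2 Z2) X Y U V
      = (\<Prod>p'\<in>Z2. (- pz p' * x * X - pz p' * o' * Y) * V + pe p' * U)" for X Y U V
    using cls_hat_prod[OF fin(2), of 1 1 g2] cls_linear(2) by (simp_all add: g2_def hat_linear del: One_nat_def)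
  have 3: "cls (k * 1) (k * 0) (g3 ^ k)" "hat (k * 1) (k * 0) (g3 ^ k) X Y U V = (x * X + o' * Y) ^ k" for k X Y U V
    using cls_power[OF cls_linear(1)] hat_power[OF cls_linear(1)] by (simp_all add: g3_def hat_linear del: One_nat_def mult_1_right mult_0_right)
  have 4: "cls (k * 1) (k * 1) (g4 ^ k)" "hat (k * 1) (k * 1) (g4 ^ k) X Y U V = ((\<beta> * x * X + \<beta> * o' * Y) * V + \<alpha> * U) ^ k" for k X Y U V
    using cls_power[OF cls_linear(2)] hat_power[OF cls_linear(2)] by (simp_all add: g4_def hat_linear del: One_nat_def mult_1_right)
  let ?k = "A - card Z1 - n" and ?j = "n - card Z2"
  have cls_eq: "card Z1 + card Z2 + (?k * 1 + ?j * 1) = A" "0 + card Z2 + (?k * 0 + ?j * 1) = n"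
    using A Z1 Z2 by auto
  have c12: "cls (card Z1 + card Z2) (0 + card Z2) (prod g1 Z1 * prod g2 Z2)"
    using 1(1) 2(1) by (rule cls_mult)
  have c34: "cls (?k * 1 + ?j * 1) (?k * 0 + ?j * 1) (g3 ^ ?k * g4 ^ ?j)"
    using 3(1) 4(1) by (rule cls_mult)
  have h: "cls A n h"
    using cls_mult[OF c12 c34] unfolding cls_eq h_def .
  have hat: "hat A n h X Y U V = (\<Prod>p'\<in>Z1. py p' * X - px p' * Y) *
      (\<Prod>p'\<in>Z2. (- pz p' * x * X - pz p' * o' * Y) * V + pe p' * U) *
      ((x * X + o' * Y) ^ ?k * ((\<beta> * x * X + \<beta> * o' * Y) * V + \<alpha> * U) ^ ?j)" for X Y U V
    using hat_mult[OF c12 c34, of X Y U V] unfolding cls_eq hat_mult[OF 1(1) 2(1)] hat_mult[OF 3(1) 4(1)] 1(2) 2(2) 3(2) 4(2) h_def .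
  show ?thesis
  proof (intro exI[of _ h] conjI ballI h)
    have "py p' * x - px p' * y \<noteq> 0" if "p' \<in> Z1" for p'
    proof
      assume eq: "py p' * x - px p' * y = 0"
      have "px p' = 1 \<or> px p' = 0 \<and> py p' = 1"
        using that Z coords(2) by (auto simp: Z1_def)
      then have "px p' = x \<and> py p' = y"
        using eq xy by auto
      then show False
        using that by (simp add: Z1_def)
    qed
    moreover have "(- pz p' * x * x - pz p' * o' * y) * e + pe p' * z \<noteq> 0" if "p' \<in> Z2" for p'
    proof -
      have "(- pz p' * x * x - pz p' * o' * y) * e + pe p' * z = - pz p' * (x * x + o' * y) * e + pe p' * z"
        by (simp add: algebra_simps)
      moreover have "pz p * pe p' \<noteq> pz p' * pe p"
        using that Z pS by (intro coords_distinct) (auto simp: Z2_def x_def y_def)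
      ultimately show ?thesis
        unfolding xo by (simp add: z_def e_def algebra_simps)
    qed
    moreover have "x * x + o' * y \<noteq> 0"
      using xo by simp
    moreover have "(\<beta> * x * x + \<beta> * o' * y) * e + \<alpha> * z \<noteq> 0"
    proof -
      have "(\<beta> * x * x + \<beta> * o' * y) * e + \<alpha> * z = \<beta> * (x * x + o' * y) * e + \<alpha> * z"
        by (simp add: algebra_simps)
      then show ?thesis
        unfolding xo using \<alpha>\<beta> by simp
    qed
    ultimately show "hat A n h (px p) (py p) (pz p) (pe p) \<noteq> 0"
      unfolding x_def[symmetric] y_def[symmetric] z_def[symmetric] e_def[symmetric] hat
      using fin by simp
  next
    fix p' assume p': "p' \<in> Z - {p}"
    show "hat A n h (px p') (py p') (pz p') (pe p') = 0"
    proof (cases "p' \<in> Z1")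
      case True
      then have "(\<Prod>q\<in>Z1. py q * px p' - px q * py p') = 0"
        using fin(1) by (intro prod_zero) (auto intro: bexI[of _ p'])
      then show ?thesis
        unfolding hat by simp
    next
      case False
      then have Z2': "p' \<in> Z2" and eq: "px p' = x" "py p' = y"
        using p' by (auto simp: Z1_def Z2_def)
      have "(- pz p' * x * x - pz p' * o' * y) * pe p' + pe p' * pz p' = - pz p' * (x * x + o' * y) * pe p' + pe p' * pz p'"
        by (simp add: algebra_simps)
      then have "(- pz p' * x * px p' - pz p' * o' * py p') * pe p' + pe p' * pz p' = 0"
        unfolding eq xo by simp
      then have "(\<Prod>q\<in>Z2. (- pz q * x * px p' - pz q * o' * py p') * pe p' + pe q * pz p') = 0"
        using fin(2) Z2' by (intro prod_zero) (auto intro: bexI[of _ p'])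
      then show ?thesis
        unfolding hat by simp
    qed
  qed
qed

lemma curve_eq_if_dvd:
  assumes "irreducible f1" "degree f1 > 0" "irreducible f2" "degree f2 > 0" "f1 dvd f2"
  shows "curve f1 = curve f2"
proof (rule curve_eq[OF S_dim S_variety curve_on_curve[OF assms(1,2)] curve_variety[OF assms(3,4)]])
  show "curve f1 \<subseteq> curve f2"
    using assms(5) dvd_trans unfolding curve_def by blast
  show "curve f2 \<subset> S"
    using assms(3) by (intro curve_proper) auto
qed

text \<open>The forms of a large class \<open>(A, m1 + m2 - 1)\<close> are compared with the multiples of \<open>f1\<close> and \<open>f2\<close>
  among them: evaluation at the intersection points is onto, and no syzygies occur since
  \<open>u\<close>-degrees are too small.\<close>

lemma card_common_points:
  assumes f1: "cls a1 m1 f1" and irr1: "irreducible f1" and m1: "degree f1 = m1" "m1 > 0"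
    and top1: "\<exists>k\<le>a1. coeff (coeff f1 k) (a1 - k) \<noteq> 0"
    and f2: "cls a2 m2 f2" and irr2: "irreducible f2" and m2: "degree f2 = m2" "m2 > 0"
    and ne: "\<not> f2 dvd f1" and Z: "finite Z" "Z \<subseteq> curve f1 \<inter> curve f2"
  shows "card Z + m1 * m2 \<le> a1 * m2 + a2 * m1"
proof -
  have ZS: "Z \<subseteq> S"
    using Z(2) curve_subset by blast
  define n where "n = m1 + m2 - 1"
  \<comment> \<open>A is large enough for \<open>separating_form\<close> and for all dimension
    formulas to hold without truncation.\<close>
  define A where "A = a1 + a2 + n + card Z"
  have n: "Suc n = m1 + m2" "n = (m2 - 1) + m1" "n = (m1 - 1) + m2"
    using m1 m2 by (auto simp: n_def)
  have on_curves: "pt (\<Phi> (px p) (py p) (pz p) (pe p)) \<in> curve f1 \<inter> curve f2"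
      "valid (px p) (py p) (pz p) (pe p)" if "p \<in> Z" for p
  proof -
    have "p \<in> S"
      using that ZS by blast
    from coords(1,4)[OF this] show "pt (\<Phi> (px p) (py p) (pz p) (pe p)) \<in> curve f1 \<inter> curve f2"
      "valid (px p) (py p) (pz p) (pe p)"
      using that Z(2) by auto
  qed
  have z1: "hat a1 m1 f1 (px p) (py p) (pz p) (pe p) = 0" if "p \<in> Z" for p
    using on_curves[OF that] by (intro hat_zero_on_curve[OF f1]) auto
  have z2: "hat a2 m2 f2 (px p) (py p) (pz p) (pe p) = 0" if "p \<in> Z" for p
    using on_curves[OF that] by (intro hat_zero_on_curve[OF f2]) auto
  have "\<exists>h. cls A n h \<and> hat A n h (px p) (py p) (pz p) (pe p) \<noteq> 0 \<and>
    (\<forall>p'\<in>Z - {p}. hat A n h (px p') (py p') (pz p') (pe p') = 0)" if p: "p \<in> Z" for p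
  proof (rule separating_form[OF Z(1) ZS p])
    let ?W = "{p' \<in> Z. px p' = px p \<and> py p' = py p}"
    have "card ?W \<le> Suc m1"
    proof (rule binary_form_zeros[OF f1 hat_not_zero_on_fibre[OF f1 irr1 m1 top1 coords(2)]])
      show "p \<in> S"
        using p ZS by blast
      show "hat a1 m1 f1 (px p) (py p) (pz p') (pe p') = 0" if "p' \<in> ?W" for p'
        using z1[of p'] that by simp
      show "pz p' * pe p'' \<noteq> pz p'' * pe p'" if "p' \<in> ?W" "p'' \<in> ?W" "p' \<noteq> p''" for p' p''
        using that ZS by (intro coords_distinct) auto
    qed (use Z in auto)
    \<comment> \<open>The points lie on the first curve, so one line of the ruling carries at most
      m1 + 1 of them, and m1 + 1 \<le> m1 + m2.\<close>
    then show "card ?W \<le> Suc n"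
      using n m2 by simp
  qed (simp add: A_def)
  then obtain h where h: "\<And>p. p \<in> Z \<Longrightarrow> cls A n (h p)"
      "\<And>p. p \<in> Z \<Longrightarrow> hat A n (h p) (px p) (py p) (pz p) (pe p) \<noteq> 0"
      "\<And>p p'. p \<in> Z \<Longrightarrow> p' \<in> Z \<Longrightarrow> p' \<noteq> p \<Longrightarrow> hat A n (h p) (px p') (py p') (pz p') (pe p') = 0"
    by (metis Diff_iff empty_iff insert_iff)
  \<comment> \<open>Monomial bases for the cofactors of f1 and f2: the classes complementary to (a1,
    m1) and (a2, m2) in (A, n), with u-degrees at most m2 - 1 and m1 - 1.\<close>
  define I1 I2 where "I1 = tri m2 (A - a1)" and "I2 = tri m1 (A - a2)"
  define I where "I = I1 <+> (I2 <+> Z)"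
  define bs where "bs = case_sum (\<lambda>s. mon s * f1) (case_sum (\<lambda>s. mon s * f2) h)"
  have finI: "finite I1" "finite I2" "finite (I2 <+> Z)"
    using Z by (auto simp: I1_def I2_def)
  have mon1: "cls (A - a1) (m2 - 1) (mon s)" if "s \<in> I1" for s
    using that m2 cls_mon[of s "m2 - 1" "A - a1"] by (simp add: I1_def)
  have mon2: "cls (A - a2) (m1 - 1) (mon s)" if "s \<in> I2" for s
    using that m1 cls_mon[of s "m1 - 1" "A - a2"] by (simp add: I2_def)
  have A: "(A - a1) + a1 = A" "(A - a2) + a2 = A"
    by (simp_all add: A_def)
  have "card I \<le> card (mon ` tri (Suc n) A)"
  proof (rule poly2.card_le_span)
    show "finite I"
      using finI by (simp add: I_def)
    have "cls A n (bs i)" if "i \<in> I" for i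
      using that mon1[THEN cls_mult[OF _ f1]] mon2[THEN cls_mult[OF _ f2]] h(1)
      unfolding I_def A n(2)[symmetric] n(3)[symmetric] by (auto simp: bs_def)
    then show "bs ` I \<subseteq> poly2.span (mon ` tri (Suc n) A)"
      using cls_span by blast
  next
    fix c assume c: "(\<Sum>i\<in>I. smult [:c i:] (bs i)) = 0"
    define P1 where "P1 = (\<Sum>s\<in>I1. smult [:c (Inl s):] (mon s))"
    define P2 where "P2 = (\<Sum>s\<in>I2. smult [:c (Inr (Inl s)):] (mon s))"
    define H where "H = (\<Sum>p\<in>Z. smult [:c (Inr (Inr p)):] (h p))"
    have sum0: "P1 * f1 + (P2 * f2 + H) = 0"
      using c unfolding I_def P1_def P2_def H_def sum_distrib_right
      by (simp add: sum.Plus[OF finI(1,3)] sum.Plus[OF finI(2) Z(1)] bs_def del: mult_smult_left flip: mult_smult_left)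
    have P1: "cls (A - a1) (m2 - 1) P1" and P2: "cls (A - a2) (m1 - 1) P2"
      unfolding P1_def P2_def by (intro cls_sum cls_smult mon1 mon2; assumption)+
    have 1: "hat A n (P1 * f1) x y z e = hat (A - a1) (m2 - 1) P1 x y z e * hat a1 m1 f1 x y z e" for x y z e
      using hat_mult[OF P1 f1] unfolding A n(2)[symmetric] .
    have 2: "hat A n (P2 * f2) x y z e = hat (A - a2) (m1 - 1) P2 x y z e * hat a2 m2 f2 x y z e" for x y z e
      using hat_mult[OF P2 f2] unfolding A n(3)[symmetric] .
    \<comment> \<open>At p the multiples of f1 and f2 vanish, and among the separating sections only
      \<open>h p\<close> does not.\<close>
    have c3: "c (Inr (Inr p)) = 0" if p: "p \<in> Z" for p
    proof -
      have "hat A n (P1 * f1 + (P2 * f2 + H)) (px p) (py p) (pz p) (pe p) = 0"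
        unfolding sum0 by simp
      then have "hat A n H (px p) (py p) (pz p) (pe p) = 0"
        unfolding hat_add 1 2 z1[OF p] z2[OF p] by simp
      moreover have "hat A n H (px p) (py p) (pz p) (pe p)
          = (\<Sum>q\<in>Z. if q = p then c (Inr (Inr p)) * hat A n (h p) (px p) (py p) (pz p) (pe p) else 0)"
        unfolding H_def hat_sum hat_smult using h(3)[OF _ p] by (intro sum.cong) auto
      ultimately show ?thesis
        using h(2)[OF p] p Z(1) by simp
    qed
    then have "H = 0"
      by (simp add: H_def)
    then have eq: "P1 * f1 + P2 * f2 = 0"
      using sum0 by simp
    then have "P1 * f1 = f2 * (- P2)"
      by (simp add: eq_neg_iff_add_eq_0 mult.commute)
    then have "f2 dvd P1 * f1"
      by simp
    \<comment> \<open>f2 is prime and does not divide f1. As P1 has smaller u-degree than f2, it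
      must be zero.\<close>
    then have "f2 dvd P1"
      using irreducible_imp_prime_elem[OF irr2] ne by (simp add: prime_elem_dvd_mult_iff)
    moreover have "degree P1 < degree f2"
      using cls_degree[OF P1] m2 by simp
    ultimately have "P1 = 0"
      using dvd_imp_degree_le[of f2 P1] by auto
    then have "P2 = 0"
      using eq irr2 by auto
    have c1: "c (Inl s) = 0" if "s \<in> I1" for s
    proof -
      obtain k i where s: "s = (k, i)"
        by fastforce
      show ?thesis
        using coeff_sum_mon[of k i m2 "A - a1" "\<lambda>s. c (Inl s)"] that \<open>P1 = 0\<close>
        by (simp add: P1_def I1_def s)
    qed
    have c2: "c (Inr (Inl s)) = 0" if "s \<in> I2" for s
    proof -
      obtain k i where s: "s = (k, i)"
        by fastforce
      show ?thesis
        using coeff_sum_mon[of k i m1 "A - a2" "\<lambda>s. c (Inr (Inl s))"] that \<open>P2 = 0\<close>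
        by (simp add: P2_def I2_def s)
    qed
    show "\<forall>i\<in>I. c i = 0"
      using c1 c2 c3 by (auto simp: I_def)
  qed simp
  also have "\<dots> \<le> card (tri (Suc n) A)"
    by (rule card_image_le) simp
  finally have "2 * int (card I1) + 2 * int (card I2) + 2 * int (card Z) \<le> 2 * int (card (tri (Suc n) A))"
    using finI Z(1) by (simp add: I_def card_Plus)
  then have "int m2 * (2 * int (A - a1) + 3 - int m2) + int m1 * (2 * int (A - a2) + 3 - int m1) + 2 * int (card Z)
      \<le> int (Suc n) * (2 * int A + 3 - int (Suc n))"
    unfolding I1_def I2_def using n by (subst (asm) (1 2 3) card_tri) (auto simp: A_def)
  moreover have "int (A - a1) = int A - int a1" "int (A - a2) = int A - int a2" "int (Suc n) = int m1 + int m2"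
    using n by (auto simp: A_def)
  \<comment> \<open>All terms with A cancel because n + 1 = m1 + m2; twice the intersection number
    remains.\<close>
  ultimately have "2 * int (card Z) + 2 * (int m1 * int m2) \<le> 2 * (int a1 * int m2 + int a2 * int m1)"
    by (simp only: algebra_simps)
  then have "2 * int (card Z + m1 * m2) \<le> 2 * int (a1 * m2 + a2 * m1)"
    by simp
  then show ?thesis
    by (simp only: mult_le_cancel_left_pos zero_less_numeral of_nat_le_iff)
qed

theorem curve_intersection:
  assumes "cls a1 m1 f1" "irreducible f1" "degree f1 = m1" "m1 > 0" "\<exists>k\<le>a1. coeff (coeff f1 k) (a1 - k) \<noteq> 0"
    and "cls a2 m2 f2" "irreducible f2" "degree f2 = m2" "m2 > 0"
    and ne: "curve f1 \<noteq> curve f2"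
  shows "finite (curve f1 \<inter> curve f2)" "card (curve f1 \<inter> curve f2) + m1 * m2 \<le> a1 * m2 + a2 * m1"
proof -
  have nd: "\<not> f2 dvd f1"
    using curve_eq_if_dvd[of f2 f1] assms by auto
  note bound = card_common_points[OF assms(1-9) nd]
  show fin: "finite (curve f1 \<inter> curve f2)"
  proof (rule ccontr)
    assume "infinite (curve f1 \<inter> curve f2)"
    \<comment> \<open>The bound for finite subsets also excludes infinitely many common
      points.\<close>
    then obtain Z where "finite Z" "card Z = Suc (a1 * m2 + a2 * m1)" "Z \<subseteq> curve f1 \<inter> curve f2"
      using infinite_arbitrarily_large by blast
    then show False
      using bound[of Z] by simp
  qed
  then show "card (curve f1 \<inter> curve f2) + m1 * m2 \<le> a1 * m2 + a2 * m1"
    by (rule bound) simp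
qed

end

section \<open>Arithmetic of the bound\<close>

lemma B_commute: "B d1 d2 = B d2 d1"
  unfolding B_def by (auto simp: mult.commute)

text \<open>With a1 = d1 - m1 and a2 = d2 - m2 the intersection number is d1 m2 + d2 m1 - 3 m1 m2.
  It is affine in each variable, so it is moved first in m1 and then in m2 to an end of the
  interval, in the direction given by the sign of the slope.\<close>

lemma bilinear_le:
  fixes s1 s2 m1 m2 d1 d2 K :: int
  assumes m: "1 \<le> m1" "m1 \<le> s1" "1 \<le> m2" "m2 \<le> s2"
    and corners: "d1 + d2 - 3 \<le> K" "d1 + d2 * s1 - 3 * s1 \<le> K" "d1 * s2 + d2 - 3 * s2 \<le> K"
      "d1 * s2 + d2 * s1 - 3 * (s1 * s2) \<le> K"
  shows "d1 * m2 + d2 * m1 - 3 * (m1 * m2) \<le> K"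
proof -
  have edge: "d1 * m2 + d2 * c - 3 * (c * m2) \<le> K"
    if "d1 + d2 * c - 3 * c \<le> K" "d1 * s2 + d2 * c - 3 * (c * s2) \<le> K" for c
  proof (cases "d1 - 3 * c \<ge> 0")
    case True
    then have "(d1 - 3 * c) * m2 \<le> (d1 - 3 * c) * s2"
      using m by (intro mult_left_mono) auto
    then show ?thesis
      using that by (simp add: algebra_simps)
  next
    case False
    then have "(d1 - 3 * c) * m2 \<le> (d1 - 3 * c) * 1"
      using m by (intro mult_left_mono_neg) auto
    then show ?thesis
      using that by (simp add: algebra_simps)
  qed
  show ?thesis
  proof (cases "d2 - 3 * m2 \<ge> 0")
    case True
    then have "(d2 - 3 * m2) * m1 \<le> (d2 - 3 * m2) * s1"
      using m by (intro mult_left_mono) auto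
    then show ?thesis
      using edge[of s1] corners by (simp add: algebra_simps)
  next
    case False
    then have "(d2 - 3 * m2) * m1 \<le> (d2 - 3 * m2) * 1"
      using m by (intro mult_left_mono_neg) auto
    then show ?thesis
      using edge[of 1] corners by (simp add: algebra_simps)
  qed
qed

text \<open>From m \<le> a one gets m \<le> d div 2, which fixes the rectangle. In the cases treated
  by \<open>main\<close> the corner m1 = d1 div 2, m2 = 1 equals \<open>B\<close>; the remaining
  parities follow by exchanging the curves.\<close>

lemma intersection_number_le_B:
  fixes a1 a2 m1 m2 c :: nat
  assumes m: "1 \<le> m1" "m1 \<le> a1" "1 \<le> m2" "m2 \<le> a2" and c: "c + m1 * m2 \<le> a1 * m2 + a2 * m1"
  shows "c \<le> B (a1 + m1) (a2 + m2)"
proof -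
  have main: "c \<le> B d1 d2"
    if d: "d1 = a1 + m1" "d2 = a2 + m2" and m: "1 \<le> m1" "m1 \<le> a1" "1 \<le> m2" "m2 \<le> a2"
      and c: "c + m1 * m2 \<le> a1 * m2 + a2 * m1"
      and par: "even d1 \<and> (even d2 \<longrightarrow> d1 \<le> d2) \<or> odd d1 \<and> odd d2" for a1 a2 m1 m2 d1 d2 :: nat
  proof -
    define s1 s2 where "s1 = d1 div 2" and "s2 = d2 div 2"
    have ms: "1 \<le> int m1" "int m1 \<le> int s1" "1 \<le> int m2" "int m2 \<le> int s2"
      using m d by (auto simp: s1_def s2_def)
    have a: "int a1 = int d1 - int m1" "int a2 = int d2 - int m2"
      using d by auto
    have "int c + int m1 * int m2 \<le> int a1 * int m2 + int a2 * int m1"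
      using c by (simp flip: of_nat_mult of_nat_add)
    then have N: "int c \<le> int d1 * int m2 + int d2 * int m1 - 3 * (int m1 * int m2)"
      unfolding a by (simp add: algebra_simps)
    \<comment> \<open>When the second degree is odd, \<open>prod\<close> compares \<open>B\<close>
      with the corner (1, 1), and \<open>prod1\<close> with (s1, s2).\<close>
    have prod: "(int s1 - 1) * (int s2 - 1) \<ge> 0"
      using ms by (intro mult_nonneg_nonneg) auto
    have prod1: "int s1 * (int s2 - 1) \<ge> 0"
      using ms by (intro mult_nonneg_nonneg) auto
    have "int c \<le> int (B d1 d2)"
    proof (cases "even d1")
      case True
      then have d1: "int d1 = 2 * int s1" "d1 = 2 * s1"
        by (auto simp: s1_def)
      show ?thesis
      proof (cases "even d2")
        case True
        then have d2: "int d2 = 2 * int s2" "d2 = 2 * s2"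
          by (auto simp: s2_def)
        have le: "int s1 \<le> int s2"
          using par True d1 d2 by auto
        have "d1 * (d2 - 1) div 2 = s1 * (2 * s2 - 1)"
          using d1 d2 by simp
        then have B: "int (B d1 d2) = int s1 * (2 * int s2 - 1)"
          using par True \<open>even d1\<close> ms by (simp add: B_def of_nat_diff)
        \<comment> \<open>The left-hand side is \<open>B\<close> minus the value at the corner (1,
          1). The second factor is negative only for s2 = 1, and then s1 = 1 as well.\<close>
        have "(int s1 - 1) * (2 * int s2 - 3) \<ge> 0"
          using ms le by (cases "s2 = 1") (auto intro!: mult_nonneg_nonneg)
        then show ?thesis
          using ms le prod prod1
          by (intro order_trans[OF N] bilinear_le[OF ms]) (simp_all add: B d1(1) d2(1) algebra_simps)
      next
        case False
        then have d2: "int d2 = 2 * int s2 + 1" "d2 = 2 * s2 + 1"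
          by (auto simp: s2_def elim!: oddE)
        have "d1 * (d2 - 1) div 2 = s1 * (2 * s2)"
          using d1 d2 by simp
        then have B: "int (B d1 d2) = 2 * (int s1 * int s2)"
          using False \<open>even d1\<close> by (simp add: B_def)
        show ?thesis
          using ms prod prod1
          by (intro order_trans[OF N] bilinear_le[OF ms]) (simp_all add: B d1(1) d2(1) algebra_simps)
      qed
    next
      case False
      then have d1: "int d1 = 2 * int s1 + 1" "d1 = 2 * s1 + 1"
        by (auto simp: s1_def elim!: oddE)
      have "odd d2"
        using False par by auto
      then have d2: "int d2 = 2 * int s2 + 1" "d2 = 2 * s2 + 1"
        by (auto simp: s2_def elim!: oddE)
      have "(d1 - 1) * (d2 - 1) div 2 = s1 * (2 * s2)"
        using d1 d2 by simp
      then have B: "int (B d1 d2) = 2 * (int s1 * int s2) + 1"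
        using False \<open>odd d2\<close> by (simp add: B_def)
      show ?thesis
        using ms prod prod1
        by (intro order_trans[OF N] bilinear_le[OF ms]) (simp_all add: B d1(1) d2(1) algebra_simps)
    qed
    then show ?thesis
      by simp
  qed
  consider "even (a1 + m1) \<and> (even (a2 + m2) \<longrightarrow> a1 + m1 \<le> a2 + m2) \<or> odd (a1 + m1) \<and> odd (a2 + m2)"
    | "even (a2 + m2) \<and> (even (a1 + m1) \<longrightarrow> a2 + m2 \<le> a1 + m1)"
    by linarith
  then show ?thesis
  proof cases
    case 1
    then show ?thesis
      using main m c by blast
  next
    case 2
    have "c + m2 * m1 \<le> a2 * m1 + a1 * m2"
      using c by (simp add: algebra_simps)
    then have "c \<le> B (a2 + m2) (a1 + m1)"
      using main[of "a2 + m2" a2 m2 "a1 + m1" a1 m1] m 2 by blast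
    then show ?thesis
      by (simp add: B_commute)
  qed
qed

section \<open>Explicit curves\<close>

lemma irreducible_monic_linear: "irreducible ([:r, 1:] :: complex poly poly)"
proof (rule irreducibleI)
  fix g h assume gh: "[:r, 1:] = g * h"
  have nz: "g \<noteq> 0" "h \<noteq> 0"
    using gh by auto
  have lc: "lead_coeff g * lead_coeff h = 1"
    using lead_coeff_mult[of g h] gh by (metis lead_coeff_pCons(1) lead_coeff_1 one_neq_zero one_pCons pCons_eq_0_iff)
  have "degree g + degree h = 1"
    using degree_mult_eq[OF nz] gh by (metis degree_pCons_eq_if one_neq_zero One_nat_def degree_pCons_0 pCons_eq_0_iff)
  then consider "degree g = 0" | "degree h = 0"
    by linarith
  then show "is_unit g \<or> is_unit h"
  proof cases
    case 1
    then obtain c where "g = [:c:]"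
      by (metis degree_eq_zeroE)
    then show ?thesis
      using lc by (auto simp: is_unit_const_poly_iff intro: dvdI[of _ _ "lead_coeff h"])
  next
    case 2
    then obtain c where "h = [:c:]"
      by (metis degree_eq_zeroE)
    then show ?thesis
      using lc by (auto simp: is_unit_const_poly_iff mult.commute intro: dvdI[of _ _ "lead_coeff g"])
  qed
qed (auto simp: is_unit_poly_iff)

lemma degree_monom_plus_const: "n > 0 \<Longrightarrow> r \<noteq> 0 \<Longrightarrow> degree (monom r n + [:c:]) = n"
  by (simp add: degree_add_eq_left degree_monom_eq)

text \<open>Eisenstein's criterion at the prime \<open>t\<close>.\<close>

lemma irreducible_monom_plus_t:
  fixes c :: complex
  assumes n: "n > 0" and c: "c \<noteq> 0"
  shows "irreducible (monom 1 n + [:[:0, c:]:])"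
proof (rule irreducibleI)
  let ?f = "monom 1 n + [:[:0, c:]:]"
  have deg: "degree ?f = n"
    using n by (simp add: degree_monom_plus_const)
  show "?f \<noteq> 0"
    using deg n by auto
  show "\<not> is_unit ?f"
    using deg n by (metis is_unit_iff_degree is_unit_poly_iff degree_pCons_0 less_irrefl)
  fix g h assume gh: "?f = g * h"
  have nz: "g \<noteq> 0" "h \<noteq> 0"
    using gh \<open>?f \<noteq> 0\<close> by auto
  have dgh: "degree g + degree h = n"
    using degree_mult_eq[OF nz] gh deg by simp
  have "coeff ?f n = 1"
    using n by (cases n) auto
  then have lc: "lead_coeff g * lead_coeff h = 1"
    using lead_coeff_mult[of g h] gh deg by simp
  have unit: "is_unit g \<or> is_unit h" if "degree g = 0 \<or> degree h = 0"
    using that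
  proof
    assume "degree g = 0"
    then obtain d where "g = [:d:]"
      by (metis degree_eq_zeroE)
    then show ?thesis
      using lc by (auto simp: is_unit_const_poly_iff intro: dvdI[of _ _ "lead_coeff h"])
  next
    assume "degree h = 0"
    then obtain d where "h = [:d:]"
      by (metis degree_eq_zeroE)
    then show ?thesis
      using lc by (auto simp: is_unit_const_poly_iff mult.commute intro: dvdI[of _ _ "lead_coeff g"])
  qed
  \<comment> \<open>Over t = 0 the polynomial is u ^ n, so a nonconstant factor, which keeps its
    degree there, has 0 as its only root.\<close>
  have zero: "poly (coeff p 0) 0 = 0" if p: "degree p > 0" "poly (lead_coeff p) 0 \<noteq> 0" "p dvd ?f" for p
  proof -
    obtain u where u: "ev2 p 0 u = 0"
      by (rule slice_root[OF p(1,2)])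
    then have "ev2 ?f 0 u = 0"
      using p(3) by (auto elim!: dvdE simp del: ev2_simps(1))
    then have "u = 0"
      using n by simp
    then show ?thesis
      using u by (simp add: ev2_def poly_0_coeff_0)
  qed
  show "is_unit g \<or> is_unit h"
  proof (rule ccontr)
    assume "\<not> ?thesis"
    then have "degree g > 0" "degree h > 0"
      using unit by (meson gr0I)+
    moreover have "poly (lead_coeff g) 0 * poly (lead_coeff h) 0 = 1"
      using lc by (metis poly_1 poly_mult)
    then have "poly (lead_coeff g) 0 \<noteq> 0" "poly (lead_coeff h) 0 \<noteq> 0"
      by auto
    ultimately have "poly (coeff g 0) 0 = 0" "poly (coeff h 0) 0 = 0"
      using zero gh by auto
    then obtain g0 h0 where "coeff g 0 = [:0, 1:] * g0" "coeff h 0 = [:0, 1:] * h0"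
      by (auto simp: poly_eq_0_iff_dvd elim!: dvdE)
    moreover have "coeff g 0 * coeff h 0 = [:0, c:]"
      using n arg_cong[OF gh, of "\<lambda>p. coeff p 0"] by (simp add: coeff_mult)
    ultimately have "pCons 0 (pCons 0 (g0 * h0)) = [:0, c:]"
      by (simp add: mult.commute)
    then show False
      using c by simp
  qed
qed

lemma irreducible_minus:
  fixes p :: "'a::{idom, algebraic_semidom}"
  assumes "irreducible p"
  shows "irreducible (- p)"
proof (rule irreducibleI)
  fix a b assume "- p = a * b"
  then have "p = (- a) * b"
    by (simp add: minus_equation_iff[of p])
  then show "is_unit a \<or> is_unit b"
    using irreducibleD[OF assms, of "- a" b] by simp
qed (use assms in \<open>auto simp: irreducible_def\<close>)

text \<open>On the section \<open>u = t ^ k\<close> the equations of \<open>even_curve n\<close> and \<open>odd_curve n\<close> become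
  \<open>t ^ (n * k) = 2 * t\<close> and \<open>t ^ ((n - 1) * k + 1) = 1\<close>. These have simple roots only, so all
  intersections are visibly distinct; the factor 2 keeps the two curves different for \<open>n = k = 1\<close>.\<close>

definition even_curve :: "nat \<Rightarrow> complex poly poly" where
  "even_curve n = monom (monom 1 0) n + monom (monom (- 2) 1) 0"

definition odd_curve :: "nat \<Rightarrow> complex poly poly" where
  "odd_curve n = monom (monom 1 1) (n - 1) + monom (monom (- 1) 0) 0"

definition section_curve :: "nat \<Rightarrow> complex poly poly" where
  "section_curve k = monom (monom 1 0) 1 + monom (monom (- 1) k) 0"

text \<open>Every zero lies on an affine line along which f is exactly linear with nonzero slope.
  Such lines serve as test curves crossing the curve to first order, so no smoothness theory is
  needed for the explicit equations.\<close>

definition transversal :: "complex poly poly \<Rightarrow> bool" where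
  "transversal f \<longleftrightarrow> (\<forall>t u. ev2 f t u = 0 \<longrightarrow>
     (\<exists>\<alpha> \<beta> c. c \<noteq> 0 \<and> (\<forall>s. ev2 f (t + \<alpha> * s) (u + \<beta> * s) = c * s)))"

text \<open>The last clause says that a is the exact total degree, so that (a, m) is really the
  class of the closure and no copy of \<open>fibre 0 1\<close> is hidden in
  \<open>hat a m f\<close>.\<close>

definition good_equation :: "nat \<Rightarrow> nat \<Rightarrow> complex poly poly \<Rightarrow> bool" where
  "good_equation a m f \<longleftrightarrow> cls a m f \<and> irreducible f \<and> degree f = m \<and> m > 0 \<and>
     (\<exists>k\<le>a. coeff (coeff f k) (a - k) \<noteq> 0)"

lemma monom_1_X: "monom c (Suc 0) = [:0, c:]"
  by (simp add: monom_Suc monom_0)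

lemma even_curve_eq: "even_curve n = monom 1 n + [:[:0, -2:]:]"
  by (simp add: even_curve_def monom_0 monom_1_X one_pCons)

lemma ev2_even_curve: "ev2 (even_curve n) t u = u ^ n - 2 * t"
  by (simp add: even_curve_eq)

lemma good_even_curve: "n > 0 \<Longrightarrow> good_equation n n (even_curve n)"
  unfolding good_equation_def
proof (intro conjI exI[of _ n])
  assume n: "n > 0"
  show "cls n n (even_curve n)"
    unfolding even_curve_def using n by (intro cls_add cls_monom) auto
  show "irreducible (even_curve n)"
    unfolding even_curve_eq by (rule irreducible_monom_plus_t[OF n]) simp
  show "degree (even_curve n) = n"
    unfolding even_curve_eq using n by (simp add: degree_monom_plus_const)
  show "coeff (coeff (even_curve n) n) (n - n) \<noteq> 0"
    using n by (cases n) (auto simp: even_curve_eq)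
qed auto

lemma transversal_even_curve: "transversal (even_curve n)"
  unfolding transversal_def ev2_even_curve
  by (intro allI impI exI[of _ 1] exI[of _ 0] exI[of _ "-2"]) (simp add: algebra_simps)

lemma hat_even_curve: "n > 0 \<Longrightarrow> hat n n (even_curve n) x y z e = z ^ n - 2 * x ^ (n - 1) * y * e ^ n"
  unfolding even_curve_def hat_add by (subst (1 2) hat_monom) auto

lemma odd_curve_eq: "odd_curve n = monom [:0, 1:] (n - 1) + [:- 1:]"
  by (simp add: odd_curve_def monom_0 monom_1_X one_pCons)

lemma ev2_odd_curve: "ev2 (odd_curve n) t u = t * u ^ (n - 1) - 1"
  by (simp add: odd_curve_eq)

text \<open>Reversing the coefficients in u turns t u ^ (n - 1) - 1 into t - u ^ (n - 1), which is
  Eisenstein up to sign. Reversal is multiplicative, and it reflects units as long as the constant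
  coefficient is nonzero.\<close>

lemma irreducible_odd_curve:
  assumes n: "n > 1"
  shows "irreducible (odd_curve n)"
proof (rule irreducibleI)
  let ?f = "odd_curve n"
  have deg: "degree ?f = n - 1"
    unfolding odd_curve_eq using n by (simp add: degree_monom_plus_const)
  then show "?f \<noteq> 0"
    using n by auto
  show "\<not> is_unit ?f"
    using deg n by (metis is_unit_poly_iff degree_pCons_0 less_irrefl zero_less_diff)
  have co: "coeff ?f 0 = - 1"
    using n by (simp add: odd_curve_eq)
  have refl: "reflect_poly ?f = - (monom 1 (n - 1) + [:[:0, - 1:]:])"
  proof (rule poly_eqI)
    fix k
    have 1: "coeff ?f i = (if i = n - 1 then [:0, 1:] else if i = 0 then - 1 else 0)" for i
      using n by (cases i) (auto simp: odd_curve_eq)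
    have 2: "coeff (- (monom 1 (n - 1) + [:[:0, - 1:]:])) k = (if k = n - 1 then - 1 else if k = 0 then [:0, 1:] else 0)"
      using n by (cases k) auto
    show "coeff (reflect_poly ?f) k = coeff (- (monom 1 (n - 1) + [:[:0, - 1:]:])) k"
      unfolding coeff_reflect_poly deg 1 2 using n by (cases "k = n - 1"; cases "k = 0") auto
  qed
  have irr: "irreducible (reflect_poly ?f)"
    unfolding refl using n by (intro irreducible_minus irreducible_monom_plus_t) auto
  fix g h assume gh: "?f = g * h"
  then have "coeff g 0 * coeff h 0 = - 1"
    using co by (simp add: coeff_mult)
  then have g0: "coeff g 0 \<noteq> 0" and h0: "coeff h 0 \<noteq> 0"
    by auto
  have unit: "is_unit p" if p: "is_unit (reflect_poly p)" "coeff p 0 \<noteq> 0" for p :: "complex poly poly"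
  proof -
    have "degree p = 0"
      using p by (metis is_unit_poly_iff degree_pCons_0 degree_reflect_poly_eq)
    then show ?thesis
      using p(1) by (metis degree_eq_zeroE reflect_poly_const)
  qed
  have "reflect_poly ?f = reflect_poly g * reflect_poly h"
    unfolding gh by (rule reflect_poly_mult)
  then show "is_unit g \<or> is_unit h"
    using irreducibleD[OF irr] unit g0 h0 by blast
qed

lemma good_odd_curve: "n > 1 \<Longrightarrow> good_equation n (n - 1) (odd_curve n)"
  unfolding good_equation_def
proof (intro conjI exI[of _ "n - 1"])
  assume n: "n > 1"
  show "cls n (n - 1) (odd_curve n)"
    unfolding odd_curve_def using n by (intro cls_add cls_monom) auto
  show "irreducible (odd_curve n)"
    by (rule irreducible_odd_curve[OF n])
  show "degree (odd_curve n) = n - 1"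
    unfolding odd_curve_eq using n by (simp add: degree_monom_plus_const)
  have "n - (n - 1) = Suc 0"
    using n by simp
  then show "coeff (coeff (odd_curve n) (n - 1)) (n - (n - 1)) \<noteq> 0"
    using n by (auto simp: odd_curve_eq coeff_pCons split: nat.splits)
qed auto

lemma transversal_odd_curve: "transversal (odd_curve n)"
  unfolding transversal_def ev2_odd_curve
proof (intro allI impI)
  fix t u :: complex assume 0: "t * u ^ (n - 1) - 1 = 0"
  then have "u ^ (n - 1) \<noteq> 0"
    by (cases "u ^ (n - 1) = 0") (auto simp del: power_eq_0_iff)
  then show "\<exists>\<alpha> \<beta> c. c \<noteq> 0 \<and> (\<forall>s. (t + \<alpha> * s) * (u + \<beta> * s) ^ (n - 1) - 1 = c * s)"
    using 0 by (intro exI[of _ 1] exI[of _ 0] exI[of _ "u ^ (n - 1)"]) (simp add: algebra_simps)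
qed

lemma hat_odd_curve: "n > 1 \<Longrightarrow> hat n (n - 1) (odd_curve n) x y z e = y * z ^ (n - 1) - x ^ n * e ^ (n - 1)"
  unfolding odd_curve_def hat_add by (subst (1 2) hat_monom) auto

lemma section_curve_eq: "section_curve k = [:- monom 1 k, 1:]"
  by (simp add: section_curve_def monom_0 monom_1_X one_pCons minus_monom)

lemma ev2_section_curve: "ev2 (section_curve k) t u = u - t ^ k"
  by (simp add: section_curve_eq poly_monom)

lemma good_section_curve: "k > 0 \<Longrightarrow> good_equation k 1 (section_curve k)"
  unfolding good_equation_def
proof (intro conjI exI[of _ 0])
  assume k: "k > 0"
  show "cls k 1 (section_curve k)"
    unfolding section_curve_def using k by (intro cls_add cls_monom) auto
  show "irreducible (section_curve k)"
    unfolding section_curve_eq by (rule irreducible_monic_linear)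
  show "degree (section_curve k) = 1"
    by (simp add: section_curve_eq)
  show "coeff (coeff (section_curve k) 0) (k - 0) \<noteq> 0"
    by (simp add: section_curve_eq)
qed auto

lemma transversal_section_curve: "transversal (section_curve k)"
  unfolding transversal_def ev2_section_curve
  by (intro allI impI exI[of _ 0] exI[of _ 1]) (simp add: algebra_simps)

lemma hat_section_curve: "k > 0 \<Longrightarrow> hat k 1 (section_curve k) x y z e = x ^ (k - 1) * z - y ^ k * e"
  unfolding section_curve_def hat_add by (subst (1 2) hat_monom) auto

text \<open>The chart equation of a line in the plane not through P. These represent h in
  \<open>has_class\<close>.\<close>

lemma good_line: "good_equation 1 1 [:[:c, d:], 1:]" and transversal_line: "transversal [:[:c, d:], 1:]"
proof -
  show "good_equation 1 1 [:[:c, d:], 1:]"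
    unfolding good_equation_def
    by (intro conjI irreducible_monic_linear exI[of _ 1])
       (auto simp: cls_def coeff_pCons one_pCons split: nat.splits)
  show "transversal [:[:c, d:], 1:]"
    unfolding transversal_def
    by (intro allI impI exI[of _ 0] exI[of _ 1]) (simp add: algebra_simps)
qed

context scroll
begin

lemma good_curve_degree: "good_equation a m f \<Longrightarrow> has_degree (curve f) (a + m)"
  by (rule curve_has_degree) (auto simp: good_equation_def)

lemma good_curve_on: "good_equation a m f \<Longrightarrow> curve_on S (curve f)"
  by (rule curve_on_curve) (auto simp: good_equation_def)

lemma curve_hat_zero:
  assumes "good_equation a m f" "valid x y z e" "pt (\<Phi> x y z e) \<in> curve f"
  shows "hat a m f x y z e = 0"
  using assms hat_zero_on_curve by (auto simp: good_equation_def)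

lemma section_intersection:
  assumes noE: "\<And>x y. x \<noteq> 0 \<or> y \<noteq> 0 \<Longrightarrow> pt (\<Phi> x y 1 0) \<notin> curve f \<inter> curve (section_curve k)"
    and no01: "\<And>z e. z \<noteq> 0 \<or> e \<noteq> 0 \<Longrightarrow> pt (\<Phi> 0 1 z e) \<notin> curve f \<inter> curve (section_curve k)"
  shows "curve f \<inter> curve (section_curve k) = (\<lambda>t. upt t (t ^ k)) ` {t. ev2 f t (t ^ k) = 0}"
proof (intro equalityI subsetI)
  fix p assume p: "p \<in> curve f \<inter> curve (section_curve k)"
  then have "p \<in> S"
    using curve_subset by blast
  then obtain t u where tu: "p = upt t u"
    by (cases rule: S_cases) (use p noE no01 in \<open>auto simp: Exc_def fibre_def\<close>)
  have "ev2 f t u = 0"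
    using p tu by (simp add: upt_in_curve)
  moreover have "u = t ^ k"
    using p tu by (simp add: upt_in_curve ev2_section_curve)
  ultimately show "p \<in> (\<lambda>t. upt t (t ^ k)) ` {t. ev2 f t (t ^ k) = 0}"
    using tu by auto
next
  fix p assume "p \<in> (\<lambda>t. upt t (t ^ k)) ` {t. ev2 f t (t ^ k) = 0}"
  then show "p \<in> curve f \<inter> curve (section_curve k)"
    by (auto simp: upt_in_curve ev2_section_curve)
qed

lemma card_section_intersection:
  assumes "curve f \<inter> curve (section_curve k) = (\<lambda>t. upt t (t ^ k)) ` {t. ev2 f t (t ^ k) = 0}"
    and "finite {t. ev2 f t (t ^ k) = 0}"
  shows "finite (curve f \<inter> curve (section_curve k))"
    "card (curve f \<inter> curve (section_curve k)) = card {t. ev2 f t (t ^ k) = 0}"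
  unfolding assms(1) using assms(2) by (auto simp: card_image inj_on_def upt_inject)

lemma even_section_intersection:
  assumes n: "n > 0" and k: "k > 0"
  shows "finite (curve (even_curve n) \<inter> curve (section_curve k))"
    "card (curve (even_curve n) \<inter> curve (section_curve k)) = n * k"
proof -
  have eq: "curve (even_curve n) \<inter> curve (section_curve k)
      = (\<lambda>t. upt t (t ^ k)) ` {t. ev2 (even_curve n) t (t ^ k) = 0}"
  proof (rule section_intersection)
    fix x y :: complex assume "x \<noteq> 0 \<or> y \<noteq> 0"
    then have "valid x y 1 0"
      by (simp add: valid_def)
    from curve_hat_zero[OF good_even_curve[OF n] this]
    show "pt (\<Phi> x y 1 0) \<notin> curve (even_curve n) \<inter> curve (section_curve k)"
      using n by (auto simp: hat_even_curve power_0_left)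
  next
    fix z e :: complex assume ze: "z \<noteq> 0 \<or> e \<noteq> 0"
    then have v: "valid 0 1 z e"
      by (simp add: valid_def)
    show "pt (\<Phi> 0 1 z e) \<notin> curve (even_curve n) \<inter> curve (section_curve k)"
    proof
      assume "pt (\<Phi> 0 1 z e) \<in> curve (even_curve n) \<inter> curve (section_curve k)"
      then have "z ^ n - 2 * 0 ^ (n - 1) * e ^ n = 0" "0 ^ (k - 1) * z - e = 0"
        using curve_hat_zero[OF good_even_curve[OF n] v, unfolded hat_even_curve[OF n]]
          curve_hat_zero[OF good_section_curve[OF k] v, unfolded hat_section_curve[OF k]] by auto
      then show False
        using ze n k by (cases "k = 1"; cases "n = 1") (auto simp: power_0_left)
    qed
  qed
  let ?R = "{t :: complex. ev2 (even_curve n) t (t ^ k) = 0}"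
  have R: "?R = {t. t ^ (n * k) = 2 * t}"
    by (simp add: ev2_even_curve mult.commute flip: power_mult)
  have "finite ?R \<and> card ?R = n * k"
  proof (cases "n * k = 1")
    case True
    then have "?R = {0}"
      unfolding R by auto
    then show ?thesis
      using True by simp
  next
    case False
    then obtain j where j: "n * k = Suc j" "j > 0"
      using n k by (metis gr0_conv_Suc nat_0_less_mult_iff not_gr_zero One_nat_def)
    \<comment> \<open>Besides t = 0 there are the nk - 1 roots of t ^ (nk - 1) = 2, in total
      nk.\<close>
    have "?R = insert 0 {t. t ^ j = 2}"
      unfolding R j(1) using j(2) by (auto simp: power_0_left)
    moreover have "finite {t :: complex. t ^ j = 2}" "card {t :: complex. t ^ j = 2} = j"
      using card_nth_roots[of 2 j] j(2) by (auto intro: card_ge_0_finite)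
    moreover have "(0 :: complex) \<notin> {t. t ^ j = 2}"
      using j(2) by (simp add: power_0_left)
    ultimately show ?thesis
      using j(1) by simp
  qed
  then show "finite (curve (even_curve n) \<inter> curve (section_curve k))"
    "card (curve (even_curve n) \<inter> curve (section_curve k)) = n * k"
    using card_section_intersection[OF eq] by auto
qed

lemma odd_section_intersection:
  assumes n: "n > 1" and k: "k > 1"
  shows "finite (curve (odd_curve n) \<inter> curve (section_curve k))"
    "card (curve (odd_curve n) \<inter> curve (section_curve k)) = (n - 1) * k + 1"
proof -
  have k0: "k > 0"
    using k by simp
  have eq: "curve (odd_curve n) \<inter> curve (section_curve k)
      = (\<lambda>t. upt t (t ^ k)) ` {t. ev2 (odd_curve n) t (t ^ k) = 0}"
  proof (rule section_intersection)
    fix x y :: complex assume xy: "x \<noteq> 0 \<or> y \<noteq> 0"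
    then have v: "valid x y 1 0"
      by (simp add: valid_def)
    show "pt (\<Phi> x y 1 0) \<notin> curve (odd_curve n) \<inter> curve (section_curve k)"
    proof
      assume "pt (\<Phi> x y 1 0) \<in> curve (odd_curve n) \<inter> curve (section_curve k)"
      then have "y - x ^ n * 0 ^ (n - 1) = 0" "x ^ (k - 1) = 0"
        using curve_hat_zero[OF good_odd_curve[OF n] v, unfolded hat_odd_curve[OF n]]
          curve_hat_zero[OF good_section_curve[OF k0] v, unfolded hat_section_curve[OF k0]] by auto
      then show False
        using xy n k by (auto simp: power_0_left)
    qed
  next
    fix z e :: complex assume ze: "z \<noteq> 0 \<or> e \<noteq> 0"
    then have v: "valid 0 1 z e"
      by (simp add: valid_def)
    show "pt (\<Phi> 0 1 z e) \<notin> curve (odd_curve n) \<inter> curve (section_curve k)"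
    proof
      assume "pt (\<Phi> 0 1 z e) \<in> curve (odd_curve n) \<inter> curve (section_curve k)"
      then have "z ^ (n - 1) - 0 ^ n * e ^ (n - 1) = 0" "0 ^ (k - 1) * z - e = 0"
        using curve_hat_zero[OF good_odd_curve[OF n] v, unfolded hat_odd_curve[OF n]]
          curve_hat_zero[OF good_section_curve[OF k0] v, unfolded hat_section_curve[OF k0]] by auto
      then show False
        using ze n k by (auto simp: power_0_left)
    qed
  qed
  let ?R = "{t :: complex. ev2 (odd_curve n) t (t ^ k) = 0}"
  have R: "?R = {t. t ^ ((n - 1) * k + 1) = 1}"
    by (simp add: ev2_odd_curve mult.commute flip: power_mult)
  have "card ?R = (n - 1) * k + 1"
    unfolding R by (rule card_nth_roots) auto
  moreover from this have "finite ?R"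
    by (intro card_ge_0_finite) simp
  ultimately show "finite (curve (odd_curve n) \<inter> curve (section_curve k))"
    "card (curve (odd_curve n) \<inter> curve (section_curve k)) = (n - 1) * k + 1"
    using card_section_intersection[OF eq] by auto
qed

end

section \<open>Orders of vanishing\<close>

text \<open>Functions in the ideal pull back to polynomials with root 0, so each factor of the power
  contributes one factor s.\<close>

lemma ideal_pow_along:
  fixes C :: "('n::finite) proj set" and \<gamma> :: "complex \<Rightarrow> complex ^ 'n"
  assumes \<gamma>: "\<And>i. \<exists>p. \<forall>s. \<gamma> s $ i = poly p s" and 0: "\<And>A. A \<in> ideal_of C \<Longrightarrow> A (\<gamma> 0) = 0"
    and A: "A \<in> ideal_pow polys (ideal_of C) n"
  shows "\<exists>r. \<forall>s. A (\<gamma> s) = s ^ n * poly r s"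
  using A
proof (induction n arbitrary: A)
  case 0
  then show ?case
    using polys_along[of A \<gamma>] \<gamma> by auto
next
  case (Suc n)
  then obtain k :: nat and f g where A: "A = (\<lambda>x. \<Sum>i<k. f i x * g i x)"
      and fg: "\<forall>i<k. f i \<in> ideal_of C \<and> g i \<in> ideal_pow polys (ideal_of C) n"
    by auto
  have "\<exists>r. \<forall>s. f i (\<gamma> s) * g i (\<gamma> s) = s ^ Suc n * poly r s" if "i < k" for i
  proof -
    have fi: "f i \<in> ideal_of C" "f i \<in> polys"
      using fg that by (auto simp: ideal_of_def)
    obtain p where p: "\<forall>s. f i (\<gamma> s) = poly p s"
      using polys_along[OF fi(2) \<gamma>] by blast
    have "poly p 0 = 0"
      using 0[OF fi(1)] p by metis
    then obtain p' where p': "p = [:0, 1:] * p'"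
      by (auto simp: poly_eq_0_iff_dvd elim: dvdE)
    have "g i \<in> ideal_pow polys (ideal_of C) n"
      using fg that by blast
    then obtain r where "\<forall>s. g i (\<gamma> s) = s ^ n * poly r s"
      using Suc.IH by blast
    then have "\<forall>s. f i (\<gamma> s) * g i (\<gamma> s) = s ^ Suc n * poly (p' * r) s"
      using p by (simp add: p')
    then show ?thesis
      by blast
  qed
  then obtain r where r: "\<forall>i<k. \<forall>s. f i (\<gamma> s) * g i (\<gamma> s) = s ^ Suc n * poly (r i) s"
    by metis
  have "A (\<gamma> s) = s ^ Suc n * poly (\<Sum>i<k. r i) s" for s
    unfolding A poly_sum sum_distrib_left by (intro sum.cong) (use r in auto)
  then show ?case
    by blast
qed

lemma ideal_pow_mult_power:
  assumes "f \<in> I" "g \<in> R"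
  shows "(\<lambda>x. f x ^ n * g x) \<in> ideal_pow R I n"
proof (induction n)
  case (Suc n)
  have "(\<lambda>x. f x ^ Suc n * g x) = (\<lambda>x. \<Sum>i<Suc 0. f x * (f x ^ n * g x))"
    by (simp add: mult.assoc)
  then show ?case
    using Suc assms(1) unfolding ideal_pow.simps
    by (intro CollectI exI[of _ "Suc 0"] exI[of _ "\<lambda>_. f"] exI[of _ "\<lambda>_ x. f x ^ n * g x"]) auto
qed (use assms in simp)

text \<open>The order is bounded above by restricting to a test curve \<open>\<gamma>\<close> in the cone over \<open>S\<close> which
  crosses the cone over \<open>C\<close> at \<open>\<gamma> 0\<close>: the ideal of \<open>C\<close> restricts to multiples of \<open>s\<close>.\<close>

lemma vanishing_orderI:
  fixes C :: "('n::finite) proj set"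
  assumes lower: "\<exists>G\<in>polys - ideal_of C. \<exists>A\<in>ideal_pow polys (ideal_of C) N. \<exists>K\<in>ideal_of S. \<forall>x. G x * F x = A x + K x"
    and upper: "\<And>G. G \<in> polys - ideal_of C \<Longrightarrow> \<exists>\<gamma> g. (\<forall>i. \<exists>p. \<forall>s. \<gamma> s $ i = poly p s) \<and>
      (\<forall>s. \<forall>K\<in>ideal_of S. K (\<gamma> s) = 0) \<and> (\<forall>A\<in>ideal_of C. A (\<gamma> 0) = 0) \<and> G (\<gamma> 0) \<noteq> 0 \<and>
      continuous_on UNIV g \<and> g 0 \<noteq> 0 \<and> (\<forall>s. F (\<gamma> s) = s ^ N * g s)"
  shows "vanishing_order S C F = N"
  unfolding vanishing_order_def
proof (rule Greatest_equality)
  show "\<exists>G\<in>polys - ideal_of C. \<exists>A\<in>ideal_pow polys (ideal_of C) N. \<exists>K\<in>ideal_of S. \<forall>x. G x * F x = A x + K x"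
    by (rule lower)
next
  fix n assume "\<exists>G\<in>polys - ideal_of C. \<exists>A\<in>ideal_pow polys (ideal_of C) n. \<exists>K\<in>ideal_of S. \<forall>x. G x * F x = A x + K x"
  then obtain G A K where G: "G \<in> polys - ideal_of C" and A: "A \<in> ideal_pow polys (ideal_of C) n"
      and K: "K \<in> ideal_of S" and eq: "\<forall>x. G x * F x = A x + K x"
    by blast
  obtain \<gamma> g where \<gamma>: "\<forall>i. \<exists>p. \<forall>s. \<gamma> s $ i = poly p s" and \<gamma>S: "\<forall>s. \<forall>K\<in>ideal_of S. K (\<gamma> s) = 0"
      and \<gamma>C: "\<forall>A\<in>ideal_of C. A (\<gamma> 0) = 0" and G0: "G (\<gamma> 0) \<noteq> 0"
      and g: "continuous_on UNIV g" "g 0 \<noteq> 0" and F: "\<forall>s. F (\<gamma> s) = s ^ N * g s"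
    using upper[OF G] by blast
  obtain r where r: "\<forall>s. A (\<gamma> s) = s ^ n * poly r s"
    using ideal_pow_along[of \<gamma> C A n] \<gamma> \<gamma>C A by blast
  obtain pG where pG: "\<forall>s. G (\<gamma> s) = poly pG s"
    using polys_along[of G \<gamma>] G \<gamma> by blast
  show "n \<le> N"
  proof (rule ccontr)
    assume "\<not> n \<le> N"
    then obtain d where d: "n = N + Suc d"
      by (metis add_Suc_right less_iff_Suc_add not_le)
    have eq': "poly pG s * g s = s ^ Suc d * poly r s" if "s \<noteq> 0" for s
    proof -
      have "poly pG s * (s ^ N * g s) = s ^ n * poly r s"
        using eq \<gamma>S K r F pG by (metis add_0_right)
      then have "s ^ N * (poly pG s * g s) = s ^ N * (s ^ Suc d * poly r s)"
        unfolding d by (simp add: power_add algebra_simps)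
      then show ?thesis
        using that by simp
    qed
    \<comment> \<open>After cancelling s ^ N the identity extends to s = 0, where the left side is
      nonzero and the right side is zero.\<close>
    have "continuous_on UNIV (\<lambda>s. poly pG s * g s)" "continuous_on UNIV (\<lambda>s. s ^ Suc d * poly r s)"
      by (intro continuous_intros g)+
    from continuous_eq_at_0[OF this eq', of 0] show False
      using G0 g(2) pG by simp
  qed
qed

lemma not_vanishes_scale:
  assumes "G \<in> polys" "\<not> vanishes G (pt v)" "v \<noteq> 0"
  obtains c where "c \<noteq> 0" "G (c *s v) \<noteq> 0"
proof -
  obtain c0 where "G (c0 *s v) \<noteq> 0"
    using assms by (auto simp: vanishes_pt)
  have "\<exists>c. c \<noteq> 0 \<and> G (c *s v) \<noteq> 0"
  proof (rule ccontr)
    assume "\<not> ?thesis"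
    then have 0: "G (c *s v) = 0" if "c \<noteq> 0" for c
      using that by blast
    have "continuous_on UNIV (\<lambda>c. G (c *s v))"
      by (intro continuous_intros assms(1))
    from continuous_eq_at_0[OF this continuous_on_const 0] show False
      using \<open>G (c0 *s v) \<noteq> 0\<close> by blast
  qed
  then show ?thesis
    using that by blast
qed

text \<open>A representation with n > 0 would make G F vanish on the irreducible C, although neither
  factor does.\<close>

lemma vanishing_order_0:
  fixes C :: "('n::finite) proj set"
  assumes C: "variety C" "C \<subseteq> S" and F: "hom_poly D F" and nv: "\<not> C \<subseteq> {p. vanishes F p}"
  shows "vanishing_order S C F = 0"
  unfolding vanishing_order_def
proof (rule Greatest_equality)
  obtain p where "p \<in> C"
    using C by (auto simp: variety_def)
  moreover have "\<not> vanishes (\<lambda>_. 1) p"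
    by (metis hom_poly_const pt_cases vanishes_hom zero_neq_one)
  ultimately have "(\<lambda>_. 1) \<in> polys - ideal_of C"
    by (auto simp: ideal_of_def polys_def poly_alg.const)
  moreover have "(\<lambda>_. 0) \<in> ideal_of S"
    by (auto simp: ideal_of_def vanishes_def polys_def poly_alg.const)
  ultimately show "\<exists>G\<in>polys - ideal_of C. \<exists>A\<in>ideal_pow polys (ideal_of C) 0. \<exists>K\<in>ideal_of S. \<forall>x. G x * F x = A x + K x"
    using hom_polyD(1)[OF F] by (intro bexI[of _ "\<lambda>_. 1"] bexI[of _ F] bexI[of _ "\<lambda>_. 0"]) auto
next
  fix n assume "\<exists>G\<in>polys - ideal_of C. \<exists>A\<in>ideal_pow polys (ideal_of C) n. \<exists>K\<in>ideal_of S. \<forall>x. G x * F x = A x + K x"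
  then obtain G A K where G: "G \<in> polys" "G \<notin> ideal_of C" and A: "A \<in> ideal_pow polys (ideal_of C) n"
      and K: "K \<in> ideal_of S" and eq: "\<forall>x. G x * F x = A x + K x"
    by blast
  show "n \<le> 0"
  proof (rule ccontr)
    assume "\<not> n \<le> 0"
    then obtain n' where n': "n = Suc n'"
      by (cases n) auto
    obtain k :: nat and f g where A': "A = (\<lambda>x. \<Sum>i<k. f i x * g i x)" and fg: "\<forall>i<k. f i \<in> ideal_of C"
      using A unfolding n' by auto
    have "vanishes (\<lambda>v. G v * F v) p" if p: "p \<in> C" for p
    proof -
      have "f i v = 0" if "i < k" "v \<in> lin p" for i v
        using fg that p by (auto simp: ideal_of_def vanishes_def)
      then have "A v = 0" if "v \<in> lin p" for v
        unfolding A' using that by (intro sum.neutral) auto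
      moreover have "K v = 0" if "v \<in> lin p" for v
        using K that p C(2) by (auto simp: ideal_of_def vanishes_def)
      ultimately show ?thesis
        unfolding vanishes_def using eq by simp
    qed
    then have "C \<subseteq> {p. vanishes F p} \<union> {p. vanishes G p}"
      using vanishes_mult[OF F G(1)] by auto
    then have "C \<subseteq> {p. vanishes G p}"
      using variety_subset_Un[OF C(1) proj_closed_form[OF F] proj_closed_vanishes[OF G(1)]] nv by blast
    then show False
      using G by (auto simp: ideal_of_def)
  qed
qed

context scroll
begin

lemma \<Phi>_component_poly:
  assumes "\<exists>p. \<forall>s. x s = poly p s" "\<exists>p. \<forall>s. y s = poly p s" "\<exists>p. \<forall>s. z s = poly p s" "\<exists>p. \<forall>s. e s = poly p s"
  shows "\<exists>p. \<forall>s::complex. (c *s \<Phi> (x s) (y s) (z s) (e s)) $ i = poly p s"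
proof -
  obtain p1 p2 p3 p4 where p: "\<forall>s. x s = poly p1 s" "\<forall>s. y s = poly p2 s" "\<forall>s. z s = poly p3 s" "\<forall>s. e s = poly p4 s"
    using assms by blast
  show ?thesis
    by (intro exI[of _ "smult c (smult (M 0 $ i) (p1 ^ 2 * p4) + smult (M 1 $ i) (p1 * p2 * p4) + smult (M 2 $ i) (p2 ^ 2 * p4)
          + smult (M 3 $ i) (p1 * p3) + smult (M 4 $ i) (p2 * p3))"])
       (simp add: p scroll_map_def algebra_simps)
qed

lemma ideal_of_S_\<Phi>:
  assumes "K \<in> ideal_of S" "valid x y z e"
  shows "K (c *s \<Phi> x y z e) = 0"
  using assms pt_\<Phi>_in_S[OF assms(2)] vanishes_pt[OF \<Phi>_nonzero[OF assms(2)], of K] by (auto simp: ideal_of_def)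

lemma ideal_of_\<Phi>:
  assumes "A \<in> ideal_of C" "valid x y z e" "pt (\<Phi> x y z e) \<in> C"
  shows "A (c *s \<Phi> x y z e) = 0"
  using assms vanishes_pt[OF \<Phi>_nonzero[OF assms(2)], of A] by (auto simp: ideal_of_def)

text \<open>An identity G F = H ^ n K on the chart, with equal degrees on both sides, holds modulo
  the ideal of S, since the difference is a form vanishing on a dense part of S.\<close>

lemma vanishing_order_lower:
  assumes F: "hom_poly D F" and G: "hom_poly d G" "\<exists>p\<in>C. \<not> vanishes G p" and H: "hom_poly h H" "\<forall>p\<in>C. vanishes H p"
    and K: "hom_poly k K" and deg: "d + D = n * h + k" and eq: "dehom G * dehom F = dehom H ^ n * dehom K"
  shows "\<exists>G\<in>polys - ideal_of C. \<exists>A\<in>ideal_pow polys (ideal_of C) n. \<exists>K\<in>ideal_of S. \<forall>x. G x * F x = A x + K x"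
proof (intro bexI)
  let ?A = "\<lambda>x. H x ^ n * K x"
  show "\<forall>x. G x * F x = ?A x + (G x * F x - ?A x)"
    by simp
  show "G \<in> polys - ideal_of C"
    using G hom_polyD(1) by (auto simp: ideal_of_def)
  show "?A \<in> ideal_pow polys (ideal_of C) n"
    using H K hom_polyD(1) by (intro ideal_pow_mult_power) (auto simp: ideal_of_def)
  have GF: "hom_poly (d + D) (\<lambda>x. G x * F x)"
    by (intro hom_poly_mult G F)
  have A: "hom_poly (d + D) ?A"
    unfolding deg by (intro hom_poly_mult hom_poly_power H K)
  have diff: "hom_poly (d + D) (\<lambda>x. G x * F x - ?A x)"
    using GF A by (rule hom_poly_diff)
  have "dehom (\<lambda>x. G x * F x - ?A x) = 0"
  proof (rule dehom_eqI[OF hom_polyD(1)[OF diff]])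
    fix t u
    have "ev2 (dehom G * dehom F) t u = ev2 (dehom H ^ n * dehom K) t u"
      by (simp only: eq)
    then show "G (\<Phi> 1 t u 1) * F (\<Phi> 1 t u 1) - H (\<Phi> 1 t u 1) ^ n * K (\<Phi> 1 t u 1) = ev2 0 t u"
      using F G H K by (simp add: dehom hom_polyD(1))
  qed
  then show "(\<lambda>x. G x * F x - ?A x) \<in> ideal_of S"
    using form_on_S[OF diff] hom_polyD(1)[OF diff] by (simp add: ideal_of_def)
qed

lemma order_on_curve:
  assumes f: "good_equation a m f" and tr: "transversal f" and F: "hom_poly D F" "dehom F = f ^ j"
  shows "vanishing_order S (curve f) F = j"
proof (rule vanishing_orderI)
  obtain h H where H: "hom_poly h H" "dehom H = f"
    by (rule dehom_surj)
  have irr: "irreducible f" "degree f > 0"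
    using f by (auto simp: good_equation_def)
  obtain t0 u0 where tu0: "ev2 f t0 u0 = 0"
    using zero_off_finite[OF irr(2) finite.emptyI] by blast
  have nz: "hom_poly (i * 1) (\<lambda>v. X 0 v ^ i)" "\<not> vanishes (\<lambda>v. X 0 v ^ i) (upt t u)"
    "dehom (\<lambda>v. X 0 v ^ i) = 1" for i t u
    using hom_poly_power[OF hom_poly_X] vanishes_upt[OF hom_poly_power[OF hom_poly_X]] dehom_power[OF dot_polys]
    by (auto simp: dehom_X)
  show "\<exists>G\<in>polys - ideal_of (curve f). \<exists>A\<in>ideal_pow polys (ideal_of (curve f)) j. \<exists>K\<in>ideal_of S. \<forall>x. G x * F x = A x + K x"
  \<comment> \<open>Powers of \<open>X 0\<close>, which is 1 on the chart, equalise the degrees in F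
    = H ^ j.\<close>
  proof (rule vanishing_order_lower[OF F(1) nz(1)[of "j * h"] _ H(1) _ nz(1)[of D]])
    show "\<exists>p\<in>curve f. \<not> vanishes (\<lambda>v. X 0 v ^ (j * h)) p"
      using nz(2) tu0 upt_in_curve by blast
    show "\<forall>p\<in>curve f. vanishes H p"
      using H by (auto simp: curve_def)
  qed (use F(2) H(2) nz(3) in auto)
next
  fix G assume G: "G \<in> polys - ideal_of (curve f)"
  have irr: "irreducible f" "degree f > 0"
    using f by (auto simp: good_equation_def)
  \<comment> \<open>The test curve must start where the given denominator is nonzero. The chart part
    is dense, so such a point exists there.\<close>
  have "\<exists>t u. upt t u \<in> curve f \<and> \<not> vanishes G (upt t u)"
  proof (rule ccontr)
    assume "\<not> ?thesis"
    moreover obtain t0 u0 where "ev2 f t0 u0 = 0"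
      using zero_off_finite[OF irr(2) finite.emptyI] by blast
    then have "\<not> curve f \<subseteq> {p. vanishes (X 0) p}"
      using upt_in_curve upt_iff upt_in_S by blast
    ultimately have "\<forall>p\<in>curve f. vanishes G p"
      using vanishes_from_chart[OF curve_variety[OF irr] curve_subset] G by blast
    then show False
      using G by (auto simp: ideal_of_def)
  qed
  then obtain t u where tu: "ev2 f t u = 0" "\<not> vanishes G (upt t u)"
    using upt_in_curve by blast
  then obtain c where c: "c \<noteq> 0" "G (c *s \<Phi> 1 t u 1) \<noteq> 0"
    using not_vanishes_scale[of G "\<Phi> 1 t u 1"] G unfolding upt_def by (auto simp: \<Phi>_nonzero)
  obtain \<alpha> \<beta> k where k: "k \<noteq> 0" "\<forall>s. ev2 f (t + \<alpha> * s) (u + \<beta> * s) = k * s"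
    using tr tu(1) unfolding transversal_def by blast
  define \<gamma> where "\<gamma> s = c *s \<Phi> 1 (t + \<alpha> * s) (u + \<beta> * s) 1" for s
  show "\<exists>\<gamma> g. (\<forall>i. \<exists>p. \<forall>s. \<gamma> s $ i = poly p s) \<and>
      (\<forall>s. \<forall>K\<in>ideal_of S. K (\<gamma> s) = 0) \<and> (\<forall>A\<in>ideal_of (curve f). A (\<gamma> 0) = 0) \<and> G (\<gamma> 0) \<noteq> 0 \<and>
      continuous_on UNIV g \<and> g 0 \<noteq> 0 \<and> (\<forall>s. F (\<gamma> s) = s ^ j * g s)"
  proof (intro exI[of _ \<gamma>] exI[of _ "\<lambda>_. c ^ D * k ^ j"] conjI allI ballI)
    show "\<exists>p. \<forall>s. \<gamma> s $ i = poly p s" for i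
      unfolding \<gamma>_def
      by (intro \<Phi>_component_poly exI[of _ "[:1:]"] exI[of _ "[:t, \<alpha>:]"] exI[of _ "[:u, \<beta>:]"]) auto
    show "K (\<gamma> s) = 0" if "K \<in> ideal_of S" for K s
      unfolding \<gamma>_def using that by (intro ideal_of_S_\<Phi>) auto
    show "A (\<gamma> 0) = 0" if "A \<in> ideal_of (curve f)" for A
      unfolding \<gamma>_def using that tu(1) upt_in_curve[of t u f] by (intro ideal_of_\<Phi>[OF that]) (auto simp: upt_def)
    show "F (\<gamma> s) = s ^ j * (c ^ D * k ^ j)" for s
      unfolding \<gamma>_def hom_polyD(2)[OF F(1)] dehom[OF hom_polyD(1)[OF F(1)]] F(2)
      by (simp add: k(2) power_mult_distrib)
  qed (use c k in \<open>auto simp: \<gamma>_def\<close>)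
qed

section \<open>Orders along the two lines outside the chart\<close>

lemma vanishes_on_ExcI:
  assumes G: "G \<in> polys" and 0: "\<And>c t. G (c *s \<Phi> 1 t 1 0) = 0" and p: "p \<in> Exc"
  shows "vanishes G p"
proof -
  obtain x y where xy: "p = pt (\<Phi> x y 1 0)" "x \<noteq> 0 \<or> y \<noteq> 0"
    using p unfolding Exc_def by blast
  have "G (c *s \<Phi> x y 1 0) = 0" for c x
  proof (rule continuous_eq_at_0[where f = "\<lambda>x. G (c *s \<Phi> x y 1 0)" and g = "\<lambda>_. 0"])
    fix x :: complex assume "x \<noteq> 0"
    then have "c *s \<Phi> x y 1 0 = (c * x) *s \<Phi> 1 (y / x) 1 0"
      by (simp add: scroll_map_def vec_eq_iff algebra_simps)
    then show "G (c *s \<Phi> x y 1 0) = 0"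
      using 0 by simp
  qed (use G in \<open>auto intro!: continuous_intros\<close>)
  then show ?thesis
    using xy by (simp add: vanishes_pt \<Phi>_nonzero valid_def)
qed

lemma vanishes_on_fibreI:
  assumes G: "G \<in> polys" and 0: "\<And>c u. G (c *s \<Phi> 0 1 u 1) = 0" and p: "p \<in> fibre 0 1"
  shows "vanishes G p"
proof -
  obtain z e where ze: "p = pt (\<Phi> 0 1 z e)" "z \<noteq> 0 \<or> e \<noteq> 0"
    using p unfolding fibre_def by blast
  have "G (c *s \<Phi> 0 1 z e) = 0" for c e
  proof (rule continuous_eq_at_0[where f = "\<lambda>e. G (c *s \<Phi> 0 1 z e)" and g = "\<lambda>_. 0"])
    fix e :: complex assume "e \<noteq> 0"
    then have "c *s \<Phi> 0 1 z e = (c * e) *s \<Phi> 0 1 (z / e) 1"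
      by (simp add: scroll_map_def vec_eq_iff algebra_simps)
    then show "G (c *s \<Phi> 0 1 z e) = 0"
      using 0 by simp
  qed (use G in \<open>auto intro!: continuous_intros\<close>)
  then show ?thesis
    using ze by (simp add: vanishes_pt \<Phi>_nonzero valid_def)
qed

lemma Exc_poly:
  assumes "G \<in> polys"
  obtains p where "\<forall>t. G (c *s \<Phi> 1 t 1 0) = poly p t"
proof -
  have "\<exists>p. \<forall>t. (c *s \<Phi> 1 t 1 0) $ i = poly p t" for i
    by (rule \<Phi>_component_poly) (auto intro: exI[of _ "[:1:]"] exI[of _ "[:0, 1:]"] exI[of _ "[:0:]"])
  from polys_along[OF assms this] show ?thesis
    using that by blast
qed

lemma fibre_poly:
  assumes "G \<in> polys"
  obtains p where "\<forall>u. G (c *s \<Phi> 0 1 u 1) = poly p u"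
proof -
  have "\<exists>p. \<forall>u. (c *s \<Phi> 0 1 u 1) $ i = poly p u" for i
    by (rule \<Phi>_component_poly) (auto intro: exI[of _ "[:1:]"] exI[of _ "[:0, 1:]"] exI[of _ "[:0:]"])
  from polys_along[OF assms this] show ?thesis
    using that by blast
qed

lemma pt_in_Exc: "pt (\<Phi> 1 t 1 0) \<in> Exc"
  unfolding Exc_def by (intro CollectI exI[of _ 1] exI[of _ t]) simp

lemma pt_in_fibre: "pt (\<Phi> 0 1 u 1) \<in> fibre 0 1"
  unfolding fibre_def by (intro CollectI exI[of _ u] exI[of _ 1]) simp

lemma valid_Exc [simp]: "valid 1 t 1 e"
  by (simp add: valid_def)

lemma valid_fibre [simp]: "valid x 1 u 1"
  by (simp add: valid_def)

lemma Exc_variety: "variety Exc"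
proof (rule varietyI[OF Exc_closed])
  show "Exc \<noteq> {}"
    using pt_in_Exc by blast
next
  fix d e F G
  assume F: "hom_poly d F" and G: "hom_poly e G" and FG: "\<forall>p\<in>Exc. vanishes F p \<or> vanishes G p"
  obtain p where p: "\<forall>t. F (1 *s \<Phi> 1 t 1 0) = poly p t"
    by (rule Exc_poly[OF hom_polyD(1)[OF F]])
  obtain q where q: "\<forall>t. G (1 *s \<Phi> 1 t 1 0) = poly q t"
    by (rule Exc_poly[OF hom_polyD(1)[OF G]])
  have "poly (p * q) t = 0" for t
    using FG pt_in_Exc[of t] p q vanishes_\<Phi>[OF F, of 1 t 1 0] vanishes_\<Phi>[OF G, of 1 t 1 0] by auto
  then have "p * q = 0"
    using poly_all_0_iff_0 by blast
  then consider "p = 0" | "q = 0"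
    by auto
  then show "(\<forall>p\<in>Exc. vanishes F p) \<or> (\<forall>p\<in>Exc. vanishes G p)"
  proof cases
    case 1
    then have "vanishes F x" if "x \<in> Exc" for x
      using p hom_polyD[OF F] by (intro vanishes_on_ExcI[OF _ _ that]) auto
    then show ?thesis
      by blast
  next
    case 2
    then have "vanishes G x" if "x \<in> Exc" for x
      using q hom_polyD[OF G] by (intro vanishes_on_ExcI[OF _ _ that]) auto
    then show ?thesis
      by blast
  qed
qed

lemma fibre_variety: "variety (fibre 0 1)"
proof (rule varietyI[OF fibre_01_closed])
  show "fibre 0 1 \<noteq> {}"
    using pt_in_fibre by blast
next
  fix d e F G
  assume F: "hom_poly d F" and G: "hom_poly e G" and FG: "\<forall>p\<in>fibre 0 1. vanishes F p \<or> vanishes G p"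
  obtain p where p: "\<forall>u. F (1 *s \<Phi> 0 1 u 1) = poly p u"
    by (rule fibre_poly[OF hom_polyD(1)[OF F]])
  obtain q where q: "\<forall>u. G (1 *s \<Phi> 0 1 u 1) = poly q u"
    by (rule fibre_poly[OF hom_polyD(1)[OF G]])
  have "poly (p * q) u = 0" for u
    using FG pt_in_fibre[of u] p q vanishes_\<Phi>[OF F, of 0 1 u 1] vanishes_\<Phi>[OF G, of 0 1 u 1] by auto
  then have "p * q = 0"
    using poly_all_0_iff_0 by blast
  then consider "p = 0" | "q = 0"
    by auto
  then show "(\<forall>p\<in>fibre 0 1. vanishes F p) \<or> (\<forall>p\<in>fibre 0 1. vanishes G p)"
  proof cases
    case 1
    then have "vanishes F x" if "x \<in> fibre 0 1" for x
      using p hom_polyD[OF F] by (intro vanishes_on_fibreI[OF _ _ that]) auto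
    then show ?thesis
      by blast
  next
    case 2
    then have "vanishes G x" if "x \<in> fibre 0 1" for x
      using q hom_polyD[OF G] by (intro vanishes_on_fibreI[OF _ _ that]) auto
    then show ?thesis
      by blast
  qed
qed

lemma upt_notin: "upt t u \<notin> Exc" "upt t u \<notin> fibre 0 1"
  using upt_iff[OF upt_in_S, of t u] unfolding Exc_eq fibre_01_eq by auto

lemma Exc_proper: "Exc \<subset> S" and fibre_proper: "fibre 0 1 \<subset> S"
  using Exc_subset fibre_subset[of 0 1] upt_notin[of 0 0] upt_in_S[of 0 0] by auto

lemma Exc_curve_on: "curve_on S Exc"
proof (rule curve_in_surface[OF S_variety S_dim Exc_variety Exc_proper pt_in_Exc[of 0] pt_in_Exc[of 1]])
  have "\<not> vanishes (X 4) (pt (\<Phi> 1 1 1 0))" "vanishes (X 4) (pt (\<Phi> 1 0 1 0))"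
    by (simp_all add: vanishes_\<Phi>[OF hom_poly_X])
  then show "pt (\<Phi> 1 0 1 0) \<noteq> pt (\<Phi> 1 1 1 0)"
    by auto
qed

lemma Exc_not_fibre: "Exc \<noteq> fibre 0 1"
proof
  assume "Exc = fibre 0 1"
  then have "pt (\<Phi> 1 0 1 0) \<in> fibre 0 1"
    using pt_in_Exc[of 0] by simp
  then show False
    unfolding fibre_01_eq by (simp add: vanishes_\<Phi>[OF hom_poly_X])
qed

text \<open>In Cox coordinates a form with chart polynomial f ^ j is \<open>hat\<close> ^ j times
  the missing powers of x and e. Their exponents are the orders along \<open>fibre 0 1\<close> and
  \<open>Exc\<close>.\<close>

lemma form_\<Phi>_power:
  assumes f: "cls a m f" and F: "hom_poly D F" "dehom F = f ^ j" and D: "j * m \<le> D" "j * a \<le> 2 * D"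
    and xe: "x \<noteq> 0" "e \<noteq> 0"
  shows "F (\<Phi> x y z e) = x ^ (2 * D - j * a) * e ^ (D - j * m) * hat a m f x y z e ^ j"
proof -
  have "F (\<Phi> x y z e) = (x\<^sup>2 * e) ^ D * ev2 f (y / x) (z / (x * e)) ^ j"
    using form_\<Phi>[OF F(1) xe] F(2) by simp
  also have "(x\<^sup>2 * e) ^ D = x ^ (2 * D) * e ^ D"
    by (simp add: power_mult_distrib flip: power_mult)
  also have "x ^ (2 * D) = x ^ (2 * D - j * a) * x ^ (a * j)"
    using D by (simp add: mult.commute flip: power_add)
  also have "e ^ D = e ^ (D - j * m) * e ^ (m * j)"
    using D by (simp add: mult.commute flip: power_add)
  finally show ?thesis
    by (simp add: hat_chart[OF f xe] power_mult_distrib power_mult)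
qed

lemma order_on_Exc:
  assumes f: "good_equation a m f" and F: "hom_poly D F" "dehom F = f ^ j" and D: "j * m \<le> D" "j * a \<le> 2 * D"
  shows "vanishing_order S Exc F = D - j * m"
proof (rule vanishing_orderI)
  have c: "cls a m f"
    using f by (simp add: good_equation_def)
  define n where "n = D - j * m"
  \<comment> \<open>The identity used is \<open>X 3\<close> ^ (2 n) F = \<open>X 0\<close> ^ n K,
    with K having chart polynomial u ^ (2 n) f ^ j. The exponent 2 n gives u-degree exactly D + n,
    the degree of K, and keeps the total degree at most 2 (D + n).\<close>
  have "cls (2 * n + j * a) (2 * n + j * m) (monom (monom 1 0) (2 * n) * f ^ j)"
    by (intro cls_mult cls_monom cls_power c) auto
  then have "cls (2 * (D + n)) (D + n) (monom (monom 1 0) (2 * n) * f ^ j)"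
    by (rule cls_mono) (use D in \<open>auto simp: n_def\<close>)
  then obtain K where K: "hom_poly (D + n) K" "dehom K = monom (monom 1 0) (2 * n) * f ^ j"
    by (rule form_exists) blast
  have X3: "dehom (\<lambda>v. X 3 v ^ (2 * n)) = monom (monom 1 0) (2 * n)"
    by (simp add: dehom_power[OF dot_polys] dehom_X monom_0 one_pCons[symmetric] monom_altdef)
  show "\<exists>G\<in>polys - ideal_of Exc. \<exists>A\<in>ideal_pow polys (ideal_of Exc) (D - j * m). \<exists>K\<in>ideal_of S. \<forall>x. G x * F x = A x + K x"
    unfolding n_def[symmetric]
  proof (rule vanishing_order_lower[OF F(1) hom_poly_power[OF hom_poly_X[of 3], of "2 * n"] _ hom_poly_X[of 0] _ K(1)])
    have "hom_poly (2 * n * 1) (\<lambda>v. X 3 v ^ (2 * n))"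
      by (rule hom_poly_power[OF hom_poly_X])
    from vanishes_\<Phi>[OF this, of 1 0 1 0] show "\<exists>p\<in>Exc. \<not> vanishes (\<lambda>v. X 3 v ^ (2 * n)) p"
      by (intro bexI[OF _ pt_in_Exc[of 0]]) simp
    show "\<forall>p\<in>Exc. vanishes (X 0) p"
      unfolding Exc_eq by auto
  qed (use F(2) K(2) X3 dehom_X in auto)
next
  fix G assume G: "G \<in> polys - ideal_of Exc"
  have c: "cls a m f" and m: "degree f = m" and m0: "m > 0"
    using f by (auto simp: good_equation_def)
  have gm: "coeff f m \<noteq> 0"
    using m m0 by auto
  have "\<exists>c t. G (c *s \<Phi> 1 t 1 0) \<noteq> 0"
  proof (rule ccontr)
    assume "\<not> ?thesis"
    then have 0: "G (c *s \<Phi> 1 t 1 0) = 0" for c t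
      by blast
    have "G \<in> polys"
      using G by blast
    then have "vanishes G p" if "p \<in> Exc" for p
      using 0 that by (rule vanishes_on_ExcI)
    then show False
      using G by (auto simp: ideal_of_def)
  qed
  then obtain c0 t0 where "G (c0 *s \<Phi> 1 t0 1 0) \<noteq> 0"
    by blast
  moreover obtain p where p: "\<forall>t. G (c0 *s \<Phi> 1 t 1 0) = poly p t"
    using Exc_poly[of G c0] G by blast
  ultimately have "p \<noteq> 0"
    by auto
  then have "p * coeff f m \<noteq> 0"
    using gm by simp
  \<comment> \<open>A point of the exceptional line where the denominator is nonzero and which does
    not lie on the curve. The test curve crosses it in the direction of e.\<close>
  then obtain t where t: "poly (p * coeff f m) t \<noteq> 0" "t \<notin> {}"
    by (rule infinite_not_root[OF _ finite.emptyI])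
  then have "G (c0 *s \<Phi> 1 t 1 0) \<noteq> 0"
    using p by simp
  then have "\<not> vanishes G (pt (\<Phi> 1 t 1 0))"
    by (auto simp: vanishes_pt \<Phi>_nonzero)
  then obtain k where k: "k \<noteq> 0" "G (k *s \<Phi> 1 t 1 0) \<noteq> 0"
    using not_vanishes_scale[of G "\<Phi> 1 t 1 0"] G by (auto simp: \<Phi>_nonzero)
  define \<gamma> where "\<gamma> s = k *s \<Phi> 1 t 1 s" for s
  show "\<exists>\<gamma> g. (\<forall>i. \<exists>p. \<forall>s. \<gamma> s $ i = poly p s) \<and>
      (\<forall>s. \<forall>K\<in>ideal_of S. K (\<gamma> s) = 0) \<and> (\<forall>A\<in>ideal_of Exc. A (\<gamma> 0) = 0) \<and> G (\<gamma> 0) \<noteq> 0 \<and>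
      continuous_on UNIV g \<and> g 0 \<noteq> 0 \<and> (\<forall>s. F (\<gamma> s) = s ^ (D - j * m) * g s)"
  proof (intro exI[of _ \<gamma>] exI[of _ "\<lambda>s. k ^ D * hat a m f 1 t 1 s ^ j"] conjI allI ballI)
    show "\<exists>p. \<forall>s. \<gamma> s $ i = poly p s" for i
      unfolding \<gamma>_def
      by (rule \<Phi>_component_poly) (auto intro: exI[of _ "[:1:]"] exI[of _ "[:t:]"] exI[of _ "[:0, 1:]"])
    show "K (\<gamma> s) = 0" if "K \<in> ideal_of S" for K s
      unfolding \<gamma>_def using that by (intro ideal_of_S_\<Phi>) auto
    show "A (\<gamma> 0) = 0" if "A \<in> ideal_of Exc" for A
      unfolding \<gamma>_def using pt_in_Exc by (intro ideal_of_\<Phi>[OF that]) auto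
    show "F (\<gamma> s) = s ^ (D - j * m) * (k ^ D * hat a m f 1 t 1 s ^ j)" for s
    proof (rule continuous_eq_at_0[where f = "\<lambda>s. F (\<gamma> s)"])
      fix s :: complex assume "s \<noteq> 0"
      then show "F (\<gamma> s) = s ^ (D - j * m) * (k ^ D * hat a m f 1 t 1 s ^ j)"
        unfolding \<gamma>_def hom_polyD(2)[OF F(1)] by (simp add: form_\<Phi>_power[OF c F D])
    qed (use hom_polyD(1)[OF F(1)] in \<open>auto simp: \<gamma>_def intro!: continuous_intros\<close>)
    show "k ^ D * hat a m f 1 t 1 0 ^ j \<noteq> 0"
      using k t(1) by (simp add: hat_x1_e0[OF c])
    show "continuous_on UNIV (\<lambda>s. k ^ D * hat a m f 1 t 1 s ^ j)"
      by (intro continuous_intros)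
  qed (use k in \<open>auto simp: \<gamma>_def\<close>)
qed

lemma order_on_fibre:
  assumes f: "good_equation a m f" and F: "hom_poly D F" "dehom F = f ^ j" and D: "j * m \<le> D" "j * a \<le> 2 * D"
  shows "vanishing_order S (fibre 0 1) F = 2 * D - j * a"
proof (rule vanishing_orderI)
  have c: "cls a m f"
    using f by (simp add: good_equation_def)
  define n where "n = 2 * D - j * a"
  have "cls (n + j * a) (0 + j * m) (monom (monom 1 n) 0 * f ^ j)"
    by (intro cls_mult cls_monom cls_power c) auto
  then have "cls (2 * D) D (monom (monom 1 n) 0 * f ^ j)"
    by (rule cls_mono) (use D in \<open>auto simp: n_def\<close>)
  then obtain K where K: "hom_poly D K" "dehom K = monom (monom 1 n) 0 * f ^ j"
    by (rule form_exists) blast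
  have X1: "dehom (X (Suc 0)) ^ i = monom (monom 1 i) 0" for i
    by (simp add: dehom_X monom_0 poly_const_pow monom_altdef)
  have X2: "dehom (\<lambda>v. X 2 v ^ i) = monom (monom 1 (2 * i)) 0" for i
  proof -
    have "[:[:0, 0, 1 :: complex:]:] = monom (monom 1 2) 0"
      by (simp add: monom_0 numeral_2_eq_2 monom_Suc one_pCons)
    moreover have "(monom 1 2 :: complex poly) ^ i = monom 1 (2 * i)"
      by (simp add: monom_power mult.commute)
    ultimately show ?thesis
      by (simp add: dehom_power[OF dot_polys] dehom_X(3) monom_0 poly_const_pow)
  qed
  show "\<exists>G\<in>polys - ideal_of (fibre 0 1). \<exists>A\<in>ideal_pow polys (ideal_of (fibre 0 1)) (2 * D - j * a). \<exists>K\<in>ideal_of S. \<forall>x. G x * F x = A x + K x"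
    unfolding n_def[symmetric]
  proof (rule vanishing_order_lower[OF F(1) hom_poly_power[OF hom_poly_X[of 2], of n] _ hom_poly_X[of "Suc 0"] _ K(1)])
    have "hom_poly (n * 1) (\<lambda>v. X 2 v ^ n)"
      by (rule hom_poly_power[OF hom_poly_X])
    from vanishes_\<Phi>[OF this, of 0 1 0 1] show "\<exists>p\<in>fibre 0 1. \<not> vanishes (\<lambda>v. X 2 v ^ n) p"
      by (intro bexI[OF _ pt_in_fibre[of 0]]) simp
    show "\<forall>p\<in>fibre 0 1. vanishes (X (Suc 0)) p"
    proof
      fix p assume "p \<in> fibre 0 1"
      then obtain z e where "p = pt (\<Phi> 0 1 z e)" "z \<noteq> 0 \<or> e \<noteq> 0"
        unfolding fibre_def by blast
      then show "vanishes (X (Suc 0)) p"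
        by (simp add: vanishes_\<Phi>[OF hom_poly_X] valid_def)
    qed
    have "monom (monom 1 (2 * n)) 0 = (monom (monom 1 n) 0 * monom (monom 1 n) 0 :: complex poly poly)"
      by (simp add: mult_monom mult_2)
    then show "dehom (\<lambda>v. X 2 v ^ n) * dehom F = dehom (X (Suc 0)) ^ n * dehom K"
      unfolding X1 X2 F(2) K(2) by (simp only: mult.assoc)
  qed auto
next
  fix G assume G: "G \<in> polys - ideal_of (fibre 0 1)"
  have c: "cls a m f" and irr: "irreducible f" and m: "degree f = m" "m > 0" and top: "\<exists>k\<le>a. coeff (coeff f k) (a - k) \<noteq> 0"
    using f by (auto simp: good_equation_def)
  have "\<exists>c u. G (c *s \<Phi> 0 1 u 1) \<noteq> 0"
  proof (rule ccontr)
    assume "\<not> ?thesis"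
    then have 0: "G (c *s \<Phi> 0 1 u 1) = 0" for c u
      by blast
    have "G \<in> polys"
      using G by blast
    then have "vanishes G p" if "p \<in> fibre 0 1" for p
      using 0 that by (rule vanishes_on_fibreI)
    then show False
      using G by (auto simp: ideal_of_def)
  qed
  then obtain c0 u0 where "G (c0 *s \<Phi> 0 1 u0 1) \<noteq> 0"
    by blast
  moreover obtain p where p: "\<forall>u. G (c0 *s \<Phi> 0 1 u 1) = poly p u"
    using fibre_poly[of G c0] G by blast
  ultimately have "p \<noteq> 0"
    by auto
  define q where "q = (\<Sum>k\<le>m. monom (\<Sum>i\<le>a. coeff (coeff f k) i * 0 ^ (a - k - i) * 1 ^ i) k)"
  have q: "hat a m f 0 1 u 1 = poly q u" for u
    by (simp add: q_def hat_def poly_sum poly_monom sum_distrib_right)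
  then have "q \<noteq> 0"
    using hat_not_zero_on_fibre[OF c irr m top, of 0 1] by auto
  then have "p * q \<noteq> 0"
    using \<open>p \<noteq> 0\<close> by simp
  then obtain u where u: "poly (p * q) u \<noteq> 0" "u \<notin> {}"
    by (rule infinite_not_root[OF _ finite.emptyI])
  then have "G (c0 *s \<Phi> 0 1 u 1) \<noteq> 0"
    using p by simp
  then have "\<not> vanishes G (pt (\<Phi> 0 1 u 1))"
    by (auto simp: vanishes_pt \<Phi>_nonzero)
  then obtain k where k: "k \<noteq> 0" "G (k *s \<Phi> 0 1 u 1) \<noteq> 0"
    using not_vanishes_scale[of G "\<Phi> 0 1 u 1"] G by (auto simp: \<Phi>_nonzero)
  define \<gamma> where "\<gamma> s = k *s \<Phi> s 1 u 1" for s
  show "\<exists>\<gamma> g. (\<forall>i. \<exists>p. \<forall>s. \<gamma> s $ i = poly p s) \<and>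
      (\<forall>s. \<forall>K\<in>ideal_of S. K (\<gamma> s) = 0) \<and> (\<forall>A\<in>ideal_of (fibre 0 1). A (\<gamma> 0) = 0) \<and> G (\<gamma> 0) \<noteq> 0 \<and>
      continuous_on UNIV g \<and> g 0 \<noteq> 0 \<and> (\<forall>s. F (\<gamma> s) = s ^ (2 * D - j * a) * g s)"
  proof (intro exI[of _ \<gamma>] exI[of _ "\<lambda>s. k ^ D * hat a m f s 1 u 1 ^ j"] conjI allI ballI)
    show "\<exists>p. \<forall>s. \<gamma> s $ i = poly p s" for i
      unfolding \<gamma>_def
      by (rule \<Phi>_component_poly) (auto intro: exI[of _ "[:1:]"] exI[of _ "[:u:]"] exI[of _ "[:0, 1:]"])
    show "K (\<gamma> s) = 0" if "K \<in> ideal_of S" for K s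
      unfolding \<gamma>_def using that by (intro ideal_of_S_\<Phi>) auto
    show "A (\<gamma> 0) = 0" if "A \<in> ideal_of (fibre 0 1)" for A
      unfolding \<gamma>_def using pt_in_fibre by (intro ideal_of_\<Phi>[OF that]) auto
    show "F (\<gamma> s) = s ^ (2 * D - j * a) * (k ^ D * hat a m f s 1 u 1 ^ j)" for s
    proof (rule continuous_eq_at_0[where f = "\<lambda>s. F (\<gamma> s)"])
      fix s :: complex assume "s \<noteq> 0"
      then show "F (\<gamma> s) = s ^ (2 * D - j * a) * (k ^ D * hat a m f s 1 u 1 ^ j)"
        unfolding \<gamma>_def hom_polyD(2)[OF F(1)] by (simp add: form_\<Phi>_power[OF c F D])
    qed (use hom_polyD(1)[OF F(1)] in \<open>auto simp: \<gamma>_def intro!: continuous_intros\<close>)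
    show "k ^ D * hat a m f 0 1 u 1 ^ j \<noteq> 0"
      using k u(1) by (simp add: q)
    show "continuous_on UNIV (\<lambda>s. k ^ D * hat a m f s 1 u 1 ^ j)"
      by (intro continuous_intros)
  qed (use k in \<open>auto simp: \<gamma>_def\<close>)
qed

lemma order_elsewhere:
  assumes f: "good_equation a m f" and F: "hom_poly D F" "dehom F = f ^ j" and C: "curve_on S C"
    and ne: "C \<noteq> curve f" "C \<noteq> Exc" "C \<noteq> fibre 0 1"
  shows "vanishing_order S C F = 0"
proof -
  have Cv: "variety C" "C \<subseteq> S"
    using C by (auto simp: curve_on_def)
  have irr: "irreducible f" "degree f > 0"
    using f by (auto simp: good_equation_def)
  have "\<not> C \<subseteq> Exc"
    using curve_eq[OF S_dim S_variety C Exc_variety _ Exc_proper] ne by blast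
  moreover have "\<not> C \<subseteq> fibre 0 1"
    using curve_eq[OF S_dim S_variety C fibre_variety _ fibre_proper] ne by blast
  ultimately have n0: "\<not> C \<subseteq> {p. vanishes (X 0) p}"
    by (rule curve_off_chart[OF Cv])
  have "\<not> C \<subseteq> {p. vanishes F p}"
  proof
    assume CF: "C \<subseteq> {p. vanishes F p}"
    have on: "ev2 f t u = 0" if "upt t u \<in> C" for t u
    proof -
      have "ev2 (f ^ j) t u = 0"
        using CF that vanishes_upt[OF F(1)] dehom[OF hom_polyD(1)[OF F(1)]] F(2) by auto
      then show ?thesis
        by simp
    qed
    have "vanishes H p" if p: "p \<in> C" and H: "hom_poly d H" "f dvd dehom H" for p d H
    proof (rule vanishes_from_chart[OF Cv n0 hom_polyD(1)[OF H(1)] _ p], intro allI impI)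
      fix t u assume "upt t u \<in> C"
      then have "upt t u \<in> curve f"
        using on upt_in_curve by simp
      then show "vanishes H (upt t u)"
        using H by (auto simp: curve_def)
    qed
    then have "C \<subseteq> curve f"
      using Cv(2) by (auto simp: curve_def)
    then have "C = curve f"
      by (rule curve_eq[OF S_dim S_variety C curve_variety[OF irr] _ curve_proper]) (use irr in auto)
    then show False
      using ne by simp
  qed
  then show ?thesis
    by (rule vanishing_order_0[OF Cv F(1)])
qed

lemma curve_ne: "good_equation a m f \<Longrightarrow> curve f \<noteq> Exc" "good_equation a m f \<Longrightarrow> curve f \<noteq> fibre 0 1"
proof -
  assume "good_equation a m f"
  then have "degree f > 0"
    by (auto simp: good_equation_def)
  then obtain t u where "upt t u \<in> curve f"
    using zero_off_finite[OF _ finite.emptyI] upt_in_curve by metis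
  then show "curve f \<noteq> Exc" "curve f \<noteq> fibre 0 1"
    using upt_notin by blast+
qed

lemma order_of_power:
  assumes f: "good_equation a m f" and tr: "transversal f" and F: "hom_poly D F" "dehom F = f ^ j"
    and D: "j * m \<le> D" "j * a \<le> 2 * D" and C: "curve_on S C"
  shows "int (vanishing_order S C F) = (if C = curve f then int j else 0) +
    (if C = Exc then int (D - j * m) else 0) + (if C = fibre 0 1 then int (2 * D - j * a) else 0)"
  using order_on_curve[OF f tr F] order_on_Exc[OF f F D] order_on_fibre[OF f F D] order_elsewhere[OF f F C]
    curve_ne[OF f] Exc_not_fibre by auto

text \<open>The rational function is F / G, where F has chart polynomial f, G has the a-th power of
  the line's equation, and both have degree a. Both forms vanish to order a along
  \<open>fibre 0 1\<close>, which cancels; along \<open>Exc\<close> the orders are a - m and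
  0.\<close>

theorem lin_equiv_curve:
  assumes f: "good_equation a m f" and tr: "transversal f" and a: "m \<le> a"
  shows "lin_equiv S (frag_of (curve f))
    (frag_cmul (int a) (frag_of (curve [:[:c, d:], 1:])) - frag_cmul (int a - int m) (frag_of Exc))"
proof -
  let ?l = "[:[:c, d:], 1 :: complex poly:]"
  have l: "good_equation 1 1 ?l" "transversal ?l"
    by (rule good_line, rule transversal_line)
  have cls: "cls a m f" "cls 1 1 ?l"
    using f l by (simp_all add: good_equation_def)
  have "cls (2 * a) a f"
    using cls(1) by (rule cls_mono) (use a in auto)
  then obtain F where F: "hom_poly a F" "dehom F = f"
    by (rule form_exists) blast
  have "cls (2 * a) a (?l ^ a)"
    using cls_power[OF cls(2), of a] by (rule cls_mono) auto
  then obtain G where G: "hom_poly a G" "dehom G = ?l ^ a"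
    by (rule form_exists) blast
  have F1: "dehom F = f ^ 1"
    using F by simp
  let ?D = "frag_of (curve f) - (frag_cmul (int a) (frag_of (curve ?l)) - frag_cmul (int a - int m) (frag_of Exc))"
  have lookup_eq: "Poly_Mapping.lookup ?D C = int (vanishing_order S C F) - int (vanishing_order S C G)"
    if C: "curve_on S C" for C
  proof -
    have "int (vanishing_order S C F) = (if C = curve f then 1 else 0) +
        (if C = Exc then int a - int m else 0) + (if C = fibre 0 1 then int a else 0)"
      using order_of_power[OF f tr F(1) F1 _ _ C] a by (simp add: of_nat_diff)
    moreover have "int (vanishing_order S C G) = (if C = curve ?l then int a else 0) + (if C = fibre 0 1 then int a else 0)"
      using order_of_power[OF l G _ _ C] by simp
    ultimately show ?thesis
      by (auto simp: lookup_minus)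
  qed
  have not_ideal: "H \<notin> ideal_of S" if "hom_poly n H" "dehom H \<noteq> 0" for n H
  proof
    assume "H \<in> ideal_of S"
    then have "ev2 (dehom H) t u = 0" for t u
      using vanishes_upt[OF that(1)] upt_in_S dehom[OF hom_polyD(1)[OF that(1)]] by (auto simp: ideal_of_def)
    then show False
      using that(2) ev2_eqI[of "dehom H" 0] by simp
  qed
  have D1: "divisor_on S (frag_of (curve f))"
    using good_curve_on[OF f] by (auto simp: divisor_on_def)
  have D2: "divisor_on S (frag_cmul (int a) (frag_of (curve ?l)) - frag_cmul (int a - int m) (frag_of Exc))"
    unfolding divisor_on_def
  proof
    fix C assume "C \<in> Poly_Mapping.keys (frag_cmul (int a) (frag_of (curve ?l)) - frag_cmul (int a - int m) (frag_of Exc))"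
    then have "C = curve ?l \<or> C = Exc"
      by (auto simp: in_keys_iff lookup_minus split: if_splits)
    then show "C \<in> {C. curve_on S C}"
      using good_curve_on[OF l(1)] Exc_curve_on by auto
  qed
  have "divisor_on S ?D"
    unfolding divisor_on_def
  proof
    fix C assume "C \<in> Poly_Mapping.keys ?D"
    then have "C = curve f \<or> C = curve ?l \<or> C = Exc"
      by (auto simp: in_keys_iff lookup_minus split: if_splits)
    then show "C \<in> {C. curve_on S C}"
      using good_curve_on[OF f] good_curve_on[OF l(1)] Exc_curve_on by auto
  qed
  moreover have "f \<noteq> 0"
    using f unfolding good_equation_def by (metis degree_0 less_irrefl)
  then have "F \<notin> ideal_of S" "G \<notin> ideal_of S"
    using not_ideal[OF F(1)] not_ideal[OF G(1)] F G by auto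
  ultimately show ?thesis
    unfolding lin_equiv_def principal_on_def using D1 D2 F(1) G(1) lookup_eq by blast
qed

text \<open>Identifies the closure of u = -(c + d t) with the parametrization in which preimages of
  lines appear when the blow-up is computed.\<close>

lemma line_curve_eq:
  "curve [:[:c, d:], 1:] = {pt (\<Phi> x y (- (c * x + d * y)) 1) | x y. x \<noteq> 0 \<or> y \<noteq> 0}" (is "curve ?l = ?R")
proof (intro equalityI subsetI)
  have hat_l: "hat 1 1 ?l x y z e = (c * x + d * y) * e + z" for x y z e
    using hat_linear(2)[of c d 1] by (simp add: one_pCons)
  have l: "cls 1 1 ?l"
    using good_line by (simp add: good_equation_def)
  fix p assume p: "p \<in> curve ?l"
  then obtain x y z e where xyz: "p = pt (\<Phi> x y z e)" "valid x y z e"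
    using curve_subset unfolding S_eq by blast
  then have eq: "(c * x + d * y) * e + z = 0"
    using hat_zero_on_curve[OF l xyz(2)] p hat_l by simp
  then have e: "e \<noteq> 0"
    using xyz(2) by (auto simp: valid_def)
  have z: "z = e * (- (c * x + d * y))"
    using eq by (simp add: algebra_simps eq_neg_iff_add_eq_0)
  have "\<Phi> x y z e = e *s \<Phi> x y (- (c * x + d * y)) 1"
    using \<Phi>_scale(1)[of x y e "- (c * x + d * y)" 1] z by simp
  moreover have "\<Phi> x y (- (c * x + d * y)) 1 \<noteq> 0"
    using xyz(2) by (intro \<Phi>_nonzero) (simp add: valid_def)
  ultimately have "p = pt (\<Phi> x y (- (c * x + d * y)) 1)"
    using xyz(1) pt_smult[OF e] by simp
  then show "p \<in> ?R"
    using xyz(2) by (auto simp: valid_def)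
next
  fix p assume "p \<in> ?R"
  then obtain x y where p: "p = pt (\<Phi> x y (- (c * x + d * y)) 1)" and xy: "x \<noteq> 0 \<or> y \<noteq> 0"
    by blast
  have v: "valid x y (- (c * x + d * y)) 1"
    using xy by (simp add: valid_def)
  have "vanishes F p" if F: "hom_poly D F" "?l dvd dehom F" for D F
  proof -
    have "F (\<Phi> x y (- (c * x + d * y)) 1) = 0" for x
    proof (rule continuous_eq_at_0[where f = "\<lambda>x. F (\<Phi> x y (- (c * x + d * y)) 1)" and g = "\<lambda>_. 0"])
      fix x :: complex assume x: "x \<noteq> 0"
      have "- (c * x + d * y) / x = - c - d * (y / x)"
        using x by (simp add: add_divide_distrib diff_divide_distrib)
      then have l0: "ev2 ?l (y / x) (- (c * x + d * y) / x) = 0"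
        by simp
      obtain k where k: "dehom F = ?l * k"
        using F(2) by (rule dvdE)
      have "ev2 (dehom F) (y / x) (- (c * x + d * y) / x) = 0"
        unfolding k ev2_simps(4) l0 by simp
      then show "F (\<Phi> x y (- (c * x + d * y)) 1) = 0"
        using form_\<Phi>[OF F(1) x, of 1 y "- (c * x + d * y)"] by simp
    qed (use hom_polyD(1)[OF F(1)] in \<open>auto intro!: continuous_intros\<close>)
    then show ?thesis
      unfolding p vanishes_\<Phi>[OF F(1) v] .
  qed
  then show "p \<in> curve ?l"
    using pt_\<Phi>_in_S[OF v] p by (auto simp: curve_def)
qed

end

section \<open>The embedded blow-up is a scroll\<close>

lemma dot_axis: "dot (axis i 1) v = v $ i"
  by (simp add: dot_def axis_def if_distrib if_distribR cong: if_cong)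

lemma dot_minus: "dot (a - b) v = dot a v - dot b v"
  by (simp add: dot_def algebra_simps sum_subtractf)

lemma dot_eq_0: "(\<And>v. dot a v = 0) \<Longrightarrow> a = 0"
proof -
  assume 0: "\<And>v. dot a v = 0"
  have "a $ i = dot a (axis i 1)" for i
    by (simp add: dot_def axis_def if_distrib if_distribR cong: if_cong)
  then show "a = 0"
    using 0 by (simp add: vec_eq_iff)
qed

text \<open>A basis of the plane's vector space with its dual basis; it is used with
  \<open>p3\<close> spanning the blown-up point, so that x and y vanish exactly at P.\<close>

locale plane_coords =
  fixes p1 p2 p3 r1 r2 r3 :: "complex ^ 3"
  assumes r1: "dot r1 p1 = 1" "dot r1 p2 = 0" "dot r1 p3 = 0"
    and r2: "dot r2 p1 = 0" "dot r2 p2 = 1" "dot r2 p3 = 0"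
    and r3: "dot r3 p1 = 0" "dot r3 p2 = 0" "dot r3 p3 = 1"
    and expand: "\<And>v. v = dot r1 v *s p1 + dot r2 v *s p2 + dot r3 v *s p3"
begin

definition vec3 where "vec3 x y z = x *s p1 + y *s p2 + z *s p3"

lemma dot_vec3 [simp]: "dot r1 (vec3 x y z) = x" "dot r2 (vec3 x y z) = y" "dot r3 (vec3 x y z) = z"
  by (simp_all add: vec3_def r1 r2 r3)

lemma vec3_cases: obtains x y z where "v = vec3 x y z"
  using expand[of v] unfolding vec3_def by blast

lemma vec3_eq_0: "vec3 x y z = 0 \<longleftrightarrow> x = 0 \<and> y = 0 \<and> z = 0"
proof
  assume "vec3 x y z = 0"
  then have "dot r1 (vec3 x y z) = 0" "dot r2 (vec3 x y z) = 0" "dot r3 (vec3 x y z) = 0"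
    by simp_all
  then show "x = 0 \<and> y = 0 \<and> z = 0"
    by simp
qed (simp add: vec3_def)

lemma vec3_smult: "c *s vec3 x y z = vec3 (c * x) (c * y) (c * z)"
  by (simp add: vec3_def vector_add_ldistrib vector_smult_assoc)

lemma p3_eq: "p3 = vec3 0 0 1"
  by (simp add: vec3_def)

text \<open>The three degrees are treated together because multiplication by a coordinate raises the
  degree by one in the induction.\<close>

lemma form_in_coords:
  assumes "monomials_span d F"
  shows "(d = 0 \<longrightarrow> (\<exists>c. \<forall>v. F v = c)) \<and>
    (d = 1 \<longrightarrow> (\<exists>c1 c2 c3. \<forall>x y z. F (vec3 x y z) = c1 * x + c2 * y + c3 * z)) \<and>
    (d = 2 \<longrightarrow> (\<exists>c0 c1 c2 c3 c4 c5. \<forall>x y z. F (vec3 x y z) =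
      c0 * x\<^sup>2 + c1 * (x * y) + c2 * y\<^sup>2 + c3 * (x * z) + c4 * (y * z) + c5 * z\<^sup>2))"
  using assms
proof (induction rule: monomials_span.induct)
  case (coord d f i)
  have v: "vec3 x y z $ i = p1 $ i * x + p2 $ i * y + p3 $ i * z" for x y z
    by (simp add: vec3_def)
  have "\<exists>c1 c2 c3. \<forall>x y z. vec3 x y z $ i * f (vec3 x y z) = c1 * x + c2 * y + c3 * z" if d: "d = 0"
  proof -
    obtain c where "\<forall>v. f v = c"
      using coord.IH d by blast
    then show ?thesis
      unfolding v by (intro exI[of _ "c * p1 $ i"] exI[of _ "c * p2 $ i"] exI[of _ "c * p3 $ i"]) (simp add: algebra_simps)
  qed
  moreover have "\<exists>c0 c1 c2 c3 c4 c5. \<forall>x y z. vec3 x y z $ i * f (vec3 x y z) =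
      c0 * x\<^sup>2 + c1 * (x * y) + c2 * y\<^sup>2 + c3 * (x * z) + c4 * (y * z) + c5 * z\<^sup>2" if d: "d = 1"
  proof -
    obtain c1 c2 c3 where c: "\<forall>x y z. f (vec3 x y z) = c1 * x + c2 * y + c3 * z"
      using coord.IH d by blast
    show ?thesis
      unfolding v by (intro exI[of _ "p1 $ i * c1"] exI[of _ "p1 $ i * c2 + p2 $ i * c1"] exI[of _ "p2 $ i * c2"]
        exI[of _ "p1 $ i * c3 + p3 $ i * c1"] exI[of _ "p2 $ i * c3 + p3 $ i * c2"] exI[of _ "p3 $ i * c3"])
        (simp add: c algebra_simps power2_eq_square)
  qed
  ultimately show ?case
    by auto
next
  case (add d f g)
  show ?case
  proof (intro conjI impI)
    assume "d = 0"
    then obtain c c' where "\<forall>v. f v = c" "\<forall>v. g v = c'"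
      using add.IH by blast
    then show "\<exists>c. \<forall>v. f v + g v = c"
      by simp
  next
    assume "d = 1"
    then obtain c1 c2 c3 e1 e2 e3 where "\<forall>x y z. f (vec3 x y z) = c1 * x + c2 * y + c3 * z"
        "\<forall>x y z. g (vec3 x y z) = e1 * x + e2 * y + e3 * z"
      using add.IH by blast
    then show "\<exists>c1 c2 c3. \<forall>x y z. f (vec3 x y z) + g (vec3 x y z) = c1 * x + c2 * y + c3 * z"
      by (intro exI[of _ "c1 + e1"] exI[of _ "c2 + e2"] exI[of _ "c3 + e3"]) (simp add: algebra_simps)
  next
    assume d: "d = 2"
    obtain c0 c1 c2 c3 c4 c5 where c: "\<forall>x y z. f (vec3 x y z) =
        c0 * x\<^sup>2 + c1 * (x * y) + c2 * y\<^sup>2 + c3 * (x * z) + c4 * (y * z) + c5 * z\<^sup>2"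
      using add.IH(1) d by blast
    obtain e0 e1 e2 e3 e4 e5 where e: "\<forall>x y z. g (vec3 x y z) =
        e0 * x\<^sup>2 + e1 * (x * y) + e2 * y\<^sup>2 + e3 * (x * z) + e4 * (y * z) + e5 * z\<^sup>2"
      using add.IH(2) d by blast
    show "\<exists>c0 c1 c2 c3 c4 c5. \<forall>x y z. f (vec3 x y z) + g (vec3 x y z) =
        c0 * x\<^sup>2 + c1 * (x * y) + c2 * y\<^sup>2 + c3 * (x * z) + c4 * (y * z) + c5 * z\<^sup>2"
    proof (rule exI[of _ "c0 + e0"], rule exI[of _ "c1 + e1"], rule exI[of _ "c2 + e2"], rule exI[of _ "c3 + e3"],
        rule exI[of _ "c4 + e4"], rule exI[of _ "c5 + e5"], intro allI)
      fix x y z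
      show "f (vec3 x y z) + g (vec3 x y z) = (c0 + e0) * x\<^sup>2 + (c1 + e1) * (x * y) + (c2 + e2) * y\<^sup>2 +
          (c3 + e3) * (x * z) + (c4 + e4) * (y * z) + (c5 + e5) * z\<^sup>2"
        unfolding c[rule_format] e[rule_format] distrib_right by (simp only: add.commute add.left_commute)
    qed
  qed
qed auto

end

lemma plane_coords_exist:
  assumes "p3 \<noteq> 0"
  obtains p1 p2 r1 r2 r3 where "plane_coords p1 p2 p3 r1 r2 r3"
proof -
  obtain k where k: "p3 $ k \<noteq> 0"
    using assms by (metis vec_eq_iff zero_index)
  obtain i j :: 3 where ij: "i \<noteq> j" "i \<noteq> k" "j \<noteq> k" "\<forall>l. l = i \<or> l = j \<or> l = k"
  proof -
    have "(2::3) \<noteq> 1" "(3::3) \<noteq> 1" "(3::3) \<noteq> 2"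
      by simp_all
    then show ?thesis
      using exhaust_3[of k] exhaust_3 that[of 2 3] that[of 1 3] that[of 1 2] by metis
  qed
  \<comment> \<open>p3 together with the two coordinate vectors other than the k-th is a basis
    because p3 has nonzero k-th entry. These are the dual forms.\<close>
  define r1 where "r1 = axis i 1 - (p3 $ i / p3 $ k) *s axis k 1"
  define r2 where "r2 = axis j 1 - (p3 $ j / p3 $ k) *s axis k 1"
  define r3 where "r3 = (1 / p3 $ k) *s axis k (1 :: complex)"
  have dots: "dot r1 v = v $ i - p3 $ i / p3 $ k * v $ k" "dot r2 v = v $ j - p3 $ j / p3 $ k * v $ k"
    "dot r3 v = v $ k / p3 $ k" for v
    by (simp_all add: r1_def r2_def r3_def dot_minus dot_axis)
  have ax: "axis i (1::complex) $ i = 1" "axis i (1::complex) $ j = 0" "axis i (1::complex) $ k = 0"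
    "axis j (1::complex) $ i = 0" "axis j (1::complex) $ j = 1" "axis j (1::complex) $ k = 0"
    using ij by (simp_all add: axis_def)
  have "plane_coords (axis i 1) (axis j 1) p3 r1 r2 r3"
  proof
    fix v
    let ?w = "dot r1 v *s axis i 1 + dot r2 v *s axis j 1 + dot r3 v *s p3"
    have w: "?w $ i = v $ i" "?w $ j = v $ j" "?w $ k = v $ k"
      using k by (simp_all add: dots ax)
    have "?w $ l = v $ l" for l
    proof -
      have "l = i \<or> l = j \<or> l = k"
        using ij(4) by blast
      then show ?thesis
        by (elim disjE) (simp_all only: w)
    qed
    then show "v = ?w"
      by (simp only: vec_eq_iff simp_thms)
  qed (use k in \<open>simp_all add: dots ax\<close>)
  then show ?thesis
    by (rule that)
qed

lemma quadratic_coeffs: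
  fixes b c :: "nat \<Rightarrow> complex"
  assumes "\<And>x y z :: complex. b 0 * x\<^sup>2 + b 1 * (x * y) + b 2 * y\<^sup>2 + b 3 * (x * z) + b 4 * (y * z)
    = c 0 * x\<^sup>2 + c 1 * (x * y) + c 2 * y\<^sup>2 + c 3 * (x * z) + c 4 * (y * z)"
    and "i < 5"
  shows "b i = c i"
proof -
  have "b 0 = c 0" "b 2 = c 2"
    using assms(1)[of 1 0 0] assms(1)[of 0 1 0] by simp_all
  moreover from this have "b 1 = c 1" "b 3 = c 3" "b 4 = c 4"
    using assms(1)[of 1 1 0] assms(1)[of 1 0 1] assms(1)[of 0 1 1] by simp_all
  moreover have "i = 0 \<or> i = 1 \<or> i = 2 \<or> i = 3 \<or> i = 4"
    using assms(2) by auto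
  ultimately show ?thesis
    by auto
qed

lemma embedded_blow_up_scroll:
  assumes emb: "blow_up_embedded P q S" and S: "variety S" "has_dim S 2"
  obtains M N where "scroll M N S" "preimage_on P q {P} = {pt (scroll_map M x y 1 0) | x y. x \<noteq> 0 \<or> y \<noteq> 0}"
    "\<forall>H. proj_line H \<and> P \<notin> H \<longrightarrow>
      (\<exists>c d. preimage_on P q H = {pt (scroll_map M x y (- (c * x + d * y)) 1) | x y. x \<noteq> 0 \<or> y \<noteq> 0})"
proof -
  obtain p3 where p3: "p3 \<noteq> 0" "P = pt p3"
    by (rule pt_cases)
  obtain p1 p2 r1 r2 r3 where "plane_coords p1 p2 p3 r1 r2 r3"
    by (rule plane_coords_exist[OF p3(1)])
  then interpret plane_coords p1 p2 p3 r1 r2 r3 .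
  have basis: "\<forall>i. hom_poly 2 (\<lambda>v. q v $ i) \<and> vanishes (\<lambda>v. q v $ i) P"
    and unique: "\<forall>Q. hom_poly 2 Q \<and> vanishes Q P \<longrightarrow> (\<exists>!a :: complex ^ 5. \<forall>v. Q v = (\<Sum>i\<in>UNIV. a $ i * q v $ i))"
    and S_image: "S = conic_map P q ` blow_up P"
    using emb unfolding blow_up_embedded_def conic_basis_def by blast+
  have "\<exists>c :: nat \<Rightarrow> complex. \<forall>x y z. q (vec3 x y z) $ i =
      c 0 * x\<^sup>2 + c 1 * (x * y) + c 2 * y\<^sup>2 + c 3 * (x * z) + c 4 * (y * z)" for i
  proof -
    have hom: "hom_poly 2 (\<lambda>v. q v $ i)"
      using basis by blast
    obtain c0 c1 c2 c3 c4 c5 where c: "\<forall>x y z. q (vec3 x y z) $ i =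
        c0 * x\<^sup>2 + c1 * (x * y) + c2 * y\<^sup>2 + c3 * (x * z) + c4 * (y * z) + c5 * z\<^sup>2"
      using form_in_coords[OF hom_poly_monomials_span[OF hom]] by blast
    have "q (vec3 0 0 1) $ i = 0"
      using basis p3 vanishes_hom[OF hom p3(1)] by (simp add: p3_eq[symmetric])
    then have "c5 = 0"
      using c by simp
    then show ?thesis
      using c by (intro exI[of _ "\<lambda>j. [c0, c1, c2, c3, c4] ! j"]) simp
  qed
  then obtain c :: "5 \<Rightarrow> nat \<Rightarrow> complex" where c: "\<forall>i x y z. q (vec3 x y z) $ i =
      c i 0 * x\<^sup>2 + c i 1 * (x * y) + c i 2 * y\<^sup>2 + c i 3 * (x * z) + c i 4 * (y * z)"
    by metis
  define M where "M j = (\<chi> i. c i j)" for j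
  have q: "q (vec3 x y z) = scroll_map M x y z 1" for x y z
    by (simp add: vec_eq_iff c scroll_map_def M_def mult.commute)
  define mono where "mono j x y z = (if j = 0 then x\<^sup>2 else if j = 1 then x * y else if j = 2 then y\<^sup>2
    else if j = 3 then x * z else y * z)" for j :: nat and x y z :: complex
  have "\<exists>a. \<forall>x y z. dot a (scroll_map M x y z 1) = mono j x y z" for j
  proof -
    let ?Q = "\<lambda>v. mono j (dot r1 v) (dot r2 v) (dot r3 v)"
    have hom: "hom_poly 2 (\<lambda>v. dot a v * dot b v)" for a b :: "complex ^ 3"
      using hom_poly_mult[OF hom_poly_dot[of a] hom_poly_dot[of b]] by (simp add: numeral_2_eq_2)
    have "hom_poly 2 ?Q"
      unfolding mono_def power2_eq_square using hom by (cases "j = 0"; cases "j = 1"; cases "j = 2"; cases "j = 3") auto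
    moreover from this have "vanishes ?Q P"
      unfolding p3(2) by (subst vanishes_hom[OF _ p3(1)]) (auto simp: mono_def r1 r2)
    ultimately obtain a where "\<forall>v. ?Q v = (\<Sum>i\<in>UNIV. a $ i * q v $ i)"
      using unique by blast
    then have "\<forall>x y z. dot a (q (vec3 x y z)) = mono j x y z"
      by (metis dot_def dot_vec3)
    then show ?thesis
      unfolding q by blast
  qed
  then obtain N where N: "\<forall>j x y z. dot (N j) (scroll_map M x y z 1) = mono j x y z"
    by metis
  \<comment> \<open>Expanding \<open>N i\<close> applied to \<open>scroll_map M\<close> and
    comparing coefficients of quadratic forms.\<close>
  have dual: "dot (N i) (M j) = (if i = j then 1 else 0)" if "i < 5" "j < 5" for i j
  proof (rule quadratic_coeffs[where c = "\<lambda>j. if i = j then 1 else 0"])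
    fix x y z
    have "dot (N i) (M 0) * x\<^sup>2 + dot (N i) (M 1) * (x * y) + dot (N i) (M 2) * y\<^sup>2 + dot (N i) (M 3) * (x * z) + dot (N i) (M 4) * (y * z)
        = dot (N i) (scroll_map M x y z 1)"
      by (simp add: scroll_map_def mult.commute)
    also have "\<dots> = (if i = 0 then 1 else 0) * x\<^sup>2 + (if i = 1 then 1 else 0) * (x * y) + (if i = 2 then 1 else 0) * y\<^sup>2
        + (if i = 3 then 1 else 0) * (x * z) + (if i = 4 then 1 else 0) * (y * z)"
      using that(1) by (auto simp: N mono_def less_Suc_eq numeral_eq_Suc)
    finally show "dot (N i) (M 0) * x\<^sup>2 + dot (N i) (M 1) * (x * y) + dot (N i) (M 2) * y\<^sup>2 + dot (N i) (M 3) * (x * z) + dot (N i) (M 4) * (y * z)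
        = (if i = 0 then 1 else 0) * x\<^sup>2 + (if i = 1 then 1 else 0) * (x * y) + (if i = 2 then 1 else 0) * y\<^sup>2
        + (if i = 3 then 1 else 0) * (x * z) + (if i = 4 then 1 else 0) * (y * z)" .
  qed (rule that)
  let ?\<Phi> = "scroll_map M"
  have nz: "?\<Phi> x y z e \<noteq> 0" if "valid x y z e" for x y z e
  proof
    assume 0: "?\<Phi> x y z e = 0"
    have "dot (N i) (?\<Phi> x y z e) = 0" for i
      by (simp add: 0)
    from this[of 0] this[of 2] this[of 3] this[of 4] show False
      using that by (auto simp: scroll_map_def dual valid_def)
  qed
  have scale: "?\<Phi> x y (k * z) (k * e) = k *s ?\<Phi> x y z e" for x y z e k
    by (simp add: scroll_map_def vector_add_ldistrib vector_smult_assoc algebra_simps)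
  have P_eq: "pt (vec3 x y z) = P \<longleftrightarrow> x = 0 \<and> y = 0" if "vec3 x y z \<noteq> 0" for x y z
  proof -
    have "pt p3 = pt (vec3 x y z) \<longleftrightarrow> (\<exists>k. vec3 x y z = k *s p3)"
      by (rule pt_eq_iff[OF p3(1) that])
    also have "\<dots> \<longleftrightarrow> x = 0 \<and> y = 0"
    proof
      assume "\<exists>k. vec3 x y z = k *s p3"
      then obtain k where "vec3 x y z = k *s p3"
        by blast
      then have "dot r1 (vec3 x y z) = k * dot r1 p3" "dot r2 (vec3 x y z) = k * dot r2 p3"
        by simp_all
      then show "x = 0 \<and> y = 0"
        by (simp add: r1 r2)
    next
      assume "x = 0 \<and> y = 0"
      then show "\<exists>k. vec3 x y z = k *s p3"
        by (intro exI[of _ z]) (simp add: vec3_def)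
    qed
    finally show ?thesis
      using p3(2) by auto
  qed
  have off_P: "conic_map P q (pt (vec3 x y z), L) = pt (?\<Phi> x y z 1)" if xy: "x \<noteq> 0 \<or> y \<noteq> 0" for x y z L
  proof -
    have v0: "vec3 x y z \<noteq> 0"
      using xy by (auto simp: vec3_eq_0)
    have ne: "pt (vec3 x y z) \<noteq> P"
      using P_eq[OF v0] xy by auto
    have v: "valid x y z 1"
      using xy by (simp add: valid_def)
    \<comment> \<open>The condition inside \<open>THE\<close> is an equation for y', so the
      description is uniquely satisfied.\<close>
    have eq: "(\<forall>v\<in>lin (pt (vec3 x y z)). q v \<in> lin y') \<longleftrightarrow> y' = pt (?\<Phi> x y z 1)" for y'
    proof
      assume *: "\<forall>v\<in>lin (pt (vec3 x y z)). q v \<in> lin y'"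
      have "vec3 x y z \<in> lin (pt (vec3 x y z))"
        unfolding lin_pt[OF v0] by (rule image_eqI[of _ _ 1]) simp_all
      then have "?\<Phi> x y z 1 \<in> lin y'"
        using * q by metis
      then show "y' = pt (?\<Phi> x y z 1)"
        by (rule pt_eqI[OF nz[OF v]])
    next
      assume y': "y' = pt (?\<Phi> x y z 1)"
      show "\<forall>v\<in>lin (pt (vec3 x y z)). q v \<in> lin y'"
      proof
        fix v assume "v \<in> lin (pt (vec3 x y z))"
        then obtain k where "v = k *s vec3 x y z"
          unfolding lin_pt[OF v0] by blast
        then have "q v = ?\<Phi> (k * x) (k * y) (k * z) 1"
          by (simp add: vec3_smult q)
        also have "\<dots> = k\<^sup>2 *s ?\<Phi> x y z 1"
          by (simp add: scroll_map_def vector_add_ldistrib vector_smult_assoc power2_eq_square algebra_simps)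
        finally show "q v \<in> lin y'"
          unfolding y' lin_pt[OF nz[OF v]] by blast
      qed
    qed
    show ?thesis
      unfolding conic_map_def using ne by (simp add: eq)
  qed
  have at_P: "conic_map P q (P, hyperplane a) = pt (?\<Phi> x0 y0 1 0)"
    if a: "dot a p3 = 0" and xy0: "x0 = dot a p2" "y0 = - dot a p1" "x0 \<noteq> 0 \<or> y0 \<noteq> 0" for a x0 y0
  proof -
    have v: "valid x0 y0 1 0"
      using xy0 by (simp add: valid_def)
    \<comment> \<open>To first order at P only the terms x z and y z of a conic contribute, with z
      replaced by its value at P. This is \<open>scroll_map\<close> at z = 1, e = 0.\<close>
    have dir: "(\<chi> i. dir_deriv (\<lambda>u. q u $ i) (k *s p3) (vec3 x y z)) = k *s ?\<Phi> x y 1 0" for k x y z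
    proof -
      have "dir_deriv (\<lambda>u. q u $ i) (k *s p3) (vec3 x y z) = (k *s ?\<Phi> x y 1 0) $ i" for i
      proof -
        have arg: "k *s p3 + t *s vec3 x y z = vec3 (t * x) (t * y) (k + t * z)" for t
          by (simp add: vec3_def vector_add_ldistrib vector_smult_assoc vector_sadd_rdistrib algebra_simps)
        have "((\<lambda>t. ?\<Phi> (t * x) (t * y) (k + t * z) 1 $ i) has_field_derivative (k *s ?\<Phi> x y 1 0) $ i) (at 0)"
          unfolding scroll_map_def by (auto intro!: derivative_eq_intros simp: algebra_simps)
        then show ?thesis
          unfolding dir_deriv_def arg q by (rule DERIV_imp_deriv)
      qed
      then show ?thesis
        by (simp add: vec_eq_iff)
    qed
    have a_vec3: "dot a (vec3 x y z) = y * x0 - x * y0" for x y z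
      by (simp add: vec3_def a xy0)
    have eq: "(\<forall>v\<in>lin P. \<forall>z\<in>hyperplane a. \<forall>w\<in>lin z. (\<chi> i. dir_deriv (\<lambda>u. q u $ i) v w) \<in> lin y')
        \<longleftrightarrow> y' = pt (?\<Phi> x0 y0 1 0)" for y'
    proof
      assume *: "\<forall>v\<in>lin P. \<forall>z\<in>hyperplane a. \<forall>w\<in>lin z. (\<chi> i. dir_deriv (\<lambda>u. q u $ i) v w) \<in> lin y'"
      have w0: "vec3 x0 y0 0 \<noteq> 0"
        using xy0 by (auto simp: vec3_eq_0)
      have "1 *s p3 \<in> lin P"
        unfolding p3(2) lin_pt[OF p3(1)] by blast
      moreover have "pt (vec3 x0 y0 0) \<in> hyperplane a"
        by (simp add: in_hyperplane[OF w0] a_vec3)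
      moreover have "vec3 x0 y0 0 \<in> lin (pt (vec3 x0 y0 0))"
        unfolding lin_pt[OF w0] by (rule image_eqI[of _ _ 1]) simp_all
      ultimately have "1 *s ?\<Phi> x0 y0 1 0 \<in> lin y'"
        using * dir by metis
      then show "y' = pt (?\<Phi> x0 y0 1 0)"
        by (intro pt_eqI[OF nz[OF v]]) simp
    next
      assume y': "y' = pt (?\<Phi> x0 y0 1 0)"
      show "\<forall>v\<in>lin P. \<forall>z\<in>hyperplane a. \<forall>w\<in>lin z. (\<chi> i. dir_deriv (\<lambda>u. q u $ i) v w) \<in> lin y'"
      proof (intro ballI)
        fix v z w assume vzw: "v \<in> lin P" "z \<in> hyperplane a" "w \<in> lin z"
        obtain k where k: "v = k *s p3"
          using vzw(1) unfolding p3(2) lin_pt[OF p3(1)] by blast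
        obtain x y t where w: "w = vec3 x y t"
          by (rule vec3_cases)
        have "dot a w = 0"
          using vzw(2,3) by (auto simp: hyperplane_dot vanishes_def)
        then have "y * x0 = x * y0"
          unfolding w a_vec3 by simp
        \<comment> \<open>Modulo p3 all vectors of the line through P are multiples of (x0, y0), so
          they have the same image.\<close>
        then obtain \<mu> where \<mu>: "x = \<mu> * x0" "y = \<mu> * y0"
          using xy0(3) that by (cases "x0 = 0") (force simp: field_simps intro: that[of "y / y0"] that[of "x / x0"])+
        have "?\<Phi> x y 1 0 = \<mu> *s ?\<Phi> x0 y0 1 0"
          by (simp add: \<mu> scroll_map_def vector_add_ldistrib vector_smult_assoc)
        then have "(\<chi> i. dir_deriv (\<lambda>u. q u $ i) v w) = (k * \<mu>) *s ?\<Phi> x0 y0 1 0"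
          unfolding k w dir by (simp add: vector_smult_assoc)
        then show "(\<chi> i. dir_deriv (\<lambda>u. q u $ i) v w) \<in> lin y'"
          unfolding y' lin_pt[OF nz[OF v]] by blast
      qed
    qed
    show ?thesis
      unfolding conic_map_def by (simp add: eq)
  qed
  \<comment> \<open>The equation of the line joining P to the point with coordinates x, y,
    z.\<close>
  have line: "(pt (vec3 x y z), hyperplane (x *s r2 - y *s r1)) \<in> blow_up P" "(P, hyperplane (x *s r2 - y *s r1)) \<in> blow_up P"
      "conic_map P q (P, hyperplane (x *s r2 - y *s r1)) = pt (?\<Phi> x y 1 0)"
    if xy: "x \<noteq> 0 \<or> y \<noteq> 0" for x y z
  proof -
    let ?a = "x *s r2 - y *s r1"
    have a: "dot ?a p1 = - y" "dot ?a p2 = x" "dot ?a p3 = 0" "dot ?a (vec3 x y z) = 0"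
      by (simp_all add: dot_minus r1 r2)
    have "?a \<noteq> 0"
      using a xy by auto
    then have "proj_line (hyperplane ?a)"
      unfolding proj_line_def by blast
    moreover have "P \<in> hyperplane ?a"
      unfolding p3(2) in_hyperplane[OF p3(1)] by (rule a)
    moreover have "vec3 x y z \<noteq> 0"
      using xy by (auto simp: vec3_eq_0)
    then have "pt (vec3 x y z) \<in> hyperplane ?a"
      using a(4) by (simp add: in_hyperplane)
    ultimately show "(pt (vec3 x y z), hyperplane ?a) \<in> blow_up P" "(P, hyperplane ?a) \<in> blow_up P"
      by (simp_all add: blow_up_def)
    show "conic_map P q (P, hyperplane ?a) = pt (?\<Phi> x y 1 0)"
      by (rule at_P) (use a xy in auto)
  qed
  have over_P: "\<exists>x y. (x \<noteq> 0 \<or> y \<noteq> 0) \<and> conic_map P q (P, L) = pt (?\<Phi> x y 1 0)" if L: "(p, L) \<in> blow_up P" for p L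
  proof -
    obtain a where a: "a \<noteq> 0" "L = hyperplane a" "P \<in> hyperplane a"
      using L unfolding blow_up_def proj_line_def by blast
    have a3: "dot a p3 = 0"
      using a(3) unfolding p3(2) in_hyperplane[OF p3(1)] .
    have "dot a p2 \<noteq> 0 \<or> - dot a p1 \<noteq> 0"
    proof (rule ccontr)
      assume 0: "\<not> ?thesis"
      have "dot a v = 0" for v
        using expand[of v] 0 a3 by (metis (no_types, lifting) add_0 dot_linear(1,2) minus_zero mult_zero_right neg_0_equal_iff_equal)
      then show False
        using dot_eq_0 a(1) by blast
    qed
    then show ?thesis
      using at_P[OF a3 refl refl] a(2) by blast
  qed
  have off_cases: "\<exists>x y z. (x \<noteq> 0 \<or> y \<noteq> 0) \<and> p = pt (vec3 x y z)" if p: "p \<noteq> P" for p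
  proof -
    obtain v where v: "v \<noteq> 0" "p = pt v"
      by (rule pt_cases)
    obtain x y z where "v = vec3 x y z"
      by (rule vec3_cases)
    then show ?thesis
      using v P_eq p by blast
  qed
  have S_eq: "S = {pt (?\<Phi> x y z e) | x y z e. valid x y z e}"
  proof (intro equalityI subsetI)
    fix s assume "s \<in> S"
    then obtain p L where pL: "(p, L) \<in> blow_up P" "s = conic_map P q (p, L)"
      unfolding S_image by auto
    show "s \<in> {pt (?\<Phi> x y z e) | x y z e. valid x y z e}"
    proof (cases "p = P")
      case True
      then obtain x y where "x \<noteq> 0 \<or> y \<noteq> 0" "s = pt (?\<Phi> x y 1 0)"
        using over_P pL by blast
      moreover from this have "valid x y 1 0"
        by (simp add: valid_def)
      ultimately show ?thesis
        by blast
    next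
      case False
      then obtain x y z where "x \<noteq> 0 \<or> y \<noteq> 0" "p = pt (vec3 x y z)"
        using off_cases by blast
      moreover from this have "valid x y z 1"
        by (simp add: valid_def)
      ultimately show ?thesis
        using pL(2) off_P by blast
    qed
  next
    fix s assume "s \<in> {pt (?\<Phi> x y z e) | x y z e. valid x y z e}"
    then obtain x y z e where s: "s = pt (?\<Phi> x y z e)" and v: "valid x y z e"
      by blast
    then have xy: "x \<noteq> 0 \<or> y \<noteq> 0"
      by (simp add: valid_def)
    show "s \<in> S"
    proof (cases "e = 0")
      case True
      then have z: "z \<noteq> 0"
        using v by (simp add: valid_def)
      have "valid x y 1 0"
        using xy by (simp add: valid_def)
      then have "s = pt (?\<Phi> x y 1 0)"
        using scale[of x y z 1 0] True pt_smult[OF z nz] s by simp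
      then show ?thesis
        using line(2,3)[OF xy] unfolding S_image by (metis imageI)
    next
      case False
      have "valid x y (z / e) 1"
        using xy by (simp add: valid_def)
      then have "s = pt (?\<Phi> x y (z / e) 1)"
        using scale[of x y e "z / e" 1] pt_smult[OF False nz] s False by simp
      then show ?thesis
        using line(1)[OF xy] off_P[OF xy] unfolding S_image by (metis imageI)
    qed
  qed
  have scroll: "scroll M N S"
    by (rule scroll.intro[OF dual S_eq S])
  have pre_P: "preimage_on P q {P} = {pt (?\<Phi> x y 1 0) | x y. x \<noteq> 0 \<or> y \<noteq> 0}"
  proof (intro equalityI subsetI)
    fix s assume "s \<in> preimage_on P q {P}"
    then obtain L where "(P, L) \<in> blow_up P" "s = conic_map P q (P, L)"
      unfolding preimage_on_def by auto
    then show "s \<in> {pt (?\<Phi> x y 1 0) | x y. x \<noteq> 0 \<or> y \<noteq> 0}"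
      using over_P by blast
  next
    fix s assume "s \<in> {pt (?\<Phi> x y 1 0) | x y. x \<noteq> 0 \<or> y \<noteq> 0}"
    then obtain x y where xy: "x \<noteq> 0 \<or> y \<noteq> 0" "s = pt (?\<Phi> x y 1 0)"
      by blast
    show "s \<in> preimage_on P q {P}"
      unfolding preimage_on_def
      by (rule image_eqI[OF _ CollectI, where x = "(P, hyperplane (x *s r2 - y *s r1))"])
         (use line(2,3)[OF xy(1)] xy(2) in auto)
  qed
  have pre_H: "\<exists>c d. preimage_on P q H = {pt (?\<Phi> x y (- (c * x + d * y)) 1) | x y. x \<noteq> 0 \<or> y \<noteq> 0}"
    if H: "proj_line H" "P \<notin> H" for H
  proof -
    obtain h where h: "H = hyperplane h"
      using H(1) unfolding proj_line_def by blast
    have h3: "dot h p3 \<noteq> 0"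
      using H(2) unfolding h p3(2) in_hyperplane[OF p3(1)] .
    define c d where "c = dot h p1 / dot h p3" and "d = dot h p2 / dot h p3"
    have h_vec3: "dot h (vec3 x y z) = dot h p3 * (c * x + d * y + z)" for x y z
      using h3 by (simp add: vec3_def c_def d_def field_simps)
    have in_H: "pt (vec3 x y z) \<in> H \<longleftrightarrow> z = - (c * x + d * y)" if "x \<noteq> 0 \<or> y \<noteq> 0" for x y z
    proof -
      have "vec3 x y z \<noteq> 0"
        using that by (auto simp: vec3_eq_0)
      then have "pt (vec3 x y z) \<in> H \<longleftrightarrow> c * x + d * y + z = 0"
        unfolding h by (simp add: in_hyperplane h_vec3 h3)
      then show ?thesis
        using add_eq_0_iff[of "c * x + d * y" z] by simp
    qed
    have "preimage_on P q H = {pt (?\<Phi> x y (- (c * x + d * y)) 1) | x y. x \<noteq> 0 \<or> y \<noteq> 0}"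
    proof (intro equalityI subsetI)
      fix s assume "s \<in> preimage_on P q H"
      then obtain p L where pL: "(p, L) \<in> blow_up P" "p \<in> H" "s = conic_map P q (p, L)"
        unfolding preimage_on_def by auto
      then have "p \<noteq> P"
        using H by auto
      then obtain x y z where xyz: "x \<noteq> 0 \<or> y \<noteq> 0" "p = pt (vec3 x y z)"
        using off_cases by blast
      then have "z = - (c * x + d * y)"
        using in_H pL(2) by blast
      then show "s \<in> {pt (?\<Phi> x y (- (c * x + d * y)) 1) | x y. x \<noteq> 0 \<or> y \<noteq> 0}"
        using off_P[OF xyz(1)] pL(3) xyz by blast
    next
      fix s assume "s \<in> {pt (?\<Phi> x y (- (c * x + d * y)) 1) | x y. x \<noteq> 0 \<or> y \<noteq> 0}"
      then obtain x y where xy: "x \<noteq> 0 \<or> y \<noteq> 0" "s = pt (?\<Phi> x y (- (c * x + d * y)) 1)"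
        by blast
      show "s \<in> preimage_on P q H"
        unfolding preimage_on_def
        by (rule image_eqI[OF _ CollectI, where x = "(pt (vec3 x y (- (c * x + d * y))), hyperplane (x *s r2 - y *s r1))"])
           (use line(1)[OF xy(1)] off_P[OF xy(1)] in_H[OF xy(1)] xy(2) in auto)
    qed
    then show ?thesis
      by blast
  qed
  show ?thesis
    by (rule that[OF scroll pre_P]) (use pre_H in blast)
qed

section \<open>The bound and the extremal curves\<close>

text \<open>The least a admissible for \<open>cls\<close>: if no term had total degree a, then a - 1
  would be admissible too.\<close>

lemma total_degree_exists:
  assumes "f \<noteq> 0"
  obtains a where "cls a (degree f) f" "\<exists>k\<le>a. coeff (coeff f k) (a - k) \<noteq> 0"
proof -
  define a where "a = (LEAST a. cls a (degree f) f)"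
  have a: "cls a (degree f) f"
    unfolding a_def by (rule LeastI_ex[OF cls_exists])
  have "\<exists>k\<le>a. coeff (coeff f k) (a - k) \<noteq> 0"
  proof (rule ccontr)
    assume no: "\<not> ?thesis"
    have less: "k + i < a" if "coeff (coeff f k) i \<noteq> 0" for k i
    proof -
      have "k + i \<le> a"
        using a that by (auto simp: cls_def)
      moreover have "k + i \<noteq> a"
      proof
        assume "k + i = a"
        then have "k \<le> a" "a - k = i"
          by auto
        then show False
          using no that by metis
      qed
      ultimately show ?thesis
        by simp
    qed
    have "coeff (coeff f (degree f)) (degree (lead_coeff f)) \<noteq> 0"
      using assms by simp
    then have "a > 0"
      using less by fastforce
    have "cls (a - 1) (degree f) f"
      unfolding cls_def using less a by (fastforce simp: cls_def)
    then have "a \<le> a - 1"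
      unfolding a_def by (rule Least_le)
    then show False
      using \<open>a > 0\<close> by simp
  qed
  then show ?thesis
    using that a by blast
qed

context scroll
begin

text \<open>Degree at least 2 excludes the exceptional line and the lines of the ruling, so the
  curve has an equation on the chart. Its invariants are tied to d by uniqueness of the
  degree.\<close>

lemma curve_equation:
  assumes C: "curve_on S C" and d: "has_degree C d" "d \<ge> 2"
  obtains a m f where "good_equation a m f" "C = curve f" "m \<le> a" "d = a + m"
proof -
  have dim: "has_dim C 1"
    using C by (simp add: curve_on_def)
  have not_line: False if v: "v \<noteq> 0" and line: "\<And>p. p \<in> C \<Longrightarrow> \<exists>s t. s *s v + t *s w \<noteq> 0 \<and> p = pt (s *s v + t *s w)" for v w
    using degree_le_1_in_line[OF dim d(1) v line] d(2) by auto
  have nE: "\<not> C \<subseteq> Exc"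
  proof
    assume CE: "C \<subseteq> Exc"
    show False
    proof (rule not_line[of "\<Phi> 1 0 1 0" "\<Phi> 0 1 1 0"])
      fix p assume "p \<in> C"
      then obtain x y where xy: "p = pt (\<Phi> x y 1 0)" "x \<noteq> 0 \<or> y \<noteq> 0"
        using CE unfolding Exc_def by blast
      have "\<Phi> x y 1 0 = x *s \<Phi> 1 0 1 0 + y *s \<Phi> 0 1 1 0"
        by (simp add: scroll_map_def)
      then show "\<exists>s t. s *s \<Phi> 1 0 1 0 + t *s \<Phi> 0 1 1 0 \<noteq> 0 \<and> p = pt (s *s \<Phi> 1 0 1 0 + t *s \<Phi> 0 1 1 0)"
        using xy \<Phi>_nonzero[of x y 1 0] by (intro exI[of _ x] exI[of _ y]) (simp add: valid_def)
    qed (simp add: \<Phi>_nonzero)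
  qed
  have nf: "\<not> C \<subseteq> fibre x y" if xy: "x \<noteq> 0 \<or> y \<noteq> 0" for x y
  proof
    assume Cf: "C \<subseteq> fibre x y"
    show False
    proof (rule not_line[of "\<Phi> x y 1 0" "\<Phi> x y 0 1"])
      fix p assume "p \<in> C"
      then obtain z e where ze: "p = pt (\<Phi> x y z e)" "z \<noteq> 0 \<or> e \<noteq> 0"
        using Cf unfolding fibre_def by blast
      have "\<Phi> x y z e = z *s \<Phi> x y 1 0 + e *s \<Phi> x y 0 1"
        by (simp add: scroll_map_def vector_add_ldistrib vector_smult_assoc algebra_simps)
      then show "\<exists>s t. s *s \<Phi> x y 1 0 + t *s \<Phi> x y 0 1 \<noteq> 0 \<and> p = pt (s *s \<Phi> x y 1 0 + t *s \<Phi> x y 0 1)"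
        using ze xy \<Phi>_nonzero[of x y z e] by (intro exI[of _ z] exI[of _ e]) (simp add: valid_def)
    qed (use xy in \<open>simp add: \<Phi>_nonzero valid_def\<close>)
  qed
  obtain f where f: "irreducible f" "degree f > 0" "C = curve f"
    using curve_cases[OF C nE nf[of 0 1]] nf[of 1] by (metis zero_neq_one)
  then have "f \<noteq> 0"
    by auto
  then obtain a where a: "cls a (degree f) f" "\<exists>k\<le>a. coeff (coeff f k) (a - k) \<noteq> 0"
    by (rule total_degree_exists)
  have good: "good_equation a (degree f) f"
    using f a by (simp add: good_equation_def)
  \<comment> \<open>A term with the top power of u has total degree at least
    \<open>degree f\<close>, which gives m \<le> a.\<close>
  have "coeff (coeff f (degree f)) (degree (lead_coeff f)) \<noteq> 0"
    using \<open>f \<noteq> 0\<close> by simp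
  then have "degree f \<le> a"
    using a(1) unfolding cls_def by (metis add_leD1)
  moreover have "d = a + degree f"
    using curve_degree_unique[OF dim d(1)] good_curve_degree[OF good] f(3) by blast
  ultimately show ?thesis
    using that good f(3) by blast
qed

lemma intersection_bound:
  assumes "curve_on S C1" "has_degree C1 d1" "d1 \<ge> 2" "curve_on S C2" "has_degree C2 d2" "d2 \<ge> 2" "C1 \<noteq> C2"
  shows "finite (C1 \<inter> C2) \<and> card (C1 \<inter> C2) \<le> B d1 d2"
proof -
  obtain a1 m1 f1 where 1: "good_equation a1 m1 f1" "C1 = curve f1" "m1 \<le> a1" "d1 = a1 + m1"
    by (rule curve_equation[OF assms(1-3)])
  obtain a2 m2 f2 where 2: "good_equation a2 m2 f2" "C2 = curve f2" "m2 \<le> a2" "d2 = a2 + m2"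
    by (rule curve_equation[OF assms(4-6)])
  have "finite (curve f1 \<inter> curve f2)" "card (curve f1 \<inter> curve f2) + m1 * m2 \<le> a1 * m2 + a2 * m1"
    using curve_intersection[of a1 m1 f1 a2 m2 f2] 1 2 assms(7) by (auto simp: good_equation_def)
  moreover have "1 \<le> m1" "1 \<le> m2"
    using 1(1) 2(1) by (auto simp: good_equation_def)
  ultimately show ?thesis
    using intersection_number_le_B[of m1 a1 m2 a2] 1 2 by simp
qed

lemma curve_has_class:
  assumes f: "good_equation a m f" "transversal f" "m \<le> a"
    and E: "preimage_on P q {P} = Exc"
    and H: "\<forall>H. proj_line H \<and> P \<notin> H \<longrightarrow> (\<exists>c d. preimage_on P q H = curve [:[:c, d:], 1:])"
  shows "has_class P q S (curve f) (int a) (int a - int m)"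
  unfolding has_class_def E
proof (intro allI impI)
  fix H' assume "proj_line H' \<and> P \<notin> H'"
  then obtain c d where "preimage_on P q H' = curve [:[:c, d:], 1:]"
    using H by blast
  then show "lin_equiv S (frag_of (curve f))
      (frag_cmul (int a) (frag_of (preimage_on P q H')) - frag_cmul (int a - int m) (frag_of Exc))"
    using lin_equiv_curve[OF f] by simp
qed

lemma even_example:
  assumes E: "preimage_on P q {P} = Exc"
    and H: "\<forall>H. proj_line H \<and> P \<notin> H \<longrightarrow> (\<exists>c d. preimage_on P q H = curve [:[:c, d:], 1:])"
    and d: "d1 \<ge> 2" "d2 \<ge> 2" "even d1 \<and> even d2 \<and> d1 \<le> d2 \<or> even d1 \<and> odd d2"
  shows "\<exists>C1 C2. curve_on S C1 \<and> curve_on S C2 \<and> C1 \<noteq> C2 \<and> has_degree C1 d1 \<and> has_degree C2 d2 \<and>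
    has_class P q S C1 (int d1 div 2) 0 \<and> has_class P q S C2 (int d2 - 1) (int d2 - 2) \<and>
    finite (C1 \<inter> C2) \<and> card (C1 \<inter> C2) = B d1 d2"
proof -
  obtain n where n: "d1 = 2 * n"
    using d(3) by (auto elim: evenE)
  \<comment> \<open>The section u = t ^ k has invariants (k, 1), so k = d2 - 1 produces degree d2
    and class (d2 - 1) h - (d2 - 2) e.\<close>
  define k where "k = d2 - 1"
  have nk: "n > 0" "k > 0" "d2 = k + 1"
    using d n by (auto simp: k_def)
  let ?C1 = "curve (even_curve n)" and ?C2 = "curve (section_curve k)"
  have C: "curve_on S ?C1" "curve_on S ?C2"
    using good_curve_on good_even_curve good_section_curve nk by blast+
  have int: "finite (?C1 \<inter> ?C2)" "card (?C1 \<inter> ?C2) = n * k"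
    using even_section_intersection nk by blast+
  have "has_degree ?C1 d1" "has_degree ?C2 d2"
    using good_curve_degree[OF good_even_curve[OF nk(1)]] good_curve_degree[OF good_section_curve[OF nk(2)]] n nk(3)
    by (simp_all add: mult_2)
  moreover have "has_class P q S ?C1 (int d1 div 2) 0"
    using curve_has_class[OF good_even_curve[OF nk(1)] transversal_even_curve le_refl E H] n by simp
  moreover have "has_class P q S ?C2 (int d2 - 1) (int d2 - 2)"
    using curve_has_class[OF good_section_curve[OF nk(2)] transversal_section_curve _ E H] nk by simp
  moreover have "?C1 \<noteq> ?C2"
    using curve_infinite[OF C(1)] int(1) by auto
  moreover have "B d1 d2 = n * k"
    using d n by (simp add: B_def k_def)
  ultimately show ?thesis
    using C int by (intro exI[of _ ?C1] exI[of _ ?C2]) simp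
qed

lemma odd_example:
  assumes E: "preimage_on P q {P} = Exc"
    and H: "\<forall>H. proj_line H \<and> P \<notin> H \<longrightarrow> (\<exists>c d. preimage_on P q H = curve [:[:c, d:], 1:])"
    and d: "d1 \<ge> 2" "d2 \<ge> 2" "odd d1" "odd d2"
  shows "\<exists>C1 C2. curve_on S C1 \<and> curve_on S C2 \<and> C1 \<noteq> C2 \<and> has_degree C1 d1 \<and> has_degree C2 d2 \<and>
    has_class P q S C1 ((int d1 + 1) div 2) 1 \<and> has_class P q S C2 (int d2 - 1) (int d2 - 2) \<and>
    finite (C1 \<inter> C2) \<and> card (C1 \<inter> C2) = B d1 d2"
proof -
  obtain n' where n': "d1 = 2 * n' + 1"
    using d(3) by (auto elim: oddE)
  \<comment> \<open>n = (d1 + 1) / 2, so that the curve with invariants (n, n - 1) has degree 2 n -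
    1 = d1 and class n h - e.\<close>
  define n k where "n = n' + 1" and "k = d2 - 1"
  have "d2 \<noteq> 2"
    using d(4) by auto
  then have nk: "n > 1" "k > 1" "k > 0" "d2 = k + 1" "d1 = n + (n - 1)"
    using d(1,2) n' by (auto simp: n_def k_def)
  let ?C1 = "curve (odd_curve n)" and ?C2 = "curve (section_curve k)"
  have C: "curve_on S ?C1" "curve_on S ?C2"
    using good_curve_on good_odd_curve good_section_curve nk by blast+
  have int: "finite (?C1 \<inter> ?C2)" "card (?C1 \<inter> ?C2) = (n - 1) * k + 1"
    using odd_section_intersection nk by blast+
  have "has_degree ?C1 d1" "has_degree ?C2 d2"
    using good_curve_degree[OF good_odd_curve[OF nk(1)]] good_curve_degree[OF good_section_curve[OF nk(3)]] nk(4,5)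
    by simp_all
  moreover have "has_class P q S ?C1 ((int d1 + 1) div 2) 1"
    using curve_has_class[OF good_odd_curve[OF nk(1)] transversal_odd_curve _ E H] n' by (simp add: n_def)
  moreover have "has_class P q S ?C2 (int d2 - 1) (int d2 - 2)"
    using curve_has_class[OF good_section_curve[OF nk(3)] transversal_section_curve _ E H] nk by simp
  moreover have "?C1 \<noteq> ?C2"
    using curve_infinite[OF C(1)] int(1) by auto
  moreover have "B d1 d2 = (n - 1) * k + 1"
    using d n' by (simp add: B_def k_def n_def)
  ultimately show ?thesis
    using C int by (intro exI[of _ ?C1] exI[of _ ?C2]) simp
qed

end

theorem theorem3p1:
  fixes S :: "5 proj set" and P :: "3 proj" and q :: "complex ^ 3 \<Rightarrow> complex ^ 5"
  assumes "smooth_nondegenerate_surface S" and "has_degree S 3"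
    and "blow_up_embedded P q S"
  shows
    "(\<forall>C1 C2 d1 d2. d1 \<ge> 2 \<and> d2 \<ge> 2 \<and> curve_on S C1 \<and> curve_on S C2 \<and> C1 \<noteq> C2 \<and>
        has_degree C1 d1 \<and> has_degree C2 d2 \<longrightarrow>
        finite (C1 \<inter> C2) \<and> card (C1 \<inter> C2) \<le> B d1 d2) \<and>
     (\<forall>d1 d2. d1 \<ge> 2 \<and> d2 \<ge> 2 \<longrightarrow>
        (\<exists>C1 C2. curve_on S C1 \<and> curve_on S C2 \<and> C1 \<noteq> C2 \<and>
           has_degree C1 d1 \<and> has_degree C2 d2 \<and> 
           finite (C1 \<inter> C2) \<and> card (C1 \<inter> C2) = B d1 d2)) \<and>
     (\<forall>d1 d2. d1 \<ge> 2 \<and> d2 \<ge> 2 \<and> (even d1 \<and> even d2 \<and> d1 \<le> d2 \<or> even d1 \<and> odd d2) \<longrightarrow>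
        (\<exists>C1 C2. curve_on S C1 \<and> curve_on S C2 \<and> C1 \<noteq> C2 \<and>
           has_degree C1 d1 \<and> has_degree C2 d2 \<and>
           has_class P q S C1 (int d1 div 2) 0 \<and>
           has_class P q S C2 (int d2 - 1) (int d2 - 2) \<and>
           finite (C1 \<inter> C2) \<and> card (C1 \<inter> C2) = B d1 d2)) \<and>
     (\<forall>d1 d2. d1 \<ge> 2 \<and> d2 \<ge> 2 \<and> odd d1 \<and> odd d2 \<longrightarrow>
        (\<exists>C1 C2. curve_on S C1 \<and> curve_on S C2 \<and> C1 \<noteq> C2 \<and>
           has_degree C1 d1 \<and> has_degree C2 d2 \<and>
           has_class P q S C1 ((int d1 + 1) div 2) 1 \<and>
           has_class P q S C2 (int d2 - 1) (int d2 - 2) \<and>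
           finite (C1 \<inter> C2) \<and> card (C1 \<inter> C2) = B d1 d2))"
proof -
  have S: "variety S" "has_dim S 2"
    using assms(1) by (auto simp: smooth_nondegenerate_surface_def smooth_variety_def)
  obtain M N where scroll: "scroll M N S"
    and pre_P: "preimage_on P q {P} = {pt (scroll_map M x y 1 0) | x y. x \<noteq> 0 \<or> y \<noteq> 0}"
    and pre_H: "\<forall>H. proj_line H \<and> P \<notin> H \<longrightarrow>
      (\<exists>c d. preimage_on P q H = {pt (scroll_map M x y (- (c * x + d * y)) 1) | x y. x \<noteq> 0 \<or> y \<noteq> 0})"
    by (rule embedded_blow_up_scroll[OF assms(3) S])
  interpret scroll M N S
    by (rule scroll)
  have E: "preimage_on P q {P} = Exc"
    unfolding pre_P Exc_def ..
  have H: "\<forall>H. proj_line H \<and> P \<notin> H \<longrightarrow> (\<exists>c d. preimage_on P q H = curve [:[:c, d:], 1:])"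
    using pre_H unfolding line_curve_eq .
  have ex: "\<exists>C1 C2. curve_on S C1 \<and> curve_on S C2 \<and> C1 \<noteq> C2 \<and> has_degree C1 d1 \<and> has_degree C2 d2 \<and>
      finite (C1 \<inter> C2) \<and> card (C1 \<inter> C2) = B d1 d2" if d: "d1 \<ge> 2" "d2 \<ge> 2" for d1 d2
  proof -
    consider "even d1 \<and> even d2 \<and> d1 \<le> d2 \<or> even d1 \<and> odd d2"
      | "even d2 \<and> even d1 \<and> d2 \<le> d1 \<or> even d2 \<and> odd d1" | "odd d1" "odd d2"
      by linarith
    then show ?thesis
    proof cases
      case 1
      from even_example[OF E H d this] show ?thesis
        by blast
    next
      \<comment> \<open>An odd first degree with an even second one, or even degrees in decreasing
        order: the same curves with their roles exchanged.\<close>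
      case 2
      from even_example[OF E H d(2,1) this] obtain C1 C2 where "curve_on S C1" "curve_on S C2" "C1 \<noteq> C2"
          "has_degree C1 d2" "has_degree C2 d1" "finite (C1 \<inter> C2)" "card (C1 \<inter> C2) = B d2 d1"
        by blast
      then show ?thesis
        by (intro exI[of _ C2] exI[of _ C1]) (auto simp: Int_commute B_commute)
    next
      case 3
      from odd_example[OF E H d this] show ?thesis
        by blast
    qed
  qed
  show ?thesis
    by (rule conjI[OF _ conjI[OF _ conjI]]; intro allI impI; elim conjE;
        rule intersection_bound ex even_example[OF E H] odd_example[OF E H]; assumption)
qed

end
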